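(* Let $g_n\colon\mathbb{D}\to\mathbb{D}$, $n\in\mathbb{N}$, be inner functions with $g_n(0)=0$, and let $G_n = g_n\circ\cdots\circ g_1$. (a) Assume that for every $0<\varepsilon<1$, $$\lim_{N\to\infty}\prod_{k=\lfloor N(1-\varepsilon)\rfloor}^{N}g_k'(0)=0.$$ Then the sequence $\{\widehat G_n\}_{n\in\mathbb{N}}$ is ergodic. (b) Assume that for every $\epsilon>0$ there exists $M_0$ such that for all integers $N>M>M_0$, $$\prod_{k=N-M}^{N}|g_k'(0)|<\epsilon.$$ Then the sequence $\{\widehat G_n\}_{n\in\mathbb{N}}$ is mixing.
   Context: $\mathbb{D}$ is the open unit disc in $\mathbb{C}$, $m$ (as a measure) is normalised Lebesgue measure on $\partial\mathbb{D}$, and $\mathbb{N}=\{1,2,3,\dots\}$. An analytic map $g\colon\mathbb{D}\to\mathbb{D}$ is inner if $\hat g(e^{i\theta})=\lim_{r\nearrow 1}g(re^{i\theta})$ exists and has modulus one for almost every $e^{i\theta}\in\partial\mathbb{D}$; $\hat g$ is its (a.e. defined) boundary map. If $g(0)=0$, then $\hat g$ preserves $m$. A sequence $\{T_n\}_{n\in\mathbb{N}}$ of measure-preserving maps of a probability space $(X,\mathcal{A},\mu)$ is called ergodic if $\lim_{N\to\infty}\left\|\frac1N\sum_{n=1}^N\varphi\circ T_n-\int_X\varphi\,d\mu\right\|_{2}=0$ for every complex-valued $\varphi\in L^2(\mu)$, and mixing if all its subsequences are ergodic. For boundary maps this is applied with $(X,\mu)=(\partial\mathbb{D},m)$. *)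

theory Defs
  imports "HOL-Complex_Analysis.Complex_Analysis" "HOL-Probability.Probability"
begin

text \<open>Normalised Lebesgue measure on the unit circle; as \<^const>\<open>lebesgue\<close> is the completion of
  \<^const>\<open>lborel\<close>, it lives on the completed Borel sets.\<close>

definition circle_measure :: "complex measure" where
  "circle_measure =
     completion (distr (uniform_measure lborel {0..2 * pi}) (restrict_space borel (sphere 0 1)) cis)"

lemma space_circle_measure [simp]: "space circle_measure = sphere 0 1"
  by (simp add: circle_measure_def space_restrict_space)

lemma prob_space_circle_measure: "prob_space circle_measure"
proof -
  have "prob_space (uniform_measure lborel {0..2 * pi})"
    by (rule prob_space_uniform_measure) auto
  moreover have "cis \<in> uniform_measure lborel {0..2 * pi} \<rightarrow>\<^sub>M restrict_space borel (sphere 0 1)"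
    by (rule measurable_restrict_space2)
      (auto intro!: borel_measurable_continuous_onI continuous_intros
        simp: measurable_cong_sets[OF sets_uniform_measure refl])
  ultimately have "prob_space
      (distr (uniform_measure lborel {0..2 * pi}) (restrict_space borel (sphere 0 1)) cis)"
    by (rule prob_space.prob_space_distr)
  then show ?thesis
    unfolding circle_measure_def by (rule prob_space.prob_space_completion)
qed

definition inner_function :: "(complex \<Rightarrow> complex) \<Rightarrow> bool" where
  "inner_function g \<longleftrightarrow>
     g holomorphic_on ball 0 1 \<and> g ` ball 0 1 \<subseteq> ball 0 1 \<and>
     (AE z in circle_measure.
        \<exists>l. ((\<lambda>r. g (of_real r * z)) \<longlongrightarrow> l) (at_left (1::real)) \<and> norm l = 1)"

text \<open>The boundary map of an inner function is defined only almost everywhere. To obtain a total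
  self-map of the circle, the value \<open>1\<close> is used on the exceptional null set.\<close>

definition boundary_map :: "(complex \<Rightarrow> complex) \<Rightarrow> complex \<Rightarrow> complex" where
  "boundary_map g z =
     (if \<exists>l. ((\<lambda>r. g (of_real r * z)) \<longlongrightarrow> l) (at_left (1::real)) \<and> norm l = 1
      then Lim (at_left (1::real)) (\<lambda>r. g (of_real r * z)) else 1)"

primrec iter_comp :: "(nat \<Rightarrow> 'a \<Rightarrow> 'a) \<Rightarrow> nat \<Rightarrow> 'a \<Rightarrow> 'a" where
  "iter_comp g 0 = id"
| "iter_comp g (Suc n) = g (Suc n) \<circ> iter_comp g n"

definition measure_preserving_map :: "'a measure \<Rightarrow> ('a \<Rightarrow> 'a) \<Rightarrow> bool" where
  "measure_preserving_map M T \<longleftrightarrow> T \<in> M \<rightarrow>\<^sub>M M \<and> distr M M T = M"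

definition square_integrable :: "'a measure \<Rightarrow> ('a \<Rightarrow> complex) \<Rightarrow> bool" where
  "square_integrable M f \<longleftrightarrow> f \<in> borel_measurable M \<and> integrable M (\<lambda>x. (norm (f x))\<^sup>2)"

definition L2_norm :: "'a measure \<Rightarrow> ('a \<Rightarrow> complex) \<Rightarrow> real" where
  "L2_norm M f = sqrt (\<integral>x. (norm (f x))\<^sup>2 \<partial>M)"

text \<open>Sequences of maps are indexed by \<open>1, 2, 3, \<dots>\<close>; the entry \<open>T 0\<close> is ignored.\<close>

definition ergodic_sequence :: "'a measure \<Rightarrow> (nat \<Rightarrow> 'a \<Rightarrow> 'a) \<Rightarrow> bool" where
  "ergodic_sequence M T \<longleftrightarrow>
     prob_space M \<and> (\<forall>n\<ge>1. measure_preserving_map M (T n)) \<and>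
     (\<forall>\<phi>. square_integrable M \<phi> \<longrightarrow>
        (\<lambda>N. L2_norm M
           (\<lambda>x. (1 / of_nat N) * (\<Sum>n=1..N. \<phi> (T n x)) - (\<integral>y. \<phi> y \<partial>M))) \<longlonglongrightarrow> 0)"

text \<open>A strictly increasing \<open>r :: nat \<Rightarrow> nat\<close> maps positive numbers to positive numbers, and
  every strictly increasing sequence of positive indices \<open>r 1 < r 2 < \<dots>\<close> extends to such a
  function by \<open>r 0 = 0\<close>.\<close>

definition mixing_sequence :: "'a measure \<Rightarrow> (nat \<Rightarrow> 'a \<Rightarrow> 'a) \<Rightarrow> bool" where
  "mixing_sequence M T \<longleftrightarrow>
     (\<forall>r. strict_mono r \<longrightarrow> ergodic_sequence M (\<lambda>n. T (r n)))"

end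

theory Submission
  imports Defs
begin

text \<open>Let \<open>G\<^sub>n = g\<^sub>n \<circ> \<dots> \<circ> g\<^sub>1\<close>. If \<open>f\<close> is inner with \<open>f 0 = 0\<close> and \<open>h\<close> is a self-map of the disc with
  \<open>h 0 = 0\<close>, then the \<open>k\<close>-th powers of the boundary maps of \<open>h \<circ> f\<close> and \<open>f\<close> have inner product
  \<open>(h' 0)\<^sup>k\<close>. Hence for \<open>m < n\<close> the \<open>k\<close>-th powers of the boundary maps of \<open>G\<^sub>n\<close> and \<open>G\<^sub>m\<close> have inner product
  \<open>(g\<^sub>m\<^sub>+\<^sub>1' 0 \<cdot> \<dots> \<cdot> g\<^sub>n' 0)\<^sup>k\<close>. Expanding the square of the ergodic average of \<open>z\<^sup>k\<close> reduces
  ergodicity to the smallness of most of these products, and trigonometric polynomials are dense in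
  \<open>L\<^sup>2\<close>. That \<open>G\<^sub>n\<close> has radial limits at all is Fatou's theorem; that these have modulus one
  follows from Bessel's inequality for the orthonormal powers of the boundary map of \<open>G\<^sub>n\<^sub>-\<^sub>1\<close>, since by Parseval the
  Taylor coefficients of the inner function \<open>g\<^sub>n\<close> are square summable with sum one.\<close>

section \<open>Integration on the unit circle\<close>

text \<open>For an initial block f and the following block h of a composition, the path r -> f (r z)
  is in general not a radius, so radial limits of h say nothing directly about
  \<open>h \<circ> f\<close>. Hence the boundary map of a composition is never written as a
  composition of boundary maps. Everything is read off from integrals of dilations z -> f (r z) with
  r < 1, whose mean values are exact, and r -> 1 is taken by bounded convergence.

  The exponent k costs nothing: by the Schwarz lemma the derivatives at 0 have modulus at most 1, so
  the k-th power of a product of them is at most the product in modulus, and one estimate serves all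
  k >= 1. For large n, hypothesis (a) makes the products small for all m < n except about \<epsilon>
  n of them; hypothesis (b) does so for all but boundedly many m. Along a subsequence r the
  exceptions in (b) do not multiply, because r n - r m >= n - m.

  The measure is complete, so its measurable sets are Borel only up to null sets; invariance and
  ergodicity are obtained for Borel sets and then transferred.\<close>

definition circle_borel :: "complex measure" where
  "circle_borel =
     distr (uniform_measure lborel {0..2 * pi}) (restrict_space borel (sphere 0 1)) cis"

lemma circle_measure_eq: "circle_measure = completion circle_borel"
  by (simp add: circle_measure_def circle_borel_def)

lemma space_circle_borel [simp]: "space circle_borel = sphere 0 1"
  by (simp add: circle_borel_def space_restrict_space)

lemma sets_circle_borel [measurable_cong]:
  "sets circle_borel = sets (restrict_space borel (sphere 0 1))"
  by (simp add: circle_borel_def)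

interpretation circle: prob_space circle_measure
  by (rule prob_space_circle_measure)

lemma measure_circle_sphere [simp]: "measure circle_measure (sphere 0 1) = 1"
  using circle.prob_space by simp

lemma measurable_cis_uniform:
  "cis \<in> uniform_measure lborel {0..2 * pi} \<rightarrow>\<^sub>M restrict_space borel (sphere 0 1)"
  by (rule measurable_restrict_space2)
    (auto intro!: borel_measurable_continuous_onI continuous_intros
      simp: measurable_cong_sets[OF sets_uniform_measure refl])

lemma uniform_measure_interval_eq_density:
  "uniform_measure lborel {0..2 * pi} =
   density lborel (\<lambda>x. ennreal (indicator {0..2 * pi} x / (2 * pi)))"
  unfolding uniform_measure_def
  by (intro arg_cong[where f="density lborel"] ext)
    (auto simp: indicator_def divide_ennreal ennreal_1[symmetric] simp del: ennreal_1)

lemma borel_measurable_circle_borelI: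
  fixes f :: "complex \<Rightarrow> 'b::topological_space"
  shows "continuous_on (sphere 0 1) f \<Longrightarrow> f \<in> borel_measurable circle_borel"
  by (subst measurable_cong_sets[OF sets_circle_borel refl])
    (rule borel_measurable_continuous_on_restrict)

lemma borel_measurable_circleI:
  fixes f :: "complex \<Rightarrow> 'b::topological_space"
  shows "continuous_on (sphere 0 1) f \<Longrightarrow> f \<in> borel_measurable circle_measure"
  unfolding circle_measure_eq by (intro measurable_completion borel_measurable_circle_borelI)

lemma integrable_circleI:
  fixes f :: "complex \<Rightarrow> 'b::{banach, second_countable_topology}"
  assumes "continuous_on (sphere 0 1) f"
  shows "integrable circle_measure f"
proof -
  have "compact (f ` sphere 0 1)"
    using assms by (intro compact_continuous_image) auto
  then obtain B where "\<And>z. z \<in> sphere 0 1 \<Longrightarrow> norm (f z) \<le> B"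
    by (meson bounded_iff compact_imp_bounded imageI)
  then show ?thesis
    by (intro circle.integrable_const_bound[of _ B] borel_measurable_circleI assms) auto
qed

text \<open>Bridge to the gauge integral over one period, the form in which contour integrals along
  \<open>circlepath\<close> unfold.\<close>

lemma integral_circle:
  fixes f :: "complex \<Rightarrow> 'b::euclidean_space"
  assumes "continuous_on (sphere 0 1) f"
  shows "integral\<^sup>L circle_measure f = (1 / (2 * pi)) *\<^sub>R integral {0..2 * pi} (\<lambda>t. f (cis t))"
proof -
  have meas: "f \<in> borel_measurable (restrict_space borel (sphere 0 1))"
    using assms by (rule borel_measurable_continuous_on_restrict)
  have cont: "continuous_on A (\<lambda>t. f (cis t))" for A
    by (rule continuous_on_compose2[OF assms]) (auto intro!: continuous_intros)
  have "integral\<^sup>L circle_measure f = (\<integral>t. f (cis t) \<partial>uniform_measure lborel {0..2 * pi})"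
    unfolding circle_measure_eq circle_borel_def using meas
    by (subst integral_completion) (auto simp: integral_distr measurable_cis_uniform)
  also have "\<dots> = (\<integral>t. (indicator {0..2 * pi} t / (2 * pi)) *\<^sub>R f (cis t) \<partial>lborel)"
    unfolding uniform_measure_interval_eq_density
    by (subst integral_density) (auto intro!: borel_measurable_continuous_onI cont)
  also have "\<dots> = (\<integral>t. (1 / (2 * pi)) *\<^sub>R (indicator {0..2 * pi} t *\<^sub>R f (cis t)) \<partial>lborel)"
    by simp
  also have "\<dots> = (1 / (2 * pi)) *\<^sub>R (LINT t:{0..2 * pi}|lborel. f (cis t))"
    unfolding set_lebesgue_integral_def by (rule integral_scaleR_right) 
  also have "(LINT t:{0..2 * pi}|lborel. f (cis t)) = integral {0..2 * pi} (\<lambda>t. f (cis t))"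
    by (intro set_borel_integral_eq_integral borel_integrable_atLeastAtMost' cont)
  finally show ?thesis .
qed

section \<open>Null sets on the circle and null sets of angles\<close>

lemma negligible_periodic:
  fixes B :: "real set"
  assumes per: "\<And>t k. t \<in> B \<Longrightarrow> t + 2 * pi * of_int k \<in> B"
    and neg: "negligible (B \<inter> {0..2 * pi})"
  shows "negligible B"
proof -
  \<comment> \<open>Subtracting \<open>2 * pi * k\<close> moves an angle into one period, so
    countably many translates of the part in \<open>{0..2 * pi}\<close> cover
    \<open>B\<close>.\<close>
  have "B \<subseteq> (\<Union>k::int. (+) (2 * pi * of_int k) ` (B \<inter> {0..2 * pi}))"
  proof
    fix t assume t: "t \<in> B"
    define k where "k = \<lfloor>t / (2 * pi)\<rfloor>"
    have "of_int k \<le> t / (2 * pi)" "t / (2 * pi) < of_int k + 1"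
      unfolding k_def by linarith+
    then have "2 * pi * of_int k \<le> t" "t \<le> 2 * pi * of_int k + 2 * pi"
      by (simp_all add: field_simps)
    moreover have "t - 2 * pi * of_int k \<in> B"
      using per[OF t, of "- k"] by simp
    ultimately show "t \<in> (\<Union>k::int. (+) (2 * pi * of_int k) ` (B \<inter> {0..2 * pi}))"
      by (intro UN_I[of k] image_eqI[of _ _ "t - 2 * pi * of_int k"]) auto
  qed
  moreover have "negligible (\<Union>k::int. (+) (2 * pi * of_int k) ` (B \<inter> {0..2 * pi}))"
    by (intro negligible_countable_Union[of "range _"]) (auto intro: negligible_translation neg)
  ultimately show ?thesis
    using negligible_subset by blast
qed

lemma Arg2pi_cis_eq: "0 \<le> t \<Longrightarrow> t < 2 * pi \<Longrightarrow> Arg2pi (cis t) = t"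
  using Arg2pi_unique[of 1 t "cis t"] by (simp add: cis_conv_exp)

text \<open>\<open>Arg2pi\<close> is continuous off the nonnegative real axis and equals 0 on
  it.\<close>

lemma borel_measurable_Arg2pi: "Arg2pi \<in> borel_measurable borel"
proof -
  have "(\<lambda>z. if z \<in> - \<real>\<^sub>\<ge>\<^sub>0 then Arg2pi z else 0) \<in> borel_measurable borel"
    by (intro borel_measurable_continuous_on_if continuous_at_imp_continuous_on)
      (auto intro: continuous_at_Arg2pi)
  also have "(\<lambda>z. if z \<in> - \<real>\<^sub>\<ge>\<^sub>0 then Arg2pi z else 0) = Arg2pi"
    by (auto simp: fun_eq_iff nonneg_Reals_def Arg2pi_of_real)
  finally show ?thesis .
qed

text \<open>Differentiation of integrals takes place on the real line, so null sets are moved there,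
  with angles not confined to one period. For the converse, the negligible set is enlarged to a
  Borel null set \<open>N\<close>, whose preimage under \<open>Arg2pi\<close> is Borel on the
  circle.\<close>

lemma AE_circle_iff_negligible:
  "(AE z in circle_measure. P z) \<longleftrightarrow> negligible {t. \<not> P (cis t)}"
proof
  assume "AE z in circle_measure. P z"
  then have "AE z in circle_borel. P z"
    unfolding circle_measure_eq AE_completion_iff .
  then have "AE t in uniform_measure lborel {0..2 * pi}. P (cis t)"
    unfolding circle_borel_def by (rule AE_distrD[OF measurable_cis_uniform])
  then have "AE t in lborel. t \<in> {0..2 * pi} \<longrightarrow> P (cis t)"
    by (subst (asm) AE_uniform_measure) auto
  then have "negligible ({t. \<not> P (cis t)} \<inter> {0..2 * pi})"
    by (subst (asm) AE_completion_iff[symmetric], subst (asm) eventually_ae_filter_negligible)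
      (auto elim!: negligible_subset)
  then show "negligible {t. \<not> P (cis t)}"
    by (rule negligible_periodic[rotated]) (simp add: cis_mult[symmetric] cis_multiple_2pi)
next
  assume "negligible {t. \<not> P (cis t)}"
  then have "AE t in lborel. P (cis t)"
    by (subst AE_completion_iff[symmetric], subst eventually_ae_filter_negligible) auto
  then obtain N where N: "N \<in> null_sets lborel" "{t. \<not> P (cis t)} \<subseteq> N"
    by (auto elim!: AE_E simp: null_sets_def)
  \<comment> \<open>At \<open>t = 2 * pi\<close> the value \<open>Arg2pi (cis t)\<close> is 0 and
    not \<open>t\<close>, so this single angle is discarded.\<close>
  have "AE t in lborel. t \<in> {0..2 * pi} \<longrightarrow> Arg2pi (cis t) \<notin> N"
    using AE_not_in[OF N(1)] AE_lborel_singleton[of "2 * pi"]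
    by eventually_elim (auto simp: Arg2pi_cis_eq)
  then have *: "AE t in uniform_measure lborel {0..2 * pi}. Arg2pi (cis t) \<notin> N"
    by (rule AE_uniform_measureI[rotated]) simp
  have "{z \<in> sphere 0 1. Arg2pi z \<notin> N} \<in> sets (restrict_space borel (sphere 0 1))"
  proof -
    have "Arg2pi -` (- N) \<inter> space borel \<in> sets borel"
      using N by (intro measurable_sets[OF borel_measurable_Arg2pi]) (auto simp: null_sets_def)
    then show ?thesis
      by (auto simp: sets_restrict_space image_iff intro!: bexI[of _ "Arg2pi -` (- N)"])
  qed
  then have "AE z in circle_borel. Arg2pi z \<notin> N"
    unfolding circle_borel_def using *
    by (subst AE_distr_iff) (auto simp: measurable_cis_uniform space_restrict_space)
  moreover have "AE z in circle_borel. z \<in> sphere 0 1"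
    using AE_space[of circle_borel] by simp
  ultimately have "AE z in circle_borel. P z"
  proof eventually_elim
    case (elim z)
    then have "z = cis (Arg2pi z)"
      using Arg2pi_eq[of z] by (simp add: cis_conv_exp)
    with elim N(2) show ?case
      by (metis (mono_tags, lifting) mem_Collect_eq subsetD)
  qed
  then show "AE z in circle_measure. P z"
    unfolding circle_measure_eq AE_completion_iff .
qed

text \<open>Cauchy's formula at the centre: along the unit circle dz / z is i dt, so the contour
  integral is the mean over the angle.\<close>

lemma integral_circle_mean_value:
  assumes "F holomorphic_on cball 0 1"
  shows "integral\<^sup>L circle_measure F = F 0"
proof -
  have cont: "continuous_on (cball 0 1) F"
    using assms by (rule holomorphic_on_imp_continuous_on)
  have "((\<lambda>u. F u / (u - 0)) has_contour_integral 2 * of_real pi * \<i> * F 0) (circlepath 0 1)"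
    by (rule Cauchy_integral_circlepath_simple[OF assms]) auto
  then have "((\<lambda>t. F (cis t) / cis t * \<i> * cis t) has_integral 2 * of_real pi * \<i> * F 0) {0..2 * pi}"
    unfolding circlepath_def by (subst (asm) has_contour_integral_part_circlepath_iff) auto
  then have "((\<lambda>t. \<i> * F (cis t)) has_integral \<i> * (2 * of_real pi * F 0)) {0..2 * pi}"
    by (simp add: mult_ac)
  then have "((\<lambda>t. (- \<i>) * (\<i> * F (cis t))) has_integral (- \<i>) * (\<i> * (2 * of_real pi * F 0))) {0..2 * pi}"
    by (rule has_integral_mult_right)
  then have "integral {0..2 * pi} (\<lambda>t. F (cis t)) = 2 * of_real pi * F 0"
    by (simp add: mult.assoc[symmetric] integral_unique)
  then show ?thesis
    by (subst integral_circle)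
      (auto intro: continuous_on_subset[OF cont] simp: scaleR_conv_of_real)
qed

section \<open>Orthogonality of powers and Parseval's identity\<close>

lemma integral_circle_power:
  "(\<integral>z. z ^ j * cnj z ^ k \<partial>circle_measure) = (if j = k then 1 else 0)"
proof -
  \<comment> \<open>On the circle \<open>cnj z\<close> is the inverse of \<open>z\<close>, so a
    mixed monomial is a single power of \<open>z\<close> or of \<open>cnj z\<close>.\<close>
  have cnj_pow: "z ^ m * cnj z ^ m = 1" if "z \<in> sphere 0 1" for z :: complex and m
    using that by (simp flip: power_mult_distrib add: complex_norm_square[symmetric])
  have pow: "(\<integral>z. z ^ m \<partial>circle_measure) = 0" if "m > 0" for m
    using that by (subst integral_circle_mean_value) (auto intro!: holomorphic_intros)
  show ?thesis
  proof (cases j k rule: linorder_cases)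
    case less
    have "(\<integral>z. z ^ j * cnj z ^ k \<partial>circle_measure) = (\<integral>z. cnj (z ^ (k - j)) \<partial>circle_measure)"
    proof (rule Bochner_Integration.integral_cong)
      fix z :: complex assume "z \<in> space circle_measure"
      then show "z ^ j * cnj z ^ k = cnj (z ^ (k - j))"
        using less cnj_pow[of z j] power_add[of "cnj z" j "k - j"] by (simp flip: mult.assoc)
    qed simp
    also have "\<dots> = 0"
      using less by (simp only: Bochner_Integration.integral_cnj) (simp add: pow del: complex_cnj_power)
    finally show ?thesis using less by simp
  next
    case equal
    have "(\<integral>z. z ^ j * cnj z ^ k \<partial>circle_measure) = (\<integral>z. 1 \<partial>circle_measure)"
      using equal by (intro Bochner_Integration.integral_cong) (auto simp: cnj_pow)
    then show ?thesis
      using equal circle.prob_space by simp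
  next
    case greater
    have "(\<integral>z. z ^ j * cnj z ^ k \<partial>circle_measure) = (\<integral>z. z ^ (j - k) \<partial>circle_measure)"
    proof (rule Bochner_Integration.integral_cong)
      fix z :: complex assume "z \<in> space circle_measure"
      then show "z ^ j * cnj z ^ k = z ^ (j - k)"
        using greater cnj_pow[of z k] power_add[of z "j - k" k] by (simp add: mult.assoc)
    qed simp
    then show ?thesis
      using greater pow by simp
  qed
qed

lemma continuous_on_suminf_circle:
  fixes c :: "nat \<Rightarrow> complex"
  assumes "summable (\<lambda>n. norm (c n))"
  shows "continuous_on (sphere 0 1) (\<lambda>z. \<Sum>n. c n * z ^ n)"
proof (rule uniform_limit_theorem)
  show "uniform_limit (sphere 0 1) (\<lambda>N z. \<Sum>n<N. c n * z ^ n) (\<lambda>z. \<Sum>n. c n * z ^ n) sequentially"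
    by (rule Weierstrass_m_test[OF _ assms]) (simp add: norm_mult norm_power)
qed (auto intro!: always_eventually continuous_intros)

lemma integral_suminf_circle:
  fixes c :: "nat \<Rightarrow> complex"
  assumes c: "summable (\<lambda>n. norm (c n))" and u: "continuous_on (sphere 0 1) u"
  shows "(\<lambda>n. c n * (\<integral>z. z ^ n * u z \<partial>circle_measure)) sums
           (\<integral>z. (\<Sum>n. c n * z ^ n) * u z \<partial>circle_measure)"
proof -
  have "compact (u ` sphere 0 1)"
    using u by (intro compact_continuous_image) auto
  then obtain B where B: "\<And>z. z \<in> sphere 0 1 \<Longrightarrow> norm (u z) \<le> B"
    by (meson bounded_iff compact_imp_bounded imageI)
  have sn: "summable (\<lambda>n. norm (c n * z ^ n))" if "z \<in> sphere 0 1" for z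
    using c that by (simp add: norm_mult norm_power)
  have summ: "summable (\<lambda>n. c n * z ^ n)" if "z \<in> sphere 0 1" for z
    by (rule summable_norm_cancel[OF sn[OF that]])
  have "(\<lambda>n. \<integral>z. c n * (z ^ n * u z) \<partial>circle_measure) sums
          (\<integral>z. (\<Sum>n. c n * (z ^ n * u z)) \<partial>circle_measure)"
  proof (rule sums_integral)
    show "integrable circle_measure (\<lambda>z. c n * (z ^ n * u z))" for n
      by (intro integrable_circleI continuous_intros u)
    have "summable (\<lambda>n. norm (c n) * B)"
      using c by (rule summable_mult2)
    have le: "norm (c n * (z ^ n * u z)) \<le> norm (c n) * B" if "z \<in> sphere 0 1" for n z
      using that B[OF that] by (simp add: norm_mult norm_power mult_left_mono)
    show "AE z in circle_measure. summable (\<lambda>n. norm (c n * (z ^ n * u z)))"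
      by (rule AE_I2, rule summable_comparison_test'[OF summable_mult2[OF c, of B], of 0])
        (use le in auto)
    show "summable (\<lambda>n. \<integral>z. norm (c n * (z ^ n * u z)) \<partial>circle_measure)"
    proof (rule summable_comparison_test'[OF summable_mult2[OF c, of B], of 0])
      fix n
      have "(\<integral>z. norm (c n * (z ^ n * u z)) \<partial>circle_measure) \<le> (\<integral>z. norm (c n) * B \<partial>circle_measure)"
        using le by (intro integral_mono integrable_circleI continuous_intros u) auto
      then show "norm (\<integral>z. norm (c n * (z ^ n * u z)) \<partial>circle_measure) \<le> norm (c n) * B"
        by (simp add: circle.prob_space)
    qed
  qed
  also have "(\<lambda>n. \<integral>z. c n * (z ^ n * u z) \<partial>circle_measure) = (\<lambda>n. c n * (\<integral>z. z ^ n * u z \<partial>circle_measure))"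
    by simp
  also have "(\<integral>z. (\<Sum>n. c n * (z ^ n * u z)) \<partial>circle_measure) = (\<integral>z. (\<Sum>n. c n * z ^ n) * u z \<partial>circle_measure)"
    using summ by (intro Bochner_Integration.integral_cong) (auto simp: suminf_mult2 mult.assoc)
  finally show ?thesis .
qed

text \<open>Sum and integral are exchanged twice: against \<open>cnj z ^ n\<close> this reads off
  the coefficient \<open>c n\<close>, and against \<open>cnj (F z)\<close> it then evaluates the
  mean of the squared modulus.\<close>

lemma Parseval_circle:
  fixes c :: "nat \<Rightarrow> complex"
  assumes c: "summable (\<lambda>n. norm (c n))"
  shows "(\<lambda>n. (norm (c n))\<^sup>2) sums (\<integral>z. (norm (\<Sum>n. c n * z ^ n))\<^sup>2 \<partial>circle_measure)"
proof -
  define F where "F z = (\<Sum>n. c n * z ^ n)" for z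
  have contF: "continuous_on (sphere 0 1) F"
    unfolding F_def by (rule continuous_on_suminf_circle[OF c])
  have "(\<integral>z. F z * cnj (z ^ n) \<partial>circle_measure) = c n" for n
  proof -
    have "(\<lambda>k. c k * (\<integral>z. z ^ k * cnj z ^ n \<partial>circle_measure)) sums
            (\<integral>z. F z * cnj z ^ n \<partial>circle_measure)"
      unfolding F_def by (rule integral_suminf_circle[OF c]) (intro continuous_intros)
    then have "(\<lambda>k. if k = n then c k else 0) sums (\<integral>z. F z * cnj z ^ n \<partial>circle_measure)"
      by (simp add: integral_circle_power if_distrib cong: if_cong)
    then show ?thesis
      using sums_If_finite[of "\<lambda>k. k = n" c] by (simp add: sums_unique2)
  qed
  then have coeff: "(\<integral>z. z ^ n * cnj (F z) \<partial>circle_measure) = cnj (c n)" for n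
    using Bochner_Integration.integral_cnj[of circle_measure "\<lambda>z. F z * cnj (z ^ n)"] by (simp add: mult.commute)
  have "(\<lambda>n. c n * (\<integral>z. z ^ n * cnj (F z) \<partial>circle_measure)) sums
           (\<integral>z. F z * cnj (F z) \<partial>circle_measure)"
    using integral_suminf_circle[OF c, of "\<lambda>z. cnj (F z)"] contF
    by (simp add: F_def[symmetric] continuous_on_cnj)
  then have "(\<lambda>n. of_real ((norm (c n))\<^sup>2) :: complex) sums (\<integral>z. of_real ((norm (F z))\<^sup>2) \<partial>circle_measure)"
    by (simp only: coeff complex_norm_square)
  then show ?thesis
    by (simp only: integral_complex_of_real sums_of_real_iff F_def)
qed

section \<open>Almost everywhere convergence of dilations\<close>

definition taylor_coeff :: "(complex \<Rightarrow> complex) \<Rightarrow> nat \<Rightarrow> complex" where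
  "taylor_coeff f n = (deriv ^^ n) f 0 / fact n"

text \<open>Convergence of the Taylor series at a radius strictly between \<open>r\<close> and 1 is
  absolute at \<open>r\<close>.\<close>

lemma summable_taylor_coeff:
  assumes f: "f holomorphic_on ball 0 1" and r: "0 \<le> r" "r < 1"
  shows "summable (\<lambda>n. norm (taylor_coeff f n * of_real r ^ n))"
proof -
  obtain s where s: "r < s" "s < 1" using dense r by blast
  have "(\<lambda>n. taylor_coeff f n * (of_real s - 0) ^ n) sums f (of_real s)"
    using s r unfolding taylor_coeff_def by (intro holomorphic_power_series[OF f]) auto
  then have "summable (\<lambda>n. taylor_coeff f n * of_real s ^ n)"
    by (simp add: sums_iff)
  then show ?thesis
    by (rule powser_insidea) (use s r in auto)
qed

lemma taylor_circle_eq: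
  assumes f: "f holomorphic_on ball 0 1" and r: "0 \<le> r" "r < 1" and z: "z \<in> sphere 0 1"
  shows "(\<lambda>n. (taylor_coeff f n * of_real r ^ n) * z ^ n) sums f (of_real r * z)"
proof -
  have "(\<lambda>n. taylor_coeff f n * (of_real r * z - 0) ^ n) sums f (of_real r * z)"
    using r z unfolding taylor_coeff_def by (intro holomorphic_power_series[OF f]) (auto simp: norm_mult)
  then show ?thesis by (simp add: power_mult_distrib mult.assoc)
qed

lemma continuous_on_dilation:
  fixes f :: "complex \<Rightarrow> complex"
  assumes f: "f holomorphic_on ball 0 1" and r: "0 \<le> r" "r < 1"
  shows "continuous_on (cball 0 1) (\<lambda>z. f (of_real r * z))"
  by (rule continuous_on_compose2[OF holomorphic_on_imp_continuous_on[OF f]])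
    (use r in \<open>auto intro!: continuous_intros mult_le_one le_less_trans[OF mult_left_le] simp: norm_mult\<close>)

lemma continuous_on_dilation_sphere:
  fixes f :: "complex \<Rightarrow> complex"
  assumes f: "f holomorphic_on ball 0 1" and r: "0 \<le> r" "r < 1"
  shows "continuous_on (sphere 0 1) (\<lambda>z. f (of_real r * z))"
  by (rule continuous_on_subset[OF continuous_on_dilation[OF assms]]) auto

lemma integral_dilation_power2:
  assumes f: "f holomorphic_on ball 0 1" and r: "0 \<le> r" "r < 1"
  shows "(\<lambda>n. (norm (taylor_coeff f n) * r ^ n)\<^sup>2) sums
           (\<integral>z. (norm (f (of_real r * z)))\<^sup>2 \<partial>circle_measure)"
proof -
  have "(\<lambda>n. (norm (taylor_coeff f n * of_real r ^ n))\<^sup>2) sums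
          (\<integral>z. (norm (\<Sum>n. (taylor_coeff f n * of_real r ^ n) * z ^ n))\<^sup>2 \<partial>circle_measure)"
    by (rule Parseval_circle[OF summable_taylor_coeff[OF assms]])
  also have "(\<integral>z. (norm (\<Sum>n. (taylor_coeff f n * of_real r ^ n) * z ^ n))\<^sup>2 \<partial>circle_measure) =
      (\<integral>z. (norm (f (of_real r * z)))\<^sup>2 \<partial>circle_measure)"
    using sums_unique[OF taylor_circle_eq[OF assms]]
    by (intro Bochner_Integration.integral_cong) auto
  finally show ?thesis using r by (simp add: norm_mult norm_power)
qed

text \<open>By Parseval the claim is coefficientwise: (s^n - r^n)^2 is at most (s^n)^2 - (r^n)^2 for
  0 <= r <= s. It turns convergence of the mean squares into an L2 Cauchy property of the
  dilations.\<close>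

lemma integral_dilation_diff_le:
  assumes f: "f holomorphic_on ball 0 1" and r: "0 \<le> r" "r \<le> s" "s < 1"
  shows "(\<integral>z. (norm (f (of_real s * z) - f (of_real r * z)))\<^sup>2 \<partial>circle_measure) \<le>
     (\<integral>z. (norm (f (of_real s * z)))\<^sup>2 \<partial>circle_measure) -
     (\<integral>z. (norm (f (of_real r * z)))\<^sup>2 \<partial>circle_measure)"
proof -
  define c where "c n = taylor_coeff f n * of_real s ^ n - taylor_coeff f n * of_real r ^ n" for n
  have "summable (\<lambda>n. norm (taylor_coeff f n * of_real s ^ n) + norm (taylor_coeff f n * of_real r ^ n))"
    using r by (intro summable_add summable_taylor_coeff f) auto
  then have c: "summable (\<lambda>n. norm (c n))"
    by (rule summable_comparison_test'[where N=0]) (auto simp: c_def norm_triangle_ineq4)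
  have "(\<lambda>n. (norm (c n))\<^sup>2) sums (\<integral>z. (norm (\<Sum>n. c n * z ^ n))\<^sup>2 \<partial>circle_measure)"
    by (rule Parseval_circle[OF c])
  also have "(\<integral>z. (norm (\<Sum>n. c n * z ^ n))\<^sup>2 \<partial>circle_measure) =
      (\<integral>z. (norm (f (of_real s * z) - f (of_real r * z)))\<^sup>2 \<partial>circle_measure)"
  proof (rule Bochner_Integration.integral_cong)
    fix z assume "z \<in> space circle_measure"
    then have "(\<lambda>n. c n * z ^ n) sums (f (of_real s * z) - f (of_real r * z))"
      using r unfolding c_def left_diff_distrib
      by (intro sums_diff taylor_circle_eq f) auto
    then show "(norm (\<Sum>n. c n * z ^ n))\<^sup>2 = (norm (f (of_real s * z) - f (of_real r * z)))\<^sup>2"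
      by (simp add: sums_unique[symmetric])
  qed simp
  finally have 1: "(\<lambda>n. (norm (c n))\<^sup>2) sums
      (\<integral>z. (norm (f (of_real s * z) - f (of_real r * z)))\<^sup>2 \<partial>circle_measure)" .
  have 2: "(\<lambda>n. (norm (taylor_coeff f n) * s ^ n)\<^sup>2 - (norm (taylor_coeff f n) * r ^ n)\<^sup>2) sums
     ((\<integral>z. (norm (f (of_real s * z)))\<^sup>2 \<partial>circle_measure) -
     (\<integral>z. (norm (f (of_real r * z)))\<^sup>2 \<partial>circle_measure))"
    using r by (intro sums_diff integral_dilation_power2 f) auto
  show ?thesis
  proof (rule sums_le[OF _ 1 2])
    fix n
    have rs: "0 \<le> r ^ n" "r ^ n \<le> s ^ n" using r by (auto intro: power_mono)
    have "c n = taylor_coeff f n * of_real (s ^ n - r ^ n)"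
      by (simp add: c_def algebra_simps)
    then have "(norm (c n))\<^sup>2 = (norm (taylor_coeff f n))\<^sup>2 * (s ^ n - r ^ n)\<^sup>2"
      using rs by (simp add: norm_mult power_mult_distrib del: of_real_diff of_real_power)
    also have "\<dots> \<le> (norm (taylor_coeff f n))\<^sup>2 * ((s ^ n)\<^sup>2 - (r ^ n)\<^sup>2)"
    proof (rule mult_left_mono)
      have "(s ^ n - r ^ n) * (s ^ n - r ^ n) \<le> (s ^ n - r ^ n) * (s ^ n + r ^ n)"
        using rs by (intro mult_left_mono) auto
      then show "(s ^ n - r ^ n)\<^sup>2 \<le> (s ^ n)\<^sup>2 - (r ^ n)\<^sup>2"
        by (simp add: power2_eq_square algebra_simps)
    qed simp
    finally show "(norm (c n))\<^sup>2 \<le> (norm (taylor_coeff f n) * s ^ n)\<^sup>2 - (norm (taylor_coeff f n) * r ^ n)\<^sup>2"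
      by (simp add: power_mult_distrib algebra_simps)
  qed
qed

lemma (in prob_space) expectation_power2_le:
  fixes X :: "'a \<Rightarrow> real"
  assumes "integrable M X" "integrable M (\<lambda>x. (X x)\<^sup>2)"
  shows "(expectation X)\<^sup>2 \<le> expectation (\<lambda>x. (X x)\<^sup>2)"
  using variance_eq[OF assms] variance_positive[of X] by linarith

text \<open>The series of the norms of the increments has a finite integral, so it is finite almost
  everywhere; there the increments are summable and telescope.\<close>

lemma AE_convergent_of_summable_diff:
  fixes u :: "nat \<Rightarrow> 'a \<Rightarrow> 'b::{banach, second_countable_topology}"
  assumes u: "\<And>n. integrable M (u n)"
    and summ: "summable (\<lambda>n. \<integral>x. norm (u (Suc n) x - u n x) \<partial>M)"
  shows "AE x in M. convergent (\<lambda>n. u n x)"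
proof -
  have [measurable]: "u n \<in> borel_measurable M" for n
    using u by auto
  have "(\<integral>\<^sup>+x. (\<Sum>n. ennreal (norm (u (Suc n) x - u n x))) \<partial>M) =
        (\<Sum>n. \<integral>\<^sup>+x. ennreal (norm (u (Suc n) x - u n x)) \<partial>M)"
    by (rule nn_integral_suminf) measurable
  also have "\<dots> = (\<Sum>n. ennreal (\<integral>x. norm (u (Suc n) x - u n x) \<partial>M))"
    by (intro suminf_cong nn_integral_eq_integral) (auto intro!: integrable_norm integrable_diff u)
  also have "\<dots> = ennreal (\<Sum>n. \<integral>x. norm (u (Suc n) x - u n x) \<partial>M)"
    by (rule suminf_ennreal2[OF _ summ]) simp
  finally have "(\<integral>\<^sup>+x. (\<Sum>n. ennreal (norm (u (Suc n) x - u n x))) \<partial>M) \<noteq> \<infinity>"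
    by simp
  then have "AE x in M. (\<Sum>n. ennreal (norm (u (Suc n) x - u n x))) \<noteq> \<infinity>"
    by (intro nn_integral_PInf_AE) measurable
  then show ?thesis
  proof eventually_elim
    case (elim x)
    then have "summable (\<lambda>n. norm (u (Suc n) x - u n x))"
      by (intro summable_suminf_not_top) auto
    then have "summable (\<lambda>n. u (Suc n) x - u n x)"
      by (rule summable_norm_cancel)
    then have "convergent (\<lambda>n. \<Sum>k<n. u (Suc k) x - u k x)"
      by (simp add: summable_iff_convergent)
    then have "convergent (\<lambda>n. (u n x - u 0 x) + u 0 x)"
      by (intro convergent_add convergent_const) (simp add: sum_lessThan_telescope[of "\<lambda>n. u n x"])
    then show ?case by simp
  qed
qed

text \<open>The mean squares \<open>M r\<close> increase with \<open>r\<close> and are bounded by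
  the square of \<open>B\<close>. Radii whose mean squares lie within (1/4)^n of the supremum
  \<open>L\<close> make consecutive dilations differ by at most (1/2)^n in the mean.\<close>

lemma AE_convergent_dilations:
  assumes f: "f holomorphic_on ball 0 1" and B: "\<And>z. z \<in> ball 0 1 \<Longrightarrow> norm (f z) \<le> B"
  obtains \<rho> :: "nat \<Rightarrow> real" where "\<And>n. 0 \<le> \<rho> n" "\<And>n. \<rho> n < 1" "\<rho> \<longlonglongrightarrow> 1"
    "AE z in circle_measure. convergent (\<lambda>n. f (of_real (\<rho> n) * z))"
proof -
  define M where "M r = (\<integral>z. (norm (f (of_real r * z)))\<^sup>2 \<partial>circle_measure)" for r :: real
  have diff: "(\<integral>z. (norm (f (of_real s * z) - f (of_real r * z)))\<^sup>2 \<partial>circle_measure) \<le> M s - M r"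
    if "0 \<le> r" "r \<le> s" "s < 1" for r s
    using integral_dilation_diff_le[OF f that] by (simp add: M_def)
  have mono: "M r \<le> M s" if "0 \<le> r" "r \<le> s" "s < 1" for r s
  proof -
    have "0 \<le> (\<integral>z. (norm (f (of_real s * z) - f (of_real r * z)))\<^sup>2 \<partial>circle_measure)" by simp
    then show ?thesis using diff[OF that] by linarith
  qed
  have Mle: "M r \<le> B\<^sup>2" if "0 \<le> r" "r < 1" for r
  proof -
    have "M r \<le> (\<integral>z. B\<^sup>2 \<partial>circle_measure)"
      unfolding M_def using that
      by (intro integral_mono integrable_circleI continuous_intros continuous_on_dilation_sphere f power_mono B)
        (auto simp: norm_mult)
    then show ?thesis by simp
  qed
  define L where "L = (SUP r\<in>{0..<1}. M r)"
  have bdd: "bdd_above (M ` {0..<1})"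
    using Mle by (intro bdd_aboveI[of _ "B\<^sup>2"]) auto
  have MleL: "M r \<le> L" if "0 \<le> r" "r < 1" for r
    unfolding L_def using that by (intro cSUP_upper bdd) auto
  \<comment> \<open>Nearness of \<open>M r\<close> to \<open>L\<close> alone need not push
    \<open>r\<close> towards 1, for instance when \<open>f\<close> is constant; since
    \<open>M\<close> is monotone, \<open>r\<close> may be enlarged to
    \<open>1 - 1 / Suc n\<close>.\<close>
  have "\<exists>r. 0 \<le> r \<and> r < 1 \<and> 1 - 1 / Suc n \<le> r \<and> L - (1/4) ^ n \<le> M r" for n
  proof -
    have "L - (1/4) ^ n < L" by simp
    then have "\<exists>r\<in>{0..<1}. L - (1/4) ^ n < M r"
      by (subst less_cSUP_iff[symmetric]) (use bdd in \<open>auto simp: L_def\<close>)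
    then obtain r where r: "0 \<le> r" "r < 1" "L - (1/4) ^ n < M r"
      by auto
    let ?s = "max r (1 - 1 / Suc n)"
    have "M r \<le> M ?s" using r by (intro mono) auto
    then show ?thesis using r by (intro exI[of _ ?s]) auto
  qed
  then obtain \<rho> where \<rho>: "\<And>n. 0 \<le> \<rho> n" "\<And>n. \<rho> n < 1" "\<And>n. 1 - 1 / Suc n \<le> \<rho> n"
      "\<And>n. L - (1/4) ^ n \<le> M (\<rho> n)"
    by metis
  have lim: "\<rho> \<longlonglongrightarrow> 1"
  proof (rule tendsto_sandwich[of "\<lambda>n. 1 - 1 / Suc n" _ _ "\<lambda>_. 1"])
    have "(\<lambda>n. 1 - 1 / real (Suc n)) \<longlonglongrightarrow> 1 - 0"
      by (intro tendsto_diff tendsto_const LIMSEQ_Suc[OF lim_1_over_n])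
    then show "(\<lambda>n. 1 - 1 / real (Suc n)) \<longlonglongrightarrow> 1" by simp
  qed (use \<rho> in \<open>auto intro!: always_eventually less_imp_le\<close>)
  let ?d = "\<lambda>n z. norm (f (of_real (\<rho> (Suc n)) * z) - f (of_real (\<rho> n) * z))"
  have int: "integrable circle_measure (?d n)" "integrable circle_measure (\<lambda>z. (?d n z)\<^sup>2)" for n
    using \<rho> by (auto intro!: integrable_circleI continuous_intros continuous_on_dilation_sphere f)
  have le: "(\<integral>z. ?d n z \<partial>circle_measure) \<le> (1/2) ^ n" for n
  proof -
    \<comment> \<open>The radii need not be monotone, so either may be the larger. In both cases the
      larger one has mean square at most \<open>L\<close> and the smaller one at least
      \<open>L - (1/4) ^ n\<close>.\<close>
    have 1: "(\<integral>z. (?d n z)\<^sup>2 \<partial>circle_measure) \<le> (1/4) ^ n"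
    proof (cases "\<rho> n \<le> \<rho> (Suc n)")
      case True
      then show ?thesis
        using diff[of "\<rho> n" "\<rho> (Suc n)"] \<rho>[of n] MleL[of "\<rho> (Suc n)"] \<rho>[of "Suc n"] by simp
    next
      case False
      have "(1/4::real) ^ Suc n \<le> (1/4) ^ n" by simp
      then show ?thesis
        using False diff[of "\<rho> (Suc n)" "\<rho> n"] \<rho>[of n] MleL[of "\<rho> n"] \<rho>(1,2,4)[of "Suc n"]
        by (simp add: norm_minus_commute)
    qed
    have "(\<integral>z. ?d n z \<partial>circle_measure)\<^sup>2 \<le> (\<integral>z. (?d n z)\<^sup>2 \<partial>circle_measure)"
      by (rule circle.expectation_power2_le[OF int])
    also have "\<dots> \<le> ((1/2) ^ n)\<^sup>2"
    proof -
      have "(1/4::real) ^ n = ((1/2) ^ n)\<^sup>2"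
        by (simp add: power2_eq_square flip: power_mult_distrib)
      then show ?thesis using 1 by (simp only:)
    qed
    finally show ?thesis
      by (rule power2_le_imp_le) simp
  qed
  have "AE z in circle_measure. convergent (\<lambda>n. f (of_real (\<rho> n) * z))"
  proof (rule AE_convergent_of_summable_diff)
    show "integrable circle_measure (\<lambda>z. f (of_real (\<rho> n) * z))" for n
      using \<rho> by (intro integrable_circleI continuous_on_dilation_sphere f) auto
    show "summable (\<lambda>n. \<integral>z. ?d n z \<partial>circle_measure)"
      by (rule summable_comparison_test'[OF summable_geometric[of "1/2::real"], of 0])
        (use le in auto)
  qed
  then show ?thesis using that \<rho> lim by blast
qed

section \<open>Differentiation of integrals and the Poisson kernel\<close>

text \<open>\<open>integrable_ccontinuous_explicit\<close> controls difference quotients to the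
  right. Applied to \<open>f\<close> and to its reflection it controls both sides, off the union of
  \<open>N1\<close> and the mirror image of \<open>N2\<close>. Neither set depends on the lower
  limit \<open>a\<close>.\<close>

lemma Lebesgue_differentiation_real:
  fixes f :: "real \<Rightarrow> 'b::euclidean_space"
  assumes f: "\<And>a b. f integrable_on {a..b}"
  obtains N where "negligible N"
    "\<And>x a. x \<notin> N \<Longrightarrow> a < x \<Longrightarrow> ((\<lambda>t. integral {a..t} f) has_vector_derivative f x) (at x)"
proof -
  have f_right: "\<exists>N. negligible N \<and> (\<forall>x e. x \<notin> N \<and> 0 < e \<longrightarrow>
      (\<exists>d>0. \<forall>h. 0 < h \<and> h < d \<longrightarrow> norm (integral {x..x + h} f /\<^sub>R h - f x) < e))"
    if "\<And>a b. f integrable_on {a..b}" for f :: "real \<Rightarrow> 'b"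
    using integrable_ccontinuous_explicit[of f] that by (simp add: cbox_interval) metis
  obtain N1 where N1: "negligible N1" "\<And>x e. x \<notin> N1 \<Longrightarrow> 0 < e \<Longrightarrow>
      \<exists>d>0. \<forall>h. 0 < h \<and> h < d \<longrightarrow> norm (integral {x..x + h} f /\<^sub>R h - f x) < e"
    using f_right[OF f] by metis
  have "(\<lambda>x. f (- x)) integrable_on {a..b}" for a b
    using Henstock_Kurzweil_Integration.integrable_reflect_real[of f "-a" "-b"] f by simp
  then obtain N2 where N2: "negligible N2" "\<And>x e. x \<notin> N2 \<Longrightarrow> 0 < e \<Longrightarrow>
      \<exists>d>0. \<forall>h. 0 < h \<and> h < d \<longrightarrow> norm (integral {x..x + h} (\<lambda>x. f (- x)) /\<^sub>R h - f (- x)) < e"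
    using f_right[of "\<lambda>x. f (- x)"] by metis
  have neg: "negligible (N1 \<union> uminus ` N2)"
    using N1(1) N2(1) by (intro negligible_Un negligible_differentiable_image_negligible) (auto intro!: derivative_intros)
  have deriv: "((\<lambda>t. integral {a..t} f) has_vector_derivative f x) (at x)"
    if x: "x \<notin> N1 \<union> uminus ` N2" and a: "a < x" for x a
    unfolding has_vector_derivative_def has_derivative_at_alt
  proof (intro conjI allI impI bounded_linear_scaleR_left)
    fix e :: real assume e: "e > 0"
    obtain d1 where d1: "d1 > 0" "\<And>h. 0 < h \<Longrightarrow> h < d1 \<Longrightarrow> norm (integral {x..x + h} f /\<^sub>R h - f x) < e"
      using N1(2)[of x e] x e by auto
    have "- x \<notin> N2" using x by force
    then obtain d2 where d2: "d2 > 0" "\<And>h. 0 < h \<Longrightarrow> h < d2 \<Longrightarrow>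
        norm (integral {- x..- x + h} (\<lambda>x. f (- x)) /\<^sub>R h - f x) < e"
      using N2(2)[of "- x" e] e by auto
    show "\<exists>d>0. \<forall>y. norm (y - x) < d \<longrightarrow>
        norm (integral {a..y} f - integral {a..x} f - (y - x) *\<^sub>R f x) \<le> e * norm (y - x)"
    proof (intro exI[of _ "min (min d1 d2) (x - a)"] conjI allI impI)
      show "0 < min (min d1 d2) (x - a)" using d1 d2 a by simp
      fix y assume y: "norm (y - x) < min (min d1 d2) (x - a)"
      consider "y = x" | "y > x" | "y < x" by linarith
      then show "norm (integral {a..y} f - integral {a..x} f - (y - x) *\<^sub>R f x) \<le> e * norm (y - x)"
      proof cases
        case 2
        define h where "h = y - x"
        have h: "h > 0" "h < d1" "y = x + h" using 2 y by (auto simp: h_def)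
        have "integral {a..x} f + integral {x..y} f = integral {a..y} f"
          using a 2 by (intro Henstock_Kurzweil_Integration.integral_combine f) auto
        then have "integral {a..y} f - integral {a..x} f - (y - x) *\<^sub>R f x =
            h *\<^sub>R (integral {x..x + h} f /\<^sub>R h - f x)"
          using h by (simp add: scaleR_diff_right algebra_simps)
        then show ?thesis
          using d1(2)[OF h(1,2)] h by (simp add: mult.commute)
      next
        case 3
        define h where "h = x - y"
        have h: "h > 0" "h < d2" "y = x - h" using 3 y by (auto simp: h_def)
        have "integral {a..y} f + integral {y..x} f = integral {a..x} f"
          using 3 y by (intro Henstock_Kurzweil_Integration.integral_combine f) auto
        then have "integral {a..y} f - integral {a..x} f = - integral {y..x} f" "y - x = - h"
          by (simp_all add: h_def algebra_simps)
        moreover have "integral {- x..- x + h} (\<lambda>x. f (- x)) = integral {y..x} f"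
          using Henstock_Kurzweil_Integration.integral_reflect_real[of x y f] h by simp
        ultimately have "integral {a..y} f - integral {a..x} f - (y - x) *\<^sub>R f x =
            - (h *\<^sub>R (integral {- x..- x + h} (\<lambda>x. f (- x)) /\<^sub>R h - f x))"
          using h(1) by (simp add: scaleR_diff_right)
        then show ?thesis
          using d2(2)[OF h(1,2)] h by (simp add: mult.commute)
      qed simp
    qed
  qed
  show ?thesis using that[OF neg deriv] by blast
qed

section \<open>The Poisson kernel and its derivative\<close>

definition poisson_denom :: "real \<Rightarrow> real \<Rightarrow> real" where
  "poisson_denom r s = 1 - 2 * r * cos s + r\<^sup>2"

text \<open>The denominator is the squared modulus of \<open>1 - r * cis s\<close>. The kernel is
  not divided by \<open>2 * pi\<close>, so its mass over \<open>{- pi..pi}\<close> is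
  \<open>2 * pi\<close>.\<close>

definition poisson_kernel :: "real \<Rightarrow> real \<Rightarrow> real" where
  "poisson_kernel r s = (1 - r\<^sup>2) / poisson_denom r s"

definition poisson_kernel' :: "real \<Rightarrow> real \<Rightarrow> real" where
  "poisson_kernel' r s = - ((1 - r\<^sup>2) * (2 * r * sin s) / (poisson_denom r s)\<^sup>2)"

lemma poisson_denom_pos:
  assumes "0 \<le> r" "r < 1"
  shows "0 < poisson_denom r s"
proof -
  have "r * cos s \<le> r * 1" using assms by (intro mult_left_mono) auto
  then have "(1 - r)\<^sup>2 \<le> poisson_denom r s"
    by (simp add: poisson_denom_def power2_eq_square algebra_simps)
  moreover have "0 < (1 - r)\<^sup>2" using assms by simp
  ultimately show ?thesis by linarith
qed

lemma poisson_denom_complex: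
  "complex_of_real (poisson_denom r s) = (1 - r * cis s) * (1 - r * cis (- s))"
proof -
  have "(1 - r * cis s) * (1 - r * cis (- s)) = 1 - r * (cis s + cis (- s)) + r\<^sup>2 * (cis s * cis (- s))"
    by (simp add: algebra_simps power2_eq_square)
  also have "cis s + cis (- s) = 2 * cos s"
    by (simp add: complex_eq_iff)
  also have "cis s * cis (- s) = 1"
    by (simp add: cis_mult)
  finally show ?thesis
    by (simp add: poisson_denom_def)
qed

lemma poisson_kernel_has_derivative [derivative_intros]:
  assumes "0 \<le> r" "r < 1"
  shows "(poisson_kernel r has_real_derivative poisson_kernel' r s) (at s within A)"
  unfolding poisson_kernel_def poisson_kernel'_def
  using poisson_denom_pos[OF assms, of s] unfolding poisson_denom_def
  by (auto intro!: derivative_eq_intros simp: power2_eq_square mult_ac)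

text \<open>Cauchy's formula at the point \<open>- r\<close> for the auxiliary function
  \<open>h\<close>, which takes the value \<open>F r\<close> there. On the circle, \<open>h\<close>
  divided by the Cauchy denominator produces the two factors of
  \<open>poisson_denom_complex\<close>. The reflection of the argument in \<open>h\<close> matches
  the shift of the angle by \<open>pi\<close> that centres the interval at 0.\<close>

lemma poisson_integral:
  assumes F: "F holomorphic_on cball 0 1" and r: "0 \<le> r" "r < 1"
  shows "((\<lambda>s. of_real (poisson_kernel r s) * F (cis s)) has_integral 2 * of_real pi * F (of_real r)) {- pi..pi}"
proof -
  define h where "h w = F (- w) * of_real (1 - r\<^sup>2) / (1 + of_real r * w)" for w :: complex
  have nz: "1 + of_real r * w \<noteq> 0" if "norm w \<le> 1" for w :: complex
  proof
    assume "1 + of_real r * w = 0"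
    then have "of_real r * w = -1" by (simp add: eq_neg_iff_add_eq_0 add.commute)
    then have "r * norm w = 1" using r by (metis norm_minus_cancel norm_mult norm_of_real norm_one abs_of_nonneg)
    moreover have "r * norm w \<le> r * 1" using r that by (intro mult_left_mono) auto
    ultimately show False using r by simp
  qed
  have "(\<lambda>w. F (- w)) holomorphic_on cball 0 1"
    by (rule holomorphic_on_compose_gen[OF _ F, unfolded o_def]) (auto intro!: holomorphic_intros)
  then have "h holomorphic_on cball 0 1"
    unfolding h_def by (intro holomorphic_intros) (auto simp: nz)
  then have "((\<lambda>u. h u / (u - (- of_real r))) has_contour_integral 2 * of_real pi * \<i> * h (- of_real r)) (circlepath 0 1)"
    using r by (intro Cauchy_integral_circlepath_simple) auto
  also have "h (- of_real r) = F (of_real r)"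
  proof -
    have "1 - r * r \<noteq> 0" using r by (metis abs_square_less_1 abs_of_nonneg less_irrefl power2_eq_square right_minus_eq)
    then have "(1 - of_real r * of_real r :: complex) \<noteq> 0"
      by (metis of_real_1 of_real_diff of_real_eq_0_iff of_real_mult)
    then show ?thesis by (simp add: h_def power2_eq_square)
  qed
  finally have "((\<lambda>t. h (cis t) / (cis t + of_real r) * \<i> * cis t) has_integral 2 * of_real pi * \<i> * F (of_real r)) {0..2 * pi}"
    unfolding circlepath_def by (subst (asm) has_contour_integral_part_circlepath_iff) auto
  from has_integral_affinity[OF this[folded cbox_interval], of 1 pi]
  have "((\<lambda>s. h (cis (s + pi)) / (cis (s + pi) + of_real r) * \<i> * cis (s + pi)) has_integral
           2 * of_real pi * \<i> * F (of_real r)) {- pi..pi}"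
    by simp
  then have "((\<lambda>s. (- \<i>) * (h (cis (s + pi)) / (cis (s + pi) + of_real r) * \<i> * cis (s + pi))) has_integral
           (- \<i>) * (2 * of_real pi * \<i> * F (of_real r))) {- pi..pi}"
    by (rule has_integral_mult_right)
  also have "(\<lambda>s. (- \<i>) * (h (cis (s + pi)) / (cis (s + pi) + of_real r) * \<i> * cis (s + pi))) =
      (\<lambda>s. of_real (poisson_kernel r s) * F (cis s))"
  proof
    fix s
    have cis: "cis (s + pi) = - cis s" by (simp add: cis_mult[symmetric])
    have den: "- cis s + of_real r = - (cis s * (1 - of_real r * cis (- s)))"
      using cis_mult[of s "- s"] by (simp add: algebra_simps)
    have "(- \<i>) * (h (cis (s + pi)) / (cis (s + pi) + of_real r) * \<i> * cis (s + pi)) =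
       F (cis s) * of_real (1 - r\<^sup>2) / ((1 - of_real r * cis s) * (1 - of_real r * cis (- s)))"
    proof -
      have alg: "(- \<i>) * (X / (- (c * b)) * \<i> * (- c)) = X / b" if "c \<noteq> 0" for X b c :: complex
        using that by (simp add: field_simps)
      show ?thesis
        unfolding cis den alg[OF cis_neq_zero] h_def by simp
    qed
    also have "\<dots> = of_real (poisson_kernel r s) * F (cis s)"
      by (simp add: poisson_kernel_def poisson_denom_complex[symmetric])
    finally show "(- \<i>) * (h (cis (s + pi)) / (cis (s + pi) + of_real r) * \<i> * cis (s + pi)) =
      of_real (poisson_kernel r s) * F (cis s)" .
  qed
  also have "(- \<i>) * (2 * of_real pi * \<i> * F (of_real r)) = 2 * of_real pi * F (of_real r)"
    by (simp add: algebra_simps)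
  finally show ?thesis .
qed

text \<open>\<open>s\<close> and \<open>sin s\<close> have the same sign on the interval: the kernel
  decreases away from 0, so the first moment of its derivative involves no cancellation.\<close>

lemma poisson_kernel'_sign:
  assumes r: "0 \<le> r" "r < 1" and s: "\<bar>s\<bar> \<le> pi"
  shows "- s * poisson_kernel' r s = \<bar>s\<bar> * \<bar>poisson_kernel' r s\<bar>"
proof -
  have "0 \<le> s * sin s"
    using s sin_ge_zero[of s] sin_ge_zero[of "- s"] 
    by (cases "0 \<le> s") (auto simp: mult_nonpos_nonpos)
  moreover have "r\<^sup>2 \<le> 1" using r by (simp add: power_le_one)
  moreover have "- s * poisson_kernel' r s = ((1 - r\<^sup>2) * 2 * r * (s * sin s)) / (poisson_denom r s)\<^sup>2"
    by (simp add: poisson_kernel'_def mult_ac)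
  ultimately have "0 \<le> - s * poisson_kernel' r s"
    using r by simp
  then show ?thesis by (simp flip: abs_mult)
qed

text \<open>Integrate the derivative of \<open>s * poisson_kernel r s\<close> and subtract the mass,
  which is the Poisson integral of the constant 1. With the sign lemma this bounds the absolute
  first moment of the derivative by \<open>2 * pi\<close>, uniformly in \<open>r\<close>.\<close>

lemma integral_poisson_kernel'_moment:
  assumes r: "0 \<le> r" "r < 1"
  shows "((\<lambda>s. - s * poisson_kernel' r s) has_integral 2 * pi - 2 * pi * poisson_kernel r pi) {- pi..pi}"
proof -
  have "((\<lambda>s. of_real (poisson_kernel r s) :: complex) has_integral 2 * of_real pi) {- pi..pi}"
    using poisson_integral[of "\<lambda>_. 1", OF _ r] by simp
  then have 1: "(poisson_kernel r has_integral 2 * pi) {- pi..pi}"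
    using has_integral_Re by (force simp: o_def)
  have 2: "((\<lambda>s. poisson_kernel r s + s * poisson_kernel' r s) has_integral
      pi * poisson_kernel r pi - (- pi) * poisson_kernel r (- pi)) {- pi..pi}"
    by (intro fundamental_theorem_of_calculus)
      (auto intro!: derivative_eq_intros poisson_kernel_has_derivative r
        simp: has_real_derivative_iff_has_vector_derivative[symmetric])
  show ?thesis
    using has_integral_diff[OF 1 2] by (simp add: poisson_kernel_def poisson_denom_def mult.assoc)
qed

text \<open>Off the centre the denominator is at least the square of \<open>sin d\<close>, by
  completing the square in \<open>r\<close>. Hence the derivative tends to 0 uniformly there as
  \<open>r\<close> tends to 1.\<close>

lemma poisson_kernel'_off_centre:
  assumes r: "0 \<le> r" "r < 1" and d: "0 < d" "d \<le> \<bar>s\<bar>" "\<bar>s\<bar> \<le> pi" "d < pi"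
  shows "\<bar>poisson_kernel' r s\<bar> \<le> 2 * (1 - r\<^sup>2) / (sin d) ^ 4"
proof -
  have "cos \<bar>s\<bar> \<le> cos d" using d by (intro cos_monotone_0_pi_le) auto
  then have "r * cos s \<le> r * cos d" using r by (intro mult_left_mono) (auto simp: abs_if split: if_splits)
  moreover have "(sin d)\<^sup>2 + (r - cos d)\<^sup>2 = 1 - 2 * (r * cos d) + r\<^sup>2"
    using sin_cos_squared_add[of d] by (simp add: power2_eq_square algebra_simps)
  ultimately have D: "(sin d)\<^sup>2 \<le> poisson_denom r s"
    unfolding poisson_denom_def using zero_le_power2[of "r - cos d"] by linarith
  have pos: "0 < sin d" using d by (intro sin_gt_zero) auto
  have "(sin d) ^ 4 = ((sin d)\<^sup>2)\<^sup>2" by simp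
  also have "\<dots> \<le> (poisson_denom r s)\<^sup>2" using D by (intro power_mono) auto
  finally have D4: "(sin d) ^ 4 \<le> (poisson_denom r s)\<^sup>2" .
  have r2: "0 \<le> 1 - r\<^sup>2" using r by (simp add: power_le_one)
  have "r * \<bar>sin s\<bar> \<le> 1 * 1" using r by (intro mult_mono) auto
  have "\<bar>poisson_kernel' r s\<bar> = (1 - r\<^sup>2) * (2 * (r * \<bar>sin s\<bar>)) / (poisson_denom r s)\<^sup>2"
    using r r2 by (simp add: poisson_kernel'_def abs_mult)
  also have "\<dots> \<le> (1 - r\<^sup>2) * (2 * (1 * 1)) / (sin d) ^ 4"
    using \<open>r * \<bar>sin s\<bar> \<le> 1 * 1\<close> r2 D4 pos by (intro frac_le mult_left_mono mult_nonneg_nonneg) auto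
  finally show ?thesis by (simp add: mult.commute)
qed

section \<open>Fatou's theorem\<close>

lemma poisson_denom_continuous [continuous_intros]:
  "continuous_on A (poisson_denom r)"
  unfolding poisson_denom_def by (intro continuous_intros)

lemma continuous_on_poisson_kernel':
  assumes "0 \<le> r" "r < 1"
  shows "continuous_on A (poisson_kernel' r)"
  unfolding poisson_kernel'_def
  using poisson_denom_pos[OF assms] by (intro continuous_intros) (metis less_irrefl power_not_zero)

text \<open>Integrating the Poisson integral by parts moves the boundary values into their primitives, so
  that differentiability of the limiting primitive at \<open>\<theta>\<close> is all that is used.\<close>

lemma radial_limit_eq_derivative:
  fixes f :: "complex \<Rightarrow> complex" and \<Psi> :: "real \<Rightarrow> complex" and \<rho> :: "nat \<Rightarrow> real"
  assumes f: "f holomorphic_on ball 0 1" and B: "\<And>z. z \<in> ball 0 1 \<Longrightarrow> norm (f z) \<le> B"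
    and \<rho>: "\<And>n. 0 \<le> \<rho> n" "\<And>n. \<rho> n < 1" "\<rho> \<longlonglongrightarrow> 1"
    and \<Psi>: "\<And>t. a \<le> t \<Longrightarrow> (\<lambda>n. integral {a..t} (\<lambda>t. f (\<rho> n * cis t))) \<longlonglongrightarrow> \<Psi> t"
    and a: "a < \<theta> - pi"
    and deriv: "(\<Psi> has_vector_derivative c) (at \<theta>)"
  shows "((\<lambda>r. f (of_real r * cis \<theta>)) \<longlongrightarrow> c) (at_left 1)"
proof -
  define u where "u n t = f (\<rho> n * cis t)" for n t
  have u_cont: "continuous_on S (u n)" for S n
    unfolding u_def using \<rho>(1,2)
    by (intro continuous_on_compose2[OF holomorphic_on_imp_continuous_on[OF f]])
      (auto intro!: continuous_intros simp: norm_mult)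
  have u_le: "norm (u n t) \<le> B" for n t
    unfolding u_def using \<rho>(1,2) by (intro B) (auto simp: norm_mult)
  define C where "C = B + norm c"
  have C0: "C \<ge> 0" using u_le[of 0 0] norm_ge_zero[of "u 0 0"] unfolding C_def by (smt (verit) norm_ge_zero)
  \<comment> \<open>\<open>A n\<close> is the primitive of \<open>u n (\<theta> + s) - c\<close>
    that vanishes at 0. \<open>A'\<close> is its limit in \<open>n\<close>, not a derivative; the
    hypothesis \<open>deriv\<close> says that it is o(s).\<close>
  define A where "A n s = integral {a..\<theta> + s} (u n) - integral {a..\<theta>} (u n) - s *\<^sub>R c" for n s
  define A' where "A' s = \<Psi> (\<theta> + s) - \<Psi> \<theta> - s *\<^sub>R c" for s
  have A_deriv: "(A n has_vector_derivative (u n (\<theta> + s) - c)) (at s within {- pi..pi})"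
    if "s \<in> {- pi..pi}" for n s
  proof -
    have "((\<lambda>t. integral {a..t} (u n)) has_vector_derivative u n (\<theta> + s)) (at (\<theta> + s) within {a..\<theta> + 2 * pi})"
      using that a by (intro integral_has_vector_derivative u_cont) auto
    then have "((\<lambda>t. integral {a..t} (u n)) has_vector_derivative u n (\<theta> + s)) (at (\<theta> + s) within (+) \<theta> ` {- pi..pi})"
      by (rule has_vector_derivative_within_subset) (use a in auto)
    then have "(((\<lambda>t. integral {a..t} (u n)) \<circ> (+) \<theta>) has_vector_derivative 1 *\<^sub>R u n (\<theta> + s)) (at s within {- pi..pi})"
      by (intro vector_diff_chain_within) (auto intro!: derivative_eq_intros)
    then show ?thesis
      unfolding A_def by (auto intro!: derivative_eq_intros simp: o_def)
  qed
  have A_lim: "(\<lambda>n. A n s) \<longlonglongrightarrow> A' s" if "s \<in> {- pi..pi}" for s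
    unfolding A_def A'_def u_def using that a by (intro tendsto_intros \<Psi>) auto
  have A_le: "norm (A n s) \<le> C * \<bar>s\<bar>" if "s \<in> {- pi..pi}" for n s
  proof -
    have "norm (A n s - A n 0) \<le> C * norm (s - 0)"
    proof (rule differentiable_bound[of "{- pi..pi}" "A n" "\<lambda>s h. h *\<^sub>R (u n (\<theta> + s) - c)"])
      show "onorm (\<lambda>h. h *\<^sub>R (u n (\<theta> + x) - c)) \<le> C" for x
      proof (rule onorm_bound[OF C0])
        have "norm (u n (\<theta> + x) - c) \<le> C"
          unfolding C_def using norm_triangle_ineq4[of "u n (\<theta> + x)" c] u_le[of n "\<theta> + x"] by linarith
        then show "norm (h *\<^sub>R (u n (\<theta> + x) - c)) \<le> C * norm h" for h
          by (simp add: mult.commute[of C] mult_left_mono)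
      qed
    qed (use A_deriv that in \<open>auto simp: has_vector_derivative_def\<close>)
    then show ?thesis by (simp add: A_def)
  qed
  have A'_le: "norm (A' s) \<le> C * \<bar>s\<bar>" if "s \<in> {- pi..pi}" for s
    by (rule Lim_bounded[OF tendsto_norm[OF A_lim[OF that]], of 0]) (use A_le[OF that] in auto)
  \<comment> \<open>Here \<open>r\<close> is fixed and \<open>n\<close> tends to infinity: the
    dilation by \<open>\<rho> n\<close> disappears on the right because \<open>f\<close> is
    continuous at \<open>r * cis \<theta>\<close>, and on the left by domination through
    \<open>A_le\<close>.\<close>
  have parts: "((\<lambda>s. poisson_kernel' r s *\<^sub>R A' s) has_integral
      poisson_kernel r pi *\<^sub>R (A' pi - A' (- pi)) - 2 * of_real pi * (f (r * cis \<theta>) - c)) {- pi..pi}"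
    if r: "0 \<le> r" "r < 1" for r
  proof (rule has_integral_dominated_convergence)
    fix n
    have "(\<lambda>w. f (\<rho> n * cis \<theta> * w) - c) holomorphic_on cball 0 1"
    proof -
      have "(\<lambda>w. f (\<rho> n * cis \<theta> * w)) holomorphic_on cball 0 1"
        by (rule holomorphic_on_compose_gen[OF _ f, unfolded o_def])
          (use \<rho>(1,2)[of n] in \<open>auto intro!: holomorphic_intros le_less_trans[OF mult_left_le] simp: norm_mult\<close>)
      then show ?thesis by (intro holomorphic_intros)
    qed
    from poisson_integral[OF this r]
    have 1: "((\<lambda>s. poisson_kernel r s *\<^sub>R (u n (\<theta> + s) - c)) has_integral
        2 * of_real pi * (f (\<rho> n * cis \<theta> * r) - c)) {- pi..pi}"
      by (simp add: u_def scaleR_conv_of_real cis_mult mult.assoc)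
    have 2: "((\<lambda>s. poisson_kernel r s *\<^sub>R (u n (\<theta> + s) - c) + poisson_kernel' r s *\<^sub>R A n s) has_integral
        poisson_kernel r pi *\<^sub>R A n pi - poisson_kernel r (- pi) *\<^sub>R A n (- pi)) {- pi..pi}"
      by (intro fundamental_theorem_of_calculus has_vector_derivative_scaleR A_deriv
          poisson_kernel_has_derivative r) auto
    show "((\<lambda>s. poisson_kernel' r s *\<^sub>R A n s) has_integral
        poisson_kernel r pi *\<^sub>R (A n pi - A n (- pi)) - 2 * of_real pi * (f (\<rho> n * cis \<theta> * r) - c)) {- pi..pi}"
      using has_integral_diff[OF 2 1] by (simp add: poisson_kernel_def poisson_denom_def scaleR_diff_right)
    show "\<forall>s\<in>{- pi..pi}. norm (poisson_kernel' r s *\<^sub>R A n s) \<le> \<bar>poisson_kernel' r s\<bar> * (C * \<bar>s\<bar>)"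
      using A_le by (auto intro!: mult_left_mono)
  next
    show "(\<lambda>s. \<bar>poisson_kernel' r s\<bar> * (C * \<bar>s\<bar>)) integrable_on {- pi..pi}"
      by (intro integrable_continuous_real continuous_intros continuous_on_poisson_kernel' r)
    show "\<forall>s\<in>{- pi..pi}. (\<lambda>n. poisson_kernel' r s *\<^sub>R A n s) \<longlonglongrightarrow> poisson_kernel' r s *\<^sub>R A' s"
      using A_lim by (auto intro!: tendsto_intros)
    have "isCont f (r * cis \<theta>)"
      using holomorphic_on_imp_continuous_on[OF f] r
      by (auto simp: continuous_on_eq_continuous_at norm_mult)
    moreover have "(\<lambda>n. \<rho> n * cis \<theta> * r) \<longlonglongrightarrow> of_real 1 * cis \<theta> * r"
      by (intro tendsto_intros \<rho>)
    ultimately have "(\<lambda>n. f (\<rho> n * cis \<theta> * r)) \<longlonglongrightarrow> f (r * cis \<theta>)"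
      by (intro isCont_tendsto_compose[of _ f]) (simp_all add: mult.commute)
    then show "(\<lambda>n. poisson_kernel r pi *\<^sub>R (A n pi - A n (- pi)) - 2 * of_real pi * (f (\<rho> n * cis \<theta> * r) - c))
        \<longlonglongrightarrow> poisson_kernel r pi *\<^sub>R (A' pi - A' (- pi)) - 2 * of_real pi * (f (r * cis \<theta>) - c)"
      by (intro tendsto_intros A_lim) auto
  qed
  show ?thesis
  proof (rule tendstoI)
    fix e :: real assume e: "e > 0"
    define \<epsilon> where "\<epsilon> = e / 2"
    have \<epsilon>: "\<epsilon> > 0" using e by (simp add: \<epsilon>_def)
    obtain d where d: "0 < d" "d < pi" "\<And>s. \<bar>s\<bar> < d \<Longrightarrow> norm (A' s) \<le> \<epsilon> * \<bar>s\<bar>"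
    proof -
      obtain d where d: "d > 0" "\<And>y. norm (y - \<theta>) < d \<Longrightarrow>
          norm (\<Psi> y - \<Psi> \<theta> - (y - \<theta>) *\<^sub>R c) \<le> \<epsilon> * norm (y - \<theta>)"
        using deriv \<epsilon> unfolding has_vector_derivative_def has_derivative_at_alt by blast
      \<comment> \<open>The 3 keeps \<open>d\<close> below \<open>pi\<close>, where
        \<open>sin d\<close> is positive.\<close>
      show ?thesis
        using d(1) d(2)[of "\<theta> + _"] by (intro that[of "min d 3"]) (use pi_gt3 in \<open>auto simp: A'_def\<close>)
    qed
    define E where "E r = 2 * (1 - r\<^sup>2) / (sin d) ^ 4" for r :: real
    have bound: "2 * pi * norm (f (r * cis \<theta>) - c) \<le>
        poisson_kernel r pi * (2 * pi * C) + (\<epsilon> * (2 * pi) + 2 * pi * (C * pi * E r))"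
      if r: "0 \<le> r" "r < 1" for r
    proof -
      have Pk0: "0 \<le> poisson_kernel r pi"
        unfolding poisson_kernel_def using poisson_denom_pos[OF r, of pi] r
        by (simp add: power_le_one)
      \<comment> \<open>Near 0 the smallness of \<open>A'\<close> supplies a factor
        \<open>\<bar>s\<bar>\<close>, which the sign lemma turns into the moment with known
        integral; elsewhere \<open>A'\<close> is bounded and the derivative of the kernel is at most
        \<open>E r\<close>.\<close>
      have le: "norm (poisson_kernel' r s *\<^sub>R A' s) \<le> \<epsilon> * (- s * poisson_kernel' r s) + C * pi * E r"
        if s: "s \<in> {- pi..pi}" for s
      proof (cases "\<bar>s\<bar> < d")
        case True
        have "norm (poisson_kernel' r s *\<^sub>R A' s) \<le> \<bar>poisson_kernel' r s\<bar> * (\<epsilon> * \<bar>s\<bar>)"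
          using d(3)[OF True] by (auto intro!: mult_left_mono)
        also have "\<dots> = \<epsilon> * (- s * poisson_kernel' r s)"
          using s by (subst poisson_kernel'_sign[OF r]) auto
        also have "\<dots> \<le> \<epsilon> * (- s * poisson_kernel' r s) + C * pi * E r"
          using C0 r by (simp add: E_def power_le_one)
        finally show ?thesis .
      next
        case False
        have "norm (poisson_kernel' r s *\<^sub>R A' s) = norm (A' s) * \<bar>poisson_kernel' r s\<bar>" by simp
        also have "\<dots> \<le> (C * pi) * E r"
        proof (rule mult_mono)
          have "norm (A' s) \<le> C * \<bar>s\<bar>" by (rule A'_le[OF s])
          also have "\<dots> \<le> C * pi" using s C0 by (intro mult_left_mono) auto
          finally show "norm (A' s) \<le> C * pi" .
          show "\<bar>poisson_kernel' r s\<bar> \<le> E r"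
            unfolding E_def using False s d by (intro poisson_kernel'_off_centre r) auto
        qed (use C0 in auto)
        also have "\<dots> \<le> \<epsilon> * (- s * poisson_kernel' r s) + C * pi * E r"
        proof -
          have "0 \<le> \<epsilon> * (- s * poisson_kernel' r s)"
            using s \<epsilon> by (subst poisson_kernel'_sign[OF r]) auto
          then show ?thesis by linarith
        qed
        finally show ?thesis .
      qed
      have "((\<lambda>s. \<epsilon> * (- s * poisson_kernel' r s) + C * pi * E r) has_integral
          \<epsilon> * (2 * pi - 2 * pi * poisson_kernel r pi) + (pi - (- pi)) *\<^sub>R (C * pi * E r)) {- pi..pi}"
        using has_integral_const_real[of "C * pi * E r" "- pi" pi]
        by (intro has_integral_add has_integral_mult_right integral_poisson_kernel'_moment r) simp
      then have "norm (poisson_kernel r pi *\<^sub>R (A' pi - A' (- pi)) - 2 * of_real pi * (f (r * cis \<theta>) - c))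
          \<le> \<epsilon> * (2 * pi - 2 * pi * poisson_kernel r pi) + (pi - (- pi)) *\<^sub>R (C * pi * E r)"
        using le parts[OF r] 
        by (metis (no_types, lifting) has_integral_integrable integral_norm_bound_integral integral_unique)
      also have "\<dots> \<le> \<epsilon> * (2 * pi) + 2 * pi * (C * pi * E r)"
        using Pk0 \<epsilon> by simp
      finally have 1: "norm (poisson_kernel r pi *\<^sub>R (A' pi - A' (- pi)) - 2 * of_real pi * (f (r * cis \<theta>) - c))
          \<le> \<epsilon> * (2 * pi) + 2 * pi * (C * pi * E r)" .
      have "norm (A' pi - A' (- pi)) \<le> 2 * pi * C"
        using norm_triangle_ineq4[of "A' pi" "A' (- pi)"] A'_le[of pi] A'_le[of "- pi"]
        by (simp add: mult.commute)
      then have 2: "norm (poisson_kernel r pi *\<^sub>R (A' pi - A' (- pi))) \<le> poisson_kernel r pi * (2 * pi * C)"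
        using Pk0 by (simp add: mult_left_mono)
      have "2 * pi * norm (f (r * cis \<theta>) - c) = norm (2 * of_real pi * (f (r * cis \<theta>) - c))"
        by (simp add: norm_mult)
      also have "\<dots> \<le> norm (poisson_kernel r pi *\<^sub>R (A' pi - A' (- pi))) +
          norm (poisson_kernel r pi *\<^sub>R (A' pi - A' (- pi)) - 2 * of_real pi * (f (r * cis \<theta>) - c))"
        by (metis norm_triangle_sub norm_minus_commute)
      finally show ?thesis using 1 2 by linarith
    qed
    \<comment> \<open>At \<open>r = 1\<close> the two factors \<open>1 - r\<^sup>2\<close> vanish
      while their denominators stay 4 and \<open>(sin d) ^ 4\<close>; only the term with
      \<open>\<epsilon>\<close> survives, half of what is allowed.\<close>
    have "((\<lambda>r. poisson_kernel r pi * (2 * pi * C) + (\<epsilon> * (2 * pi) + 2 * pi * (C * pi * E r)))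
        \<longlongrightarrow> (1 - 1\<^sup>2) / (1 - 2 * 1 * cos pi + 1\<^sup>2) * (2 * pi * C) + (\<epsilon> * (2 * pi) + 2 * pi * (C * pi * (2 * (1 - 1\<^sup>2) / (sin d) ^ 4)))) (at_left 1)"
      unfolding poisson_kernel_def poisson_denom_def E_def
      using sin_gt_zero[OF d(1,2)] by (intro tendsto_intros) auto
    moreover have "\<epsilon> * (2 * pi) < 2 * pi * e" using e by (simp add: \<epsilon>_def)
    ultimately have "\<forall>\<^sub>F r in at_left 1. poisson_kernel r pi * (2 * pi * C) + (\<epsilon> * (2 * pi) + 2 * pi * (C * pi * E r)) < 2 * pi * e"
      by (intro order_tendstoD(2)) auto
    moreover have "\<forall>\<^sub>F r in at_left 1. r \<in> {0<..<1::real}"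
      by (rule eventually_at_left_real) simp
    ultimately show "\<forall>\<^sub>F r in at_left 1. dist (f (of_real r * cis \<theta>)) c < e"
    proof eventually_elim
      case (elim r)
      then have "2 * pi * norm (f (r * cis \<theta>) - c) < 2 * pi * e"
        using bound[of r] by (intro le_less_trans[OF bound]) auto
      then show ?case by (simp add: dist_norm)
    qed
  qed
qed

text \<open>Along the radii \<open>\<rho>\<close> the dilations have an almost everywhere limit
  \<open>\<psi>\<close>, and their primitives converge to that of \<open>\<psi>\<close>. Almost
  every angle is a point where this primitive has derivative \<open>\<psi>\<close>, and there the
  full radial limit exists.\<close>

theorem Fatou_radial_limit:
  assumes f: "f holomorphic_on ball 0 1" and B: "\<And>z. z \<in> ball 0 1 \<Longrightarrow> norm (f z) \<le> B"
  shows "AE z in circle_measure. \<exists>l. ((\<lambda>r. f (of_real r * z)) \<longlongrightarrow> l) (at_left (1::real))"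
proof -
  obtain \<rho> :: "nat \<Rightarrow> real" where \<rho>: "\<And>n. 0 \<le> \<rho> n" "\<And>n. \<rho> n < 1" "\<rho> \<longlonglongrightarrow> 1"
    and AE: "AE z in circle_measure. convergent (\<lambda>n. f (of_real (\<rho> n) * z))"
    using AE_convergent_dilations[OF f B] by blast
  define E where "E = {t. \<not> convergent (\<lambda>n. f (of_real (\<rho> n) * cis t))}"
  have E: "negligible E"
    using AE unfolding E_def AE_circle_iff_negligible .
  \<comment> \<open>Replacing the values on the negligible set \<open>E\<close> by 0 gives
    convergence everywhere without changing any integral.\<close>
  define u where "u n t = (if t \<in> E then 0 else f (of_real (\<rho> n) * cis t))" for n t
  define \<psi> where "\<psi> t = lim (\<lambda>n. u n t)" for t
  have u_lim: "(\<lambda>n. u n t) \<longlonglongrightarrow> \<psi> t" for t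
    unfolding \<psi>_def by (cases "t \<in> E") (auto simp: u_def E_def convergent_LIMSEQ_iff)
  have cont: "continuous_on S (\<lambda>t. f (\<rho> n * cis t))" for S n
    using \<rho>(1,2)
    by (intro continuous_on_compose2[OF holomorphic_on_imp_continuous_on[OF f]])
      (auto intro!: continuous_intros simp: norm_mult)
  have u_int: "(u n has_integral integral {a..b} (\<lambda>t. f (\<rho> n * cis t))) {a..b}" for n a b
    using integrable_integral[OF integrable_continuous_real[OF cont]]
    by (rule has_integral_spike[OF E, rotated]) (auto simp: u_def)
  have "0 \<le> B" using B[of 0] norm_ge_zero[of "f 0"] by (simp add: order_trans[OF norm_ge_zero])
  then have u_le: "norm (u n t) \<le> B" for n t
    using \<rho>(1,2)[of n] by (auto simp: u_def norm_mult intro!: B)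
  have \<psi>: "\<psi> integrable_on {a..b}" "(\<lambda>n. integral {a..b} (u n)) \<longlonglongrightarrow> integral {a..b} \<psi>" for a b
    by (rule dominated_convergence[of u _ "\<lambda>_. B"]; use u_int u_le u_lim in \<open>auto intro: has_integral_integrable\<close>)+
  obtain N where N: "negligible N"
    "\<And>x a. x \<notin> N \<Longrightarrow> a < x \<Longrightarrow> ((\<lambda>t. integral {a..t} \<psi>) has_vector_derivative \<psi> x) (at x)"
    using Lebesgue_differentiation_real[OF \<psi>(1)] by blast
  \<comment> \<open>The lower limit of integration may move with \<open>\<theta>\<close>, since
    \<open>N\<close> serves all lower limits.\<close>
  have "((\<lambda>r. f (of_real r * cis \<theta>)) \<longlongrightarrow> \<psi> \<theta>) (at_left 1)" if "\<theta> \<notin> N" for \<theta>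
  proof (rule radial_limit_eq_derivative[OF f B \<rho>, where a = "\<theta> - 2 * pi" and \<Psi> = "\<lambda>t. integral {\<theta> - 2 * pi..t} \<psi>"])
    show "(\<lambda>n. integral {\<theta> - 2 * pi..t} (\<lambda>t. f (\<rho> n * cis t))) \<longlonglongrightarrow> integral {\<theta> - 2 * pi..t} \<psi>" for t
      using \<psi>(2)[of "\<theta> - 2 * pi" t] by (simp add: integral_unique[OF u_int])
  qed (use N(2)[OF that] in auto)
  then show ?thesis
    unfolding AE_circle_iff_negligible by (intro negligible_subset[OF N(1)]) auto
qed

section \<open>Moments of boundary maps\<close>

text \<open>The limit function differs from the measurable function \<open>h\<close> only inside a
  Borel null set, all of whose subsets are measurable in the completion.\<close>

lemma circle_borel_measurable_AE_limit:
  fixes u :: "nat \<Rightarrow> complex \<Rightarrow> complex"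
  assumes u: "\<And>n. u n \<in> borel_measurable circle_borel"
    and lim: "AE z in circle_measure. (\<lambda>n. u n z) \<longlonglongrightarrow> v z"
  shows "v \<in> borel_measurable circle_measure"
proof -
  define h where "h z = lim (\<lambda>n. u n z)" for z
  have h: "h \<in> borel_measurable circle_measure"
    unfolding h_def circle_measure_eq
    by (intro measurable_completion borel_measurable_lim_metric u)
  have AE: "AE z in circle_borel. v z = h z"
    using lim unfolding circle_measure_eq AE_completion_iff
    by eventually_elim (simp add: h_def limI)
  have "{z \<in> space circle_measure. v z \<in> S} \<in> sets circle_measure" if "S \<in> sets borel" for S
  proof -
    have 1: "{z \<in> space circle_measure. h z \<in> S} \<in> sets circle_measure"
      using h that by measurable
    have "Measurable.pred circle_measure (\<lambda>z. v z \<noteq> h z \<and> v z \<in> S)"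
      unfolding circle_measure_eq by (rule sets_completion_AE) (use AE in eventually_elim, auto)
    moreover have "Measurable.pred circle_measure (\<lambda>z. v z \<noteq> h z \<and> h z \<in> S)"
      unfolding circle_measure_eq by (rule sets_completion_AE) (use AE in eventually_elim, auto)
    moreover have "{z \<in> space circle_measure. v z \<in> S} = 
        ({z \<in> space circle_measure. h z \<in> S} - {z \<in> space circle_measure. v z \<noteq> h z \<and> h z \<in> S})
        \<union> {z \<in> space circle_measure. v z \<noteq> h z \<and> v z \<in> S}"
      by auto
    ultimately show ?thesis
      using 1 by (simp add: pred_def sets.Un sets.Diff)
  qed
  then show ?thesis
    by (intro measurableI) (auto simp: vimage_def Int_def conj_commute)
qed

lemma circle_bounded_convergence:
  fixes u :: "nat \<Rightarrow> complex \<Rightarrow> complex"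
  assumes "\<And>n. u n \<in> borel_measurable circle_measure" "v \<in> borel_measurable circle_measure"
    and "\<And>n z. z \<in> sphere 0 1 \<Longrightarrow> norm (u n z) \<le> B"
    and "AE z in circle_measure. (\<lambda>n. u n z) \<longlonglongrightarrow> v z"
  shows "(\<lambda>n. \<integral>z. u n z \<partial>circle_measure) \<longlonglongrightarrow> (\<integral>z. v z \<partial>circle_measure)"
  using assms by (intro integral_dominated_convergence[of _ _ _ "\<lambda>_. B"]) auto

text \<open>A fixed sequence increasing to 1: dominated convergence is applied to sequences, not to
  the one-sided limit in \<open>r\<close>.\<close>

definition radii :: "nat \<Rightarrow> real" where
  "radii n = 1 - 1 / real (Suc n)"

lemma radii_bounds: "0 \<le> radii n" "radii n < 1"
  by (auto simp: radii_def)

lemma radii_tendsto: "filterlim radii (at_left 1) sequentially"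
proof -
  have "(\<lambda>n. 1 - 1 / real (Suc n)) \<longlonglongrightarrow> 1 - 0"
    by (intro tendsto_diff tendsto_const LIMSEQ_Suc[OF lim_1_over_n])
  then show ?thesis
    unfolding radii_def filterlim_at by auto
qed

lemma inner_functionD:
  assumes "inner_function g"
  shows "g holomorphic_on ball 0 1" "\<And>z. norm z < 1 \<Longrightarrow> norm (g z) < 1"
    "g ` ball 0 1 \<subseteq> ball 0 1"
  using assms by (auto simp: inner_function_def image_subset_iff)

text \<open>True at every point, because the default value 1 is itself unimodular.\<close>

lemma norm_boundary_map [simp]: "norm (boundary_map g z) = 1"
  by (auto simp: boundary_map_def tendsto_Lim)

lemma boundary_map_eqI:
  assumes "((\<lambda>r. g (of_real r * z)) \<longlongrightarrow> l) (at_left (1::real))" "norm l = 1"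
  shows "boundary_map g z = l"
  using assms by (auto simp: boundary_map_def intro!: tendsto_Lim)

lemma AE_boundary_map:
  assumes "inner_function g"
  shows "AE z in circle_measure. ((\<lambda>r. g (of_real r * z)) \<longlongrightarrow> boundary_map g z) (at_left (1::real))"
  using assms unfolding inner_function_def
  by (auto elim!: eventually_mono simp: boundary_map_eqI)

lemma AE_radii:
  assumes "AE z in circle_measure. ((\<lambda>r. g (of_real r * z)) \<longlongrightarrow> G z) (at_left (1::real))"
  shows "AE z in circle_measure. (\<lambda>n. g (of_real (radii n) * z)) \<longlonglongrightarrow> G z"
  using assms by eventually_elim (rule filterlim_compose[OF _ radii_tendsto])

lemma borel_measurable_radial_limit:
  assumes "g holomorphic_on ball 0 1"
    and "AE z in circle_measure. ((\<lambda>r. g (of_real r * z)) \<longlongrightarrow> G z) (at_left (1::real))"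
  shows "G \<in> borel_measurable circle_measure"
  by (rule circle_borel_measurable_AE_limit[OF _ AE_radii[OF assms(2)]])
    (intro borel_measurable_circle_borelI continuous_on_dilation_sphere assms radii_bounds)

lemma borel_measurable_boundary_map:
  "inner_function g \<Longrightarrow> boundary_map g \<in> borel_measurable circle_measure"
  using borel_measurable_radial_limit AE_boundary_map inner_functionD(1) by blast

lemma holomorphic_on_dilation:
  assumes f: "f holomorphic_on ball 0 1" and r: "0 \<le> r" "r < 1"
  shows "(\<lambda>z. f (of_real r * z)) holomorphic_on cball 0 1"
proof -
  have "norm (of_real r * z) < 1" if "norm z \<le> 1" for z :: complex
  proof -
    have "r * norm z \<le> r * 1" using r that by (intro mult_left_mono) auto
    then show ?thesis using r by (simp add: norm_mult)
  qed
  then have "(\<lambda>z. of_real r * z) ` cball 0 1 \<subseteq> (ball 0 1 :: complex set)"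
    by (intro image_subsetI) simp
  moreover have "(\<lambda>z. of_real r * z :: complex) holomorphic_on cball 0 1"
    by (intro holomorphic_intros)
  ultimately have "(f \<circ> (\<lambda>z. of_real r * z)) holomorphic_on cball 0 1"
    using f by (intro holomorphic_on_compose_gen)
  then show ?thesis by (simp only: o_def)
qed

text \<open>\<open>Q\<close> is the shifted Taylor series, so that it is defined at 0 as well and
  its value there is the coefficient of order \<open>k\<close>.\<close>

lemma taylor_factor:
  assumes f: "f holomorphic_on ball 0 1"
  obtains Q where "Q holomorphic_on ball 0 1" "Q 0 = taylor_coeff f k"
    "\<And>w. norm w < 1 \<Longrightarrow> f w = (\<Sum>i<k. taylor_coeff f i * w ^ i) + w ^ k * Q w"
proof -
  define Q where "Q w = (\<Sum>i. taylor_coeff f (i + k) * w ^ i)" for w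
  have summ: "summable (\<lambda>i. taylor_coeff f (i + k) * w ^ i)" if "norm w < 1" for w
  proof -
    have "\<exists>s>norm w. s < 1" using that by (rule dense)
    then obtain s where s: "norm w < s" "s < 1" by auto
    then have "s > 0" using norm_ge_zero[of w] by linarith
    have "summable (\<lambda>n. taylor_coeff f n * of_real s ^ n)"
      using s \<open>s > 0\<close> by (intro summable_norm_cancel[OF summable_taylor_coeff[OF f]]) auto
    then have "summable (\<lambda>n. taylor_coeff f (n + k) * of_real s ^ (n + k))"
      by (rule summable_ignore_initial_segment)
    then have "summable (\<lambda>n. (taylor_coeff f (n + k) * of_real s ^ (n + k)) / of_real s ^ k)"
      by (rule summable_divide)
    then have "summable (\<lambda>n. taylor_coeff f (n + k) * of_real s ^ n)"
      using \<open>s > 0\<close> by (simp add: power_add)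
    then show ?thesis
      by (rule powser_inside) (use s \<open>s > 0\<close> in auto)
  qed
  show ?thesis
  proof (rule that[of Q])
    show "Q holomorphic_on ball 0 1"
      by (rule power_series_holomorphic[where a = "\<lambda>i. taylor_coeff f (i + k)"])
        (use summ in \<open>auto simp: Q_def summable_sums\<close>)
    show "Q 0 = taylor_coeff f k"
      unfolding Q_def by (subst powser_zero) simp
    fix w :: complex assume w: "norm w < 1"
    have sums: "(\<lambda>n. taylor_coeff f n * w ^ n) sums f w"
      using holomorphic_power_series[OF f, of w] w by (simp add: taylor_coeff_def)
    have "(\<lambda>i. taylor_coeff f (i + k) * w ^ (i + k)) sums (f w - (\<Sum>i<k. taylor_coeff f i * w ^ i))"
      by (rule sums_split_initial_segment[OF sums])
    moreover have "(\<lambda>i. w ^ k * (taylor_coeff f (i + k) * w ^ i)) sums (w ^ k * Q w)"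
      unfolding Q_def by (intro sums_mult summable_sums summ w)
    ultimately have "f w - (\<Sum>i<k. taylor_coeff f i * w ^ i) = w ^ k * Q w"
      by (intro sums_unique2) (auto simp: power_add mult_ac)
    then show "f w = (\<Sum>i<k. taylor_coeff f i * w ^ i) + w ^ k * Q w"
      by (simp add: algebra_simps)
  qed
qed

text \<open>Division by \<open>w ^ k\<close> is dangerous only near 0. On the disc of radius 1/2
  compactness bounds \<open>Q\<close>; outside it the division costs at most the factor
  \<open>2 ^ k\<close>.\<close>

lemma bounded_power_factor:
  fixes Q :: "complex \<Rightarrow> complex"
  assumes Q: "continuous_on (ball 0 1) Q" and B: "\<And>w. norm w < 1 \<Longrightarrow> norm (w ^ k * Q w) \<le> B"
  obtains C where "\<And>w. norm w < 1 \<Longrightarrow> norm (Q w) \<le> C"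
proof -
  have "compact (Q ` cball 0 (1/2))"
    by (intro compact_continuous_image continuous_on_subset[OF Q]) auto
  then obtain C where C: "\<And>w. norm w \<le> 1/2 \<Longrightarrow> norm (Q w) \<le> C"
    by (metis bounded_iff compact_imp_bounded imageI mem_cball_0)
  show ?thesis
  proof (rule that[of "max C (2 ^ k * B)"])
    fix w :: complex assume w: "norm w < 1"
    show "norm (Q w) \<le> max C (2 ^ k * B)"
    proof (cases "norm w \<le> 1/2")
      case False
      have "1 \<le> (2 * norm w) ^ k" using False by (intro one_le_power) auto
      then have "norm (Q w) \<le> (2 * norm w) ^ k * norm (Q w)"
        by (simp add: mult_le_cancel_right1)
      also have "\<dots> = 2 ^ k * norm (w ^ k * Q w)"
        by (simp add: norm_mult norm_power power_mult_distrib)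
      also have "\<dots> \<le> 2 ^ k * B" using B[OF w] by simp
      finally show ?thesis by simp
    qed (use C in \<open>auto simp: le_max_iff_disj\<close>)
  qed
qed

text \<open>A positive power of a dilation of \<open>f\<close> has mean \<open>f 0 ^ m = 0\<close>,
  and bounded convergence carries this to the boundary. Mixed powers reduce to it because the
  boundary map is unimodular.\<close>

lemma integral_boundary_power:
  assumes f: "inner_function f" "f 0 = 0"
  shows "(\<integral>z. boundary_map f z ^ j * cnj (boundary_map f z) ^ k \<partial>circle_measure) = (if j = k then 1 else 0)"
proof -
  note fD = inner_functionD[OF f(1)]
  define T where "T = boundary_map f"
  have T: "norm (T z) = 1" "T \<in> borel_measurable circle_measure" for z
    using borel_measurable_boundary_map[OF f(1)] by (auto simp: T_def)
  have cnj_pow: "T z ^ m * cnj (T z) ^ m = 1" for z m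
    using T(1)[of z] complex_norm_square[of "T z"] by (simp flip: power_mult_distrib)
  have pow: "(\<integral>z. T z ^ m \<partial>circle_measure) = 0" if "m > 0" for m
  proof -
    have "(\<lambda>n. \<integral>z. f (of_real (radii n) * z) ^ m \<partial>circle_measure) \<longlonglongrightarrow> (\<integral>z. T z ^ m \<partial>circle_measure)"
    proof (rule circle_bounded_convergence[where B = 1])
      show "(\<lambda>z. f (of_real (radii n) * z) ^ m) \<in> borel_measurable circle_measure" for n
        by (intro borel_measurable_circleI continuous_on_power continuous_on_dilation_sphere[OF fD(1)] radii_bounds)
      show "norm (f (of_real (radii n) * z) ^ m) \<le> 1" if "z \<in> sphere 0 1" for n z
        using that radii_bounds[of n] fD(2)[of "of_real (radii n) * z"] by (simp add: norm_mult norm_power power_le_one)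
      show "AE z in circle_measure. (\<lambda>n. f (of_real (radii n) * z) ^ m) \<longlonglongrightarrow> T z ^ m"
        using AE_radii[OF AE_boundary_map[OF f(1)]]
        by eventually_elim (auto intro!: tendsto_intros simp: T_def)
    qed (use T in measurable)
    moreover have "(\<integral>z. f (of_real (radii n) * z) ^ m \<partial>circle_measure) = 0" for n
      using that f(2)
      by (subst integral_circle_mean_value) (auto intro!: holomorphic_intros holomorphic_on_dilation fD radii_bounds)
    ultimately have "(\<lambda>n::nat. 0) \<longlonglongrightarrow> (\<integral>z. T z ^ m \<partial>circle_measure)" by simp
    then show ?thesis by (simp add: LIMSEQ_const_iff)
  qed
  have "(\<integral>z. T z ^ j * cnj (T z) ^ k \<partial>circle_measure) = (if j = k then 1 else 0)"
  proof (cases j k rule: linorder_cases)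
    case less
    then have "(\<lambda>z. T z ^ j * cnj (T z) ^ k) = (\<lambda>z. cnj (T z ^ (k - j)))"
      using cnj_pow[of _ j] power_add[of "cnj (T _)" j "k - j"] by (auto simp flip: mult.assoc)
    then show ?thesis
      using less pow[of "k - j"] Bochner_Integration.integral_cnj[of circle_measure "\<lambda>z. T z ^ (k - j)"]
      by simp
  next
    case equal
    then show ?thesis
      by (simp add: cnj_pow)
  next
    case greater
    then have "(\<lambda>z. T z ^ j * cnj (T z) ^ k) = (\<lambda>z. T z ^ (j - k))"
      using cnj_pow[of _ k] power_add[of "T _" "j - k" k] by (auto simp: mult.assoc)
    then show ?thesis
      using greater pow[of "j - k"] by simp
  qed
  then show ?thesis by (simp add: T_def)
qed

text \<open>As \<open>\<bar>f (r z)\<bar> \<rightarrow> 1\<close> almost everywhere, the factor \<open>f\<^sup>k\<close> of the remainder cancels against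
  \<open>cnj f\<^sup>k\<close> in the limit, and what is left has the mean value \<open>Q (f 0)\<close>.\<close>

lemma integral_radial_limit_cnj_power:
  assumes f: "inner_function f" "f 0 = 0"
    and h: "h holomorphic_on ball 0 1" "\<And>w. norm w < 1 \<Longrightarrow> norm (h w) \<le> B"
    and Q: "Q holomorphic_on ball 0 1"
      "\<And>w. norm w < 1 \<Longrightarrow> h w = (\<Sum>i<k. b i * w ^ i) + w ^ k * Q w"
    and G: "AE z in circle_measure. ((\<lambda>r. h (f (of_real r * z))) \<longlongrightarrow> G z) (at_left (1::real))"
  shows "(\<integral>z. G z * cnj (boundary_map f z) ^ k \<partial>circle_measure) = Q 0"
proof -
  note fD = inner_functionD[OF f(1)]
  define T where "T = boundary_map f"
  define F where "F n z = f (of_real (radii n) * z)" for n z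
  have T: "norm (T z) = 1" "T \<in> borel_measurable circle_measure" for z
    using borel_measurable_boundary_map[OF f(1)] by (auto simp: T_def)
  have cnj_T: "(\<lambda>z. cnj (T z)) \<in> borel_measurable circle_measure"
    by (rule measurable_compose[OF T(2)]) (intro borel_measurable_continuous_onI continuous_intros)
  have hf: "(\<lambda>z. h (f z)) holomorphic_on ball 0 1"
    using holomorphic_on_compose_gen[OF fD(1) h(1) fD(3)] by (simp add: o_def)
  have Qf: "(\<lambda>z. Q (f z)) holomorphic_on ball 0 1"
    using holomorphic_on_compose_gen[OF fD(1) Q(1) fD(3)] by (simp add: o_def)
  have G_meas: "G \<in> borel_measurable circle_measure"
    by (rule borel_measurable_radial_limit[OF hf G])
  have F_cont: "continuous_on (sphere 0 1) (F n)" for n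
    unfolding F_def using continuous_on_dilation_sphere[OF fD(1) radii_bounds] .
  have hF_cont: "continuous_on (sphere 0 1) (\<lambda>z. h (F n z))" for n
    unfolding F_def using continuous_on_dilation_sphere[OF hf radii_bounds] .
  have QF_cont: "continuous_on (sphere 0 1) (\<lambda>z. Q (F n z))" for n
    unfolding F_def using continuous_on_dilation_sphere[OF Qf radii_bounds] .
  have F_less: "norm (F n z) < 1" if "z \<in> sphere 0 1" for n z
    unfolding F_def using that radii_bounds[of n] by (intro fD) (simp add: norm_mult)
  have F_lim: "AE z in circle_measure. (\<lambda>n. F n z) \<longlonglongrightarrow> T z"
    unfolding F_def T_def by (rule AE_radii[OF AE_boundary_map[OF f(1)]])
  have hF_lim: "AE z in circle_measure. (\<lambda>n. h (F n z)) \<longlonglongrightarrow> G z"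
    unfolding F_def by (rule AE_radii[OF G])
  have h_le: "norm (h (F n z)) \<le> B" if "z \<in> sphere 0 1" for n z
    by (intro h F_less that)
  have "0 \<le> B" using h(2)[of 0] norm_ge_zero[of "h 0"] by (simp add: order_trans[OF norm_ge_zero])
  \<comment> \<open>Only \<open>h\<close> is known to be bounded. This makes the remainder bounded,
    and then \<open>Q\<close> itself by \<open>bounded_power_factor\<close>.\<close>
  have "norm (w ^ k * Q w) \<le> B + (\<Sum>i<k. norm (b i))" if w: "norm w < 1" for w
  proof -
    have "w ^ k * Q w = h w - (\<Sum>i<k. b i * w ^ i)" using Q(2)[OF w] by simp
    also have "norm \<dots> \<le> norm (h w) + norm (\<Sum>i<k. b i * w ^ i)" by (rule norm_triangle_ineq4)
    also have "norm (\<Sum>i<k. b i * w ^ i) \<le> (\<Sum>i<k. norm (b i))"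
      using w by (intro sum_norm_le) (simp add: norm_mult norm_power mult_left_le power_le_one)
    finally show ?thesis using h(2)[OF w] by simp
  qed
  then obtain C where C: "\<And>w. norm w < 1 \<Longrightarrow> norm (Q w) \<le> C"
    using bounded_power_factor[OF holomorphic_on_imp_continuous_on[OF Q(1)]] by metis
  have lim1: "(\<lambda>n. \<integral>z. h (F n z) * cnj (F n z) ^ k \<partial>circle_measure) \<longlonglongrightarrow> (\<integral>z. G z * cnj (T z) ^ k \<partial>circle_measure)"
  proof (rule circle_bounded_convergence[where B = B])
    show "(\<lambda>z. h (F n z) * cnj (F n z) ^ k) \<in> borel_measurable circle_measure" for n
      by (intro borel_measurable_circleI continuous_intros hF_cont F_cont)
    show "norm (h (F n z) * cnj (F n z) ^ k) \<le> B" if "z \<in> sphere 0 1" for n z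
      using h_le[OF that, of n] F_less[OF that, of n] \<open>0 \<le> B\<close>
      by (auto simp: norm_mult norm_power power_le_one intro!: order_trans[OF mult_left_le])
    show "AE z in circle_measure. (\<lambda>n. h (F n z) * cnj (F n z) ^ k) \<longlonglongrightarrow> G z * cnj (T z) ^ k"
      using F_lim hF_lim by eventually_elim (intro tendsto_intros)
  qed (intro borel_measurable_times borel_measurable_power T cnj_T G_meas)
  \<comment> \<open>The low-order terms die in the limit by orthogonality of the powers of the
    boundary map.\<close>
  have lim2: "(\<lambda>n. \<integral>z. F n z ^ i * cnj (F n z) ^ k \<partial>circle_measure) \<longlonglongrightarrow> 0" if "i < k" for i
  proof -
    have "(\<lambda>n. \<integral>z. F n z ^ i * cnj (F n z) ^ k \<partial>circle_measure) \<longlonglongrightarrow> (\<integral>z. T z ^ i * cnj (T z) ^ k \<partial>circle_measure)"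
    proof (rule circle_bounded_convergence[where B = 1])
      show "(\<lambda>z. F n z ^ i * cnj (F n z) ^ k) \<in> borel_measurable circle_measure" for n
        by (intro borel_measurable_circleI continuous_intros F_cont)
      show "norm (F n z ^ i * cnj (F n z) ^ k) \<le> 1" if "z \<in> sphere 0 1" for n z
        using F_less[OF that, of n] by (simp add: norm_mult norm_power power_le_one mult_le_one)
      show "AE z in circle_measure. (\<lambda>n. F n z ^ i * cnj (F n z) ^ k) \<longlonglongrightarrow> T z ^ i * cnj (T z) ^ k"
        using F_lim by eventually_elim (intro tendsto_intros)
    qed (intro borel_measurable_times borel_measurable_power T cnj_T)
    then show ?thesis
      using integral_boundary_power[OF f, of i k] that by (simp add: T_def)
  qed
  \<comment> \<open>No convergence of \<open>Q (F n z)\<close> is claimed: its boundedness is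
    enough, since the first factor tends to 0.\<close>
  have lim3: "(\<lambda>n. \<integral>z. (of_real (norm (F n z) ^ (2 * k)) - 1) * Q (F n z) \<partial>circle_measure) \<longlonglongrightarrow> (\<integral>z. 0 \<partial>circle_measure)"
  proof (rule circle_bounded_convergence[where B = "1 * C"])
    show "(\<lambda>z. (of_real (norm (F n z) ^ (2 * k)) - 1) * Q (F n z)) \<in> borel_measurable circle_measure" for n
      by (intro borel_measurable_circleI continuous_intros F_cont QF_cont)
    have le: "norm (of_real (norm (F n z) ^ (2 * k)) - 1 :: complex) \<le> 1" if "z \<in> sphere 0 1" for n z
    proof -
      have "norm (F n z) ^ (2 * k) \<le> 1" "0 \<le> norm (F n z) ^ (2 * k)"
        using F_less[OF that, of n] by (auto simp: power_le_one)
      then have "norm (norm (F n z) ^ (2 * k) - 1) \<le> 1" by simp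
      then show ?thesis by (metis norm_of_real of_real_1 of_real_diff real_norm_def)
    qed
    show "norm ((of_real (norm (F n z) ^ (2 * k)) - 1) * Q (F n z)) \<le> 1 * C" if "z \<in> sphere 0 1" for n z
      unfolding norm_mult using le[OF that, of n] C[OF F_less[OF that, of n]] by (intro mult_mono) auto
    show "AE z in circle_measure. (\<lambda>n. (of_real (norm (F n z) ^ (2 * k)) - 1) * Q (F n z)) \<longlonglongrightarrow> 0"
      using F_lim AE_space[of circle_measure]
    proof eventually_elim
      case (elim z)
      have "(\<lambda>n. of_real (norm (F n z) ^ (2 * k)) - 1 :: complex) \<longlonglongrightarrow> of_real (norm (T z) ^ (2 * k)) - 1"
        by (intro tendsto_intros elim)
      then have "(\<lambda>n. of_real (norm (F n z) ^ (2 * k)) - 1 :: complex) \<longlonglongrightarrow> 0"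
        by (simp add: T)
      moreover have "Bseq (\<lambda>n. Q (F n z))"
        using C F_less elim by (intro BseqI'[of _ C]) auto
      ultimately show ?case
        using bounded_bilinear.Zfun_prod_Bfun[OF bounded_bilinear_mult]
        by (simp add: tendsto_Zfun_iff Bfun_def)
    qed
  qed simp
  have Q_mean: "(\<integral>z. Q (F n z) \<partial>circle_measure) = Q 0" for n
    unfolding F_def using f(2)
    by (subst integral_circle_mean_value) (auto intro!: holomorphic_on_dilation[OF Qf] radii_bounds)
  \<comment> \<open>The remainder contributes \<open>Q (F n z)\<close> weighted by
    \<open>norm (F n z) ^ (2 * k)\<close>. Splitting off the weight 1 leaves a term whose mean is
    exactly \<open>Q 0\<close> for every \<open>n\<close>.\<close>
  have eq: "(\<integral>z. h (F n z) * cnj (F n z) ^ k \<partial>circle_measure) =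
      (\<Sum>i<k. b i * (\<integral>z. F n z ^ i * cnj (F n z) ^ k \<partial>circle_measure)) +
      ((\<integral>z. (of_real (norm (F n z) ^ (2 * k)) - 1) * Q (F n z) \<partial>circle_measure) + Q 0)" for n
  proof -
    have "(\<integral>z. h (F n z) * cnj (F n z) ^ k \<partial>circle_measure) =
      (\<integral>z. (\<Sum>i<k. b i * (F n z ^ i * cnj (F n z) ^ k)) +
        ((of_real (norm (F n z) ^ (2 * k)) - 1) * Q (F n z) + Q (F n z)) \<partial>circle_measure)"
    proof (rule Bochner_Integration.integral_cong)
      fix z assume "z \<in> space circle_measure"
      then have "h (F n z) = (\<Sum>i<k. b i * F n z ^ i) + F n z ^ k * Q (F n z)"
        by (intro Q F_less) simp
      moreover have "F n z ^ k * cnj (F n z) ^ k = of_real (norm (F n z) ^ (2 * k))"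
        by (simp only: power_mult flip: power_mult_distrib complex_norm_square of_real_power)
      then have "F n z ^ k * Q (F n z) * cnj (F n z) ^ k = of_real (norm (F n z) ^ (2 * k)) * Q (F n z)"
        by (metis mult.assoc mult.commute)
      ultimately show "h (F n z) * cnj (F n z) ^ k = (\<Sum>i<k. b i * (F n z ^ i * cnj (F n z) ^ k)) +
        ((of_real (norm (F n z) ^ (2 * k)) - 1) * Q (F n z) + Q (F n z))"
        by (simp add: distrib_right left_diff_distrib sum_distrib_right mult.assoc)
    qed simp
    also have "\<dots> = (\<Sum>i<k. b i * (\<integral>z. F n z ^ i * cnj (F n z) ^ k \<partial>circle_measure)) +
      ((\<integral>z. (of_real (norm (F n z) ^ (2 * k)) - 1) * Q (F n z) \<partial>circle_measure) + (\<integral>z. Q (F n z) \<partial>circle_measure))"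
      by (subst Bochner_Integration.integral_add Bochner_Integration.integral_sum;
          (intro integrable_circleI continuous_intros F_cont QF_cont)?)+ simp
    finally show ?thesis by (simp only: Q_mean)
  qed
  have "(\<lambda>n. \<integral>z. h (F n z) * cnj (F n z) ^ k \<partial>circle_measure) \<longlonglongrightarrow> (\<Sum>i<k. b i * 0) + ((\<integral>z. 0 \<partial>circle_measure) + Q 0)"
    unfolding eq by (intro tendsto_intros lim2 lim3) auto
  then show ?thesis
    using LIMSEQ_unique[OF lim1] by (simp add: T_def)
qed

section \<open>Composition and measure preservation\<close>

lemma integrable_circle_bounded:
  fixes u :: "complex \<Rightarrow> 'b::{banach, second_countable_topology}"
  assumes "u \<in> borel_measurable circle_measure" "\<And>z. z \<in> sphere 0 1 \<Longrightarrow> norm (u z) \<le> B"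
  shows "integrable circle_measure u"
  using assms by (intro circle.integrable_const_bound[of _ B]) auto

lemma borel_measurable_cnj:
  "u \<in> borel_measurable M \<Longrightarrow> (\<lambda>z. cnj (u z)) \<in> borel_measurable M"
  by (rule measurable_compose[where g = cnj]) (auto intro!: borel_measurable_continuous_onI continuous_intros)

text \<open>The radial limit \<open>G\<close> has modulus at most 1, so it is enough that its mean
  square is at least 1. That lower bound comes from comparing \<open>G\<close> with \<open>g\<close>
  itself, whose Taylor coefficients are the coefficients of \<open>G\<close> against the powers of
  \<open>T\<close>.\<close>

lemma inner_function_comp:
  assumes f: "inner_function f" "f 0 = 0" and g: "inner_function g"
  shows "inner_function (g \<circ> f)"
proof -
  note fD = inner_functionD[OF f(1)] and gD = inner_functionD[OF g]
  define T where "T = boundary_map f"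
  have T: "norm (T z) = 1" "T \<in> borel_measurable circle_measure" for z
    using borel_measurable_boundary_map[OF f(1)] by (auto simp: T_def)
  note cnj_T = borel_measurable_cnj[OF T(2)]
  define b where "b = taylor_coeff g"
  have gf: "(\<lambda>z. g (f z)) holomorphic_on ball 0 1"
    using holomorphic_on_compose_gen[OF fD(1) gD(1) fD(3)] by (simp add: o_def)
  have le1: "norm (g (f z)) \<le> 1" if "norm z < 1" for z
    using gD(2)[OF fD(2)[OF that]] by simp
  have ex: "AE z in circle_measure. \<exists>l. ((\<lambda>r. g (f (of_real r * z))) \<longlongrightarrow> l) (at_left (1::real))"
    by (rule Fatou_radial_limit[OF gf, of 1]) (use le1 in auto)
  define G' where "G' z = Lim (at_left (1::real)) (\<lambda>r. g (f (of_real r * z)))" for z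
  have G': "AE z in circle_measure. ((\<lambda>r. g (f (of_real r * z))) \<longlongrightarrow> G' z) (at_left (1::real))"
    using ex
  proof eventually_elim
    case (elim z)
    then obtain l where l: "((\<lambda>r. g (f (of_real r * z))) \<longlongrightarrow> l) (at_left (1::real))" ..
    then show ?case by (simp add: G'_def tendsto_Lim[OF _ l])
  qed
  \<comment> \<open>Truncation changes \<open>G'\<close> only on a null set and makes the bound by 1
    hold at every point, as integrability arguments below use it.\<close>
  define G where "G z = (if norm (G' z) \<le> 1 then G' z else 0)" for z
  have "AE z in circle_measure. norm (G' z) \<le> 1"
    using AE_radii[OF G'] AE_space
  proof eventually_elim
    case (elim z)
    show ?case
      by (rule Lim_bounded[OF tendsto_norm[OF elim(1)], of 0])
        (use elim(2) radii_bounds in \<open>auto intro!: le1 simp: norm_mult\<close>)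
  qed
  with G' have G: "AE z in circle_measure. ((\<lambda>r. g (f (of_real r * z))) \<longlongrightarrow> G z) (at_left (1::real))"
    by eventually_elim (simp add: G_def)
  have G_le: "norm (G z) \<le> 1" for z by (simp add: G_def)
  have G_meas: "G \<in> borel_measurable circle_measure"
    by (rule borel_measurable_radial_limit[OF gf G])
  have coeff: "(\<integral>z. G z * cnj (T z) ^ k \<partial>circle_measure) = b k" for k
  proof -
    obtain Q where Q: "Q holomorphic_on ball 0 1" "Q 0 = taylor_coeff g k"
      "\<And>w. norm w < 1 \<Longrightarrow> g w = (\<Sum>i<k. taylor_coeff g i * w ^ i) + w ^ k * Q w"
      using taylor_factor[OF gD(1)] by metis
    show ?thesis
      using integral_radial_limit_cnj_power[OF f gD(1) less_imp_le[OF gD(2)] Q(1,3) G] Q(2)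
      by (simp add: T_def b_def)
  qed
  have Bessel: "(\<Sum>k<K. (norm (b k))\<^sup>2) \<le> (\<integral>z. (norm (G z))\<^sup>2 \<partial>circle_measure)" for K
  proof -
    \<comment> \<open>The orthogonal projection of \<open>G\<close> onto the first \<open>K\<close>
      powers of \<open>T\<close>; the inequality is the expansion of the mean square of
      \<open>G - S\<close>.\<close>
    define S where "S z = (\<Sum>k<K. b k * T z ^ k)" for z
    have S_meas: "S \<in> borel_measurable circle_measure"
      unfolding S_def using T(2) by measurable
    have S_le: "norm (S z) \<le> (\<Sum>k<K. norm (b k))" for z
      unfolding S_def by (rule sum_norm_le) (simp add: norm_mult norm_power T)
    have int_term: "integrable circle_measure (\<lambda>z. G z * (cnj (b k) * cnj (T z) ^ k))" for k
    proof (rule integrable_circle_bounded[where B = "1 * (norm (b k) * 1)"])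
      show "norm (G z * (cnj (b k) * cnj (T z) ^ k)) \<le> 1 * (norm (b k) * 1)" for z
        unfolding norm_mult norm_power complex_mod_cnj T(1) power_one
        by (intro mult_mono G_le) auto
    qed (intro borel_measurable_times borel_measurable_power G_meas cnj_T borel_measurable_const)
    have int_term2: "integrable circle_measure (\<lambda>z. T z ^ i * cnj (T z) ^ k)" for i k
      by (rule integrable_circle_bounded[where B = 1])
        (auto intro!: borel_measurable_times borel_measurable_power cnj_T T(2) simp: norm_mult norm_power T(1))
    have GS: "(\<integral>z. G z * cnj (S z) \<partial>circle_measure) = of_real (\<Sum>k<K. (norm (b k))\<^sup>2)"
    proof -
      have "(\<integral>z. G z * cnj (S z) \<partial>circle_measure) = (\<integral>z. (\<Sum>k<K. G z * (cnj (b k) * cnj (T z) ^ k)) \<partial>circle_measure)"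
        by (simp add: S_def sum_distrib_left)
      also have "\<dots> = (\<Sum>k<K. \<integral>z. G z * (cnj (b k) * cnj (T z) ^ k) \<partial>circle_measure)"
        by (rule Bochner_Integration.integral_sum) (rule int_term)
      also have "\<dots> = (\<Sum>k<K. cnj (b k) * (\<integral>z. G z * cnj (T z) ^ k \<partial>circle_measure))"
        by (intro sum.cong refl, subst integral_mult_right_zero[symmetric]) (simp add: mult_ac)
      also have "\<dots> = (\<Sum>k<K. of_real ((norm (b k))\<^sup>2))"
        unfolding coeff complex_norm_square by (simp add: mult.commute)
      finally show ?thesis by simp
    qed
    have SS: "(\<integral>z. S z * cnj (S z) \<partial>circle_measure) = of_real (\<Sum>k<K. (norm (b k))\<^sup>2)"
    proof -
      have "(\<integral>z. S z * cnj (S z) \<partial>circle_measure) =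
          (\<integral>z. (\<Sum>i<K. \<Sum>k<K. (b i * cnj (b k)) * (T z ^ i * cnj (T z) ^ k)) \<partial>circle_measure)"
        by (simp add: S_def sum_product mult_ac)
      also have "\<dots> = (\<Sum>i<K. \<integral>z. (\<Sum>k<K. (b i * cnj (b k)) * (T z ^ i * cnj (T z) ^ k)) \<partial>circle_measure)"
        by (intro Bochner_Integration.integral_sum Bochner_Integration.integrable_sum integrable_mult_right int_term2)
      also have "\<dots> = (\<Sum>i<K. \<Sum>k<K. (b i * cnj (b k)) * (\<integral>z. T z ^ i * cnj (T z) ^ k \<partial>circle_measure))"
        by (subst Bochner_Integration.integral_sum) (intro integrable_mult_right int_term2, simp)
      also have "\<dots> = (\<Sum>i<K. b i * cnj (b i))"
        unfolding T_def integral_boundary_power[OF f] by (simp add: if_distrib cong: if_cong)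
      finally show ?thesis by (simp only: complex_norm_square of_real_sum)
    qed
    define C where "C = (\<Sum>k<K. norm (b k))"
    have C0: "0 \<le> C" unfolding C_def by (intro sum_nonneg) auto
    have int1: "integrable circle_measure (\<lambda>z. (norm (G z))\<^sup>2)"
      by (rule integrable_circle_bounded[where B = 1])
        (use G_meas G_le in \<open>auto simp: power_le_one\<close>)
    have S_le: "norm (S z) \<le> C" for z
      using S_le by (simp add: C_def)
    note cnj_S = borel_measurable_cnj[OF S_meas]
    have int2: "integrable circle_measure (\<lambda>z. G z * cnj (S z))"
    proof (rule integrable_circle_bounded[where B = "1 * C"])
      show "norm (G z * cnj (S z)) \<le> 1 * C" for z
        unfolding norm_mult complex_mod_cnj by (intro mult_mono G_le S_le) auto
    qed (intro borel_measurable_times G_meas cnj_S)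
    have int3: "integrable circle_measure (\<lambda>z. S z * cnj (S z))"
    proof (rule integrable_circle_bounded[where B = "C * C"])
      show "norm (S z * cnj (S z)) \<le> C * C" for z
        unfolding norm_mult complex_mod_cnj by (intro mult_mono S_le C0) auto
    qed (intro borel_measurable_times S_meas cnj_S)
    have "0 \<le> (\<integral>z. (norm (G z - S z))\<^sup>2 \<partial>circle_measure)" by simp
    also have "(\<lambda>z. (norm (G z - S z))\<^sup>2) = (\<lambda>z. (norm (G z))\<^sup>2 - 2 * Re (G z * cnj (S z)) + Re (S z * cnj (S z)))"
      by (intro ext, simp only: cmod_power2) (simp add: power2_eq_square algebra_simps)
    also have "(\<integral>z. (norm (G z))\<^sup>2 - 2 * Re (G z * cnj (S z)) + Re (S z * cnj (S z)) \<partial>circle_measure) =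
        (\<integral>z. (norm (G z))\<^sup>2 \<partial>circle_measure) - 2 * Re (\<integral>z. G z * cnj (S z) \<partial>circle_measure)
          + Re (\<integral>z. S z * cnj (S z) \<partial>circle_measure)"
    proof -
      have "(\<integral>z. a z - 2 * Re (p z) + Re (q z) \<partial>circle_measure) =
          (\<integral>z. a z \<partial>circle_measure) - 2 * Re (\<integral>z. p z \<partial>circle_measure) + Re (\<integral>z. q z \<partial>circle_measure)"
        if "integrable circle_measure a" "integrable circle_measure p" "integrable circle_measure q"
        for a and p q :: "complex \<Rightarrow> complex"
        using that by simp
      from this[OF int1 int2 int3] show ?thesis .
    qed
    finally show ?thesis
      unfolding GS SS by simp
  qed
  \<comment> \<open>The left side is a series in the same coefficients, damped by powers of
    \<open>radii n\<close>, so the Bessel bound dominates it. It tends to 1 because \<open>g\<close>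
    is inner.\<close>
  have "(\<integral>z. (norm (g (of_real (radii n) * z)))\<^sup>2 \<partial>circle_measure) \<le> (\<integral>z. (norm (G z))\<^sup>2 \<partial>circle_measure)" for n
  proof (rule LIMSEQ_le_const2)
    show "(\<lambda>K. \<Sum>k<K. (norm (b k) * radii n ^ k)\<^sup>2) \<longlonglongrightarrow> (\<integral>z. (norm (g (of_real (radii n) * z)))\<^sup>2 \<partial>circle_measure)"
      using integral_dilation_power2[OF gD(1) radii_bounds[of n]] by (simp add: sums_def b_def)
    have "(\<Sum>k<K. (norm (b k) * radii n ^ k)\<^sup>2) \<le> (\<Sum>k<K. (norm (b k))\<^sup>2)" for K
      using radii_bounds[of n]
      by (intro sum_mono power_mono mult_left_le) (auto simp: power_le_one)
    then show "\<exists>N. \<forall>K\<ge>N. (\<Sum>k<K. (norm (b k) * radii n ^ k)\<^sup>2) \<le> (\<integral>z. (norm (G z))\<^sup>2 \<partial>circle_measure)"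
      using Bessel order_trans by blast
  qed
  moreover have "(\<lambda>n. \<integral>z. (norm (g (of_real (radii n) * z)))\<^sup>2 \<partial>circle_measure) \<longlonglongrightarrow> (\<integral>z. 1 \<partial>circle_measure)"
  proof (rule integral_dominated_convergence[of _ _ _ "\<lambda>_. 1"])
    show "(\<lambda>z. (norm (g (of_real (radii n) * z)))\<^sup>2) \<in> borel_measurable circle_measure" for n
      by (intro borel_measurable_circleI continuous_on_power continuous_on_norm continuous_on_dilation_sphere gD radii_bounds)
    show "AE z in circle_measure. norm ((norm (g (of_real (radii n) * z)))\<^sup>2) \<le> 1" for n
      using radii_bounds[of n]
      by (intro AE_I2) (auto simp: norm_mult intro!: power_le_one less_imp_le[OF gD(2)])
    show "AE z in circle_measure. (\<lambda>n. (norm (g (of_real (radii n) * z)))\<^sup>2) \<longlonglongrightarrow> 1"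
      using AE_radii[OF AE_boundary_map[OF g]]
    proof eventually_elim
      case (elim z)
      from tendsto_power[OF tendsto_norm[OF elim], of 2] show ?case by simp
    qed
  qed auto
  ultimately have "1 \<le> (\<integral>z. (norm (G z))\<^sup>2 \<partial>circle_measure)"
    by (intro LIMSEQ_le_const2[where X = "\<lambda>n. \<integral>z. (norm (g (of_real (radii n) * z)))\<^sup>2 \<partial>circle_measure"]) auto
  moreover have int: "integrable circle_measure (\<lambda>z. (norm (G z))\<^sup>2)"
    by (rule integrable_circle_bounded[where B = 1])
      (use G_meas G_le in \<open>auto simp: power_le_one\<close>)
  then have "(\<integral>z. 1 - (norm (G z))\<^sup>2 \<partial>circle_measure) = 1 - (\<integral>z. (norm (G z))\<^sup>2 \<partial>circle_measure)"
    by simp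
  moreover have nn: "0 \<le> 1 - (norm (G z))\<^sup>2" for z
    using G_le[of z] by (simp add: power_le_one)
  moreover have "0 \<le> (\<integral>z. 1 - (norm (G z))\<^sup>2 \<partial>circle_measure)"
    by (intro integral_nonneg_AE AE_I2 nn)
  ultimately have "(\<integral>z. 1 - (norm (G z))\<^sup>2 \<partial>circle_measure) = 0"
    by linarith
  then have "AE z in circle_measure. 1 - (norm (G z))\<^sup>2 = 0"
    by (subst (asm) integral_nonneg_eq_0_iff_AE) (use int nn in auto)
  with G have "AE z in circle_measure. \<exists>l. ((\<lambda>r. (g \<circ> f) (of_real r * z)) \<longlongrightarrow> l) (at_left (1::real)) \<and> norm l = 1"
  proof eventually_elim
    case (elim z)
    have "norm (G z) = 1"
      by (rule power2_eq_imp_eq) (use elim(2) in auto)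
    with elim(1) show ?case by auto
  qed
  then show ?thesis
    using gf le1 fD gD unfolding inner_function_def by (auto simp: o_def image_subset_iff)
qed

text \<open>The Schwarz factorisation \<open>h z = z * q z\<close> shows that \<open>h w ^ k\<close>
  has no Taylor terms below order \<open>k\<close> and the quotient \<open>q w ^ k\<close>, where
  \<open>q 0\<close> is the derivative of \<open>h\<close> at 0.\<close>

lemma integral_boundary_comp_cnj_power:
  assumes f: "inner_function f" "f 0 = 0" and hf: "inner_function (h \<circ> f)"
    and h: "h holomorphic_on ball 0 1" "h ` ball 0 1 \<subseteq> ball 0 1" "h 0 = 0"
  shows "(\<integral>z. boundary_map (h \<circ> f) z ^ k * cnj (boundary_map f z) ^ k \<partial>circle_measure) = deriv h 0 ^ k"
proof -
  obtain q where q: "q holomorphic_on ball 0 1" "\<And>z. norm z < 1 \<Longrightarrow> h z = z * q z" "deriv h 0 = q 0"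
    using Schwarz3[OF h(1,3)] by metis
  have h_le: "norm (h w) \<le> 1" if "norm w < 1" for w
    using h(2) that by (auto simp: image_subset_iff intro!: less_imp_le)
  have "(\<integral>z. boundary_map (h \<circ> f) z ^ k * cnj (boundary_map f z) ^ k \<partial>circle_measure) = q 0 ^ k"
  proof (rule integral_radial_limit_cnj_power[OF f, where h = "\<lambda>w. h w ^ k" and Q = "\<lambda>w. q w ^ k" and b = "\<lambda>_. 0" and B = 1])
    show "AE z in circle_measure. ((\<lambda>r. h (f (of_real r * z)) ^ k) \<longlongrightarrow> boundary_map (h \<circ> f) z ^ k) (at_left (1::real))"
      using AE_boundary_map[OF hf] by eventually_elim (auto intro!: tendsto_power)
    show "norm (h w ^ k) \<le> 1" if "norm w < 1" for w
      using h_le[OF that] by (simp add: norm_power power_le_one)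
    show "h w ^ k = (\<Sum>i<k. 0 * w ^ i) + w ^ k * q w ^ k" if "norm w < 1" for w
      by (simp add: q(2)[OF that] power_mult_distrib)
  qed (intro holomorphic_intros h q)+
  then show ?thesis by (simp add: q)
qed

text \<open>Monomials yield real polynomials, these yield continuous functions by Stone-Weierstrass,
  indicators of closed sets are bounded limits of continuous functions, and closed sets are an
  intersection-stable generator. The same principle serves measure preservation and
  ergodicity.\<close>

lemma circle_class_indicator:
  fixes P :: "(complex \<Rightarrow> complex) \<Rightarrow> bool"
  assumes monom: "\<And>j k. P (\<lambda>z. z ^ j * cnj z ^ k)"
    and add: "\<And>u v. P u \<Longrightarrow> P v \<Longrightarrow> P (\<lambda>z. u z + v z)"
    and scale: "\<And>u c. P u \<Longrightarrow> P (\<lambda>z. c * u z)"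
    and lim: "\<And>u v B. (\<And>n::nat. P (u n)) \<Longrightarrow> (\<And>n z. z \<in> sphere 0 1 \<Longrightarrow> norm (u n z) \<le> B) \<Longrightarrow>
      (\<And>z. z \<in> sphere 0 1 \<Longrightarrow> (\<lambda>n. u n z) \<longlonglongrightarrow> v z) \<Longrightarrow> P v"
    and A: "A \<in> sets borel"
  shows "P (indicator A)"
proof -
  have one: "P (\<lambda>z. 1)" using monom[of 0 0] by simp
  have zero: "P (\<lambda>z. 0)" using scale[OF one, of 0] by simp
  have "(indicator {} :: complex \<Rightarrow> complex) = (\<lambda>z. 0)" by auto
  then have empty: "P (indicator {})" using zero by simp
  \<comment> \<open>\<open>P\<close> is not closed under products. The arbitrary factor
    \<open>u\<close> lets the induction pass through \<open>p * q\<close>: the hypothesis for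
    \<open>p\<close> is used with \<open>q\<close> absorbed into \<open>u\<close>.\<close>
  have poly: "P (\<lambda>z. z ^ j * cnj z ^ k * (of_real (p z) * u z))"
    if "real_polynomial_function p" "\<And>j k. P (\<lambda>z. z ^ j * cnj z ^ k * u z)" for p u j k
    using that
  proof (induction p arbitrary: u j k)
    case (linear h)
    interpret h: bounded_linear h by fact
    \<comment> \<open>A real linear functional on the plane is twice the real part of multiplication
      by a constant, fixed by its values at 1 and \<open>\<i>\<close>.\<close>
    define \<alpha> where "\<alpha> = Complex (h 1) (- h \<i>) / 2"
    have "of_real (h z) = \<alpha> * z + cnj \<alpha> * cnj z" for z
    proof -
      have "h z = h (Re z *\<^sub>R 1 + Im z *\<^sub>R \<i>)"
        by (rule arg_cong[where f = h]) (simp add: complex_eq_iff)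
      also have "\<dots> = Re z * h 1 + Im z * h \<i>"
        by (simp add: h.add h.scaleR)
      finally show ?thesis by (simp add: complex_eq_iff \<alpha>_def field_simps)
    qed
    then have "(\<lambda>z. z ^ j * cnj z ^ k * (of_real (h z) * u z)) =
        (\<lambda>z. \<alpha> * (z ^ Suc j * cnj z ^ k * u z) + cnj \<alpha> * (z ^ j * cnj z ^ Suc k * u z))"
      by (auto simp: fun_eq_iff algebra_simps)
    then show ?case
      using add[OF scale[OF linear(2)[of "Suc j" k], of \<alpha>] scale[OF linear(2)[of j "Suc k"], of "cnj \<alpha>"]]
      by (simp only:)
  next
    case (const c)
    have "(\<lambda>z. z ^ j * cnj z ^ k * (of_real c * u z)) = (\<lambda>z. of_real c * (z ^ j * cnj z ^ k * u z))"
      by (auto simp: mult_ac)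
    then show ?case using scale[OF const(1)] by simp
  next
    case (add p q)
    have "(\<lambda>z. z ^ j * cnj z ^ k * (of_real (p z + q z) * u z)) =
      (\<lambda>z. z ^ j * cnj z ^ k * (of_real (p z) * u z) + z ^ j * cnj z ^ k * (of_real (q z) * u z))"
      by (auto simp: algebra_simps)
    then show ?case
      using assms(2)[OF add.IH(1)[OF add.prems] add.IH(2)[OF add.prems]] by simp
  next
    case (mult p q)
    have "(\<lambda>z. z ^ j * cnj z ^ k * (of_real (p z * q z) * u z)) =
      (\<lambda>z. z ^ j * cnj z ^ k * (of_real (p z) * (of_real (q z) * u z)))"
      by (auto simp: mult_ac)
    then show ?case
      using mult.IH(1)[OF mult.IH(2)[OF mult.prems]] by simp
  qed
  have cont: "P (\<lambda>z. of_real (f z))" if f: "continuous_on (sphere 0 1) f" for f :: "complex \<Rightarrow> real"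
  proof -
    have "\<exists>p. real_polynomial_function p \<and> (\<forall>z\<in>sphere 0 1. \<bar>f z - p z\<bar> < 1 / Suc n)" for n
      by (rule Stone_Weierstrass_real_polynomial_function[OF compact_sphere f, of "1 / Suc n"]) auto
    then obtain p where p: "\<And>n. real_polynomial_function (p n)"
      "\<And>n z. z \<in> sphere 0 1 \<Longrightarrow> \<bar>f z - p n z\<bar> < 1 / Suc n"
      by metis
    have "compact (f ` sphere 0 1)"
      using f by (intro compact_continuous_image) auto
    then obtain C where C: "\<And>z. z \<in> sphere 0 1 \<Longrightarrow> \<bar>f z\<bar> \<le> C"
      by (metis bounded_iff compact_imp_bounded imageI real_norm_def)
    show ?thesis
    proof (rule lim[of "\<lambda>n z. of_real (p n z)" "C + 1"])
      show "P (\<lambda>z. of_real (p n z))" for n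
        using poly[OF p(1), of "\<lambda>_. 1" 0 0] monom by simp
      show "norm (of_real (p n z) :: complex) \<le> C + 1" if "z \<in> sphere 0 1" for n z
      proof -
        have "1 / real (Suc n) \<le> 1" by simp
        then have "\<bar>p n z\<bar> \<le> C + 1" using C[OF that] p(2)[OF that, of n] by linarith
        then show ?thesis by simp
      qed
      show "(\<lambda>n. of_real (p n z) :: complex) \<longlonglongrightarrow> of_real (f z)" if "z \<in> sphere 0 1" for z
      proof -
        have "(\<lambda>n. p n z - f z) \<longlonglongrightarrow> 0"
          by (rule Lim_null_comparison[OF _ LIMSEQ_Suc[OF lim_1_over_n]])
            (use p(2)[OF that] in \<open>auto intro!: always_eventually less_imp_le simp: abs_minus_commute\<close>)
        then show ?thesis by (simp add: Lim_null[symmetric] tendsto_of_real)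
      qed
    qed
  qed
  have closed: "P (indicator C)" if C: "closed C" for C
  proof (cases "C = {}")
    case True
    then show ?thesis using empty by simp
  next
    case False
    \<comment> \<open>These powers equal 1 on \<open>C\<close> and tend to 0 off it. The empty set
      is treated apart since \<open>infdist\<close> to it is 0.\<close>
    let ?u = "\<lambda>n z. of_real ((1 / (1 + infdist z C)) ^ n) :: complex"
    show ?thesis
    proof (rule lim[of ?u 1])
      show "P (?u n)" for n
        by (rule cont)
          (auto intro!: continuous_intros simp: add_nonneg_eq_0_iff infdist_nonneg)
      show "norm (?u n z) \<le> 1" for n z
      proof -
        have "0 \<le> 1 / (1 + infdist z C)" "1 / (1 + infdist z C) \<le> 1"
          using infdist_nonneg[of z C] by (auto simp: divide_le_eq)
        then have "\<bar>(1 / (1 + infdist z C)) ^ n\<bar> \<le> 1"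
          by (simp only: abs_of_nonneg zero_le_power power_le_one)
        then show ?thesis by (simp only: norm_of_real)
      qed
      show "(\<lambda>n. ?u n z) \<longlonglongrightarrow> indicator C z" for z
      proof (cases "z \<in> C")
        case False
        then have "infdist z C > 0"
          using in_closed_iff_infdist_zero[OF C \<open>C \<noteq> {}\<close>] infdist_nonneg[of z C] by force
        then have "(\<lambda>n. (1 / (1 + infdist z C)) ^ n) \<longlonglongrightarrow> 0"
          by (intro LIMSEQ_realpow_zero) auto
        from tendsto_of_real[OF this, where 'a = complex] show ?thesis using False by simp
      qed simp
    qed
  qed
  have "A \<in> sigma_sets UNIV (Collect closed)"
    using A unfolding borel_eq_closed by simp
  then show ?thesis
  proof (induction rule: sigma_sets_induct_disjoint[rotated 2, consumes 1, case_names basic empty compl union])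
    case (compl S)
    have "(indicator (UNIV - S) :: complex \<Rightarrow> complex) = (\<lambda>z. 1 + (- 1) * indicator S z)"
      by (auto simp: fun_eq_iff indicator_def)
    then show ?case using add[OF one scale[where c = "- 1", OF compl(2)]] by (simp only:)
  next
    case (union S)
    have fin: "P (\<lambda>z. \<Sum>i<n. indicator (S i) z)" for n
      by (induction n) (simp_all add: zero add union)
    have eq: "(\<Sum>i<n. indicator (S i) z :: complex) = indicator (\<Union>i<n. S i) z" for n z
      using union(1) by (subst indicator_UN_disjoint) (auto intro: disjoint_family_on_mono)
    show ?case
    proof (rule lim[where B = 1, OF fin])
      show "norm (\<Sum>i<n. indicator (S i) z :: complex) \<le> 1" for n z
        unfolding eq by (simp add: indicator_def)
      show "(\<lambda>n. \<Sum>i<n. indicator (S i) z :: complex) \<longlonglongrightarrow> indicator (\<Union> (range S)) z" for z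
        unfolding eq by (rule LIMSEQ_indicator_UN)
    qed
  qed (use closed empty zero in \<open>auto simp: Int_stable_def\<close>)
qed

text \<open>The boundary map and the identity have the same mixed moments, by
  \<open>integral_boundary_power\<close> and \<open>integral_circle_power\<close>; these moments
  determine the image measure on Borel sets.\<close>

lemma boundary_map_measure_preserving:
  assumes f: "inner_function f" "f 0 = 0"
  shows "measure_preserving_map circle_measure (boundary_map f)"
proof -
  define T where "T = boundary_map f"
  have T: "norm (T z) = 1" "T \<in> borel_measurable circle_measure" for z
    using borel_measurable_boundary_map[OF f(1)] by (auto simp: T_def)
  have T_meas: "T \<in> circle_measure \<rightarrow>\<^sub>M circle_borel"
    by (subst measurable_cong_sets[OF refl sets_circle_borel])
      (rule measurable_restrict_space2, use T in auto)
  have id_meas: "(\<lambda>z. z) \<in> circle_measure \<rightarrow>\<^sub>M circle_borel"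
    unfolding circle_measure_eq by (intro measurable_completion) simp
  \<comment> \<open>Borel measurability and boundedness are part of the class, so that sums are
    integrable and limits can be taken under both integrals.\<close>
  define P where "P u \<longleftrightarrow> u \<in> borel_measurable circle_borel \<and> (\<exists>B. \<forall>z\<in>sphere 0 1. norm (u z) \<le> B) \<and>
     (\<integral>z. u (T z) \<partial>circle_measure) = (\<integral>z. u z \<partial>circle_measure)" for u :: "complex \<Rightarrow> complex"
  have int: "integrable circle_measure (\<lambda>z. u (T z))" "integrable circle_measure u" if u: "P u" for u
  proof -
    obtain B where B: "\<And>z. z \<in> sphere 0 1 \<Longrightarrow> norm (u z) \<le> B" and meas: "u \<in> borel_measurable circle_borel"
      using u unfolding P_def by metis
    show "integrable circle_measure (\<lambda>z. u (T z))"
      by (rule integrable_circle_bounded[OF measurable_compose[OF T_meas meas], of B]) (simp add: B T)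
    show "integrable circle_measure u"
      by (rule integrable_circle_bounded[OF measurable_compose[OF id_meas meas], of B]) (simp add: B)
  qed
  have P_ind: "P (indicator A)" if "A \<in> sets borel" for A
  proof (rule circle_class_indicator[OF _ _ _ _ that])
    show "P (\<lambda>z. z ^ j * cnj z ^ k)" for j k
    proof -
      have "norm (z ^ j * cnj z ^ k) \<le> 1" if "z \<in> sphere 0 1" for z
        using that by (simp add: norm_mult norm_power)
      then show ?thesis
        unfolding P_def T_def integral_boundary_power[OF f] integral_circle_power
        by (intro conjI exI[of _ 1] borel_measurable_circle_borelI continuous_intros) auto
    qed
    show "P (\<lambda>z. u z + v z)" if uv: "P u" "P v" for u v
    proof -
      obtain B C where "\<And>z. z \<in> sphere 0 1 \<Longrightarrow> norm (u z) \<le> B" "\<And>z. z \<in> sphere 0 1 \<Longrightarrow> norm (v z) \<le> C"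
        using uv unfolding P_def by metis
      then have "\<forall>z\<in>sphere 0 1. norm (u z + v z) \<le> B + C"
        by (meson add_mono norm_triangle_le)
      then show ?thesis
        using uv int[OF uv(1)] int[OF uv(2)] unfolding P_def by auto
    qed
    show "P (\<lambda>z. c * u z)" if u: "P u" for u c
    proof -
      obtain B where "\<And>z. z \<in> sphere 0 1 \<Longrightarrow> norm (u z) \<le> B"
        using u unfolding P_def by metis
      then have "\<forall>z\<in>sphere 0 1. norm (c * u z) \<le> norm c * B"
        by (simp add: norm_mult mult_left_mono)
      then show ?thesis
        using u unfolding P_def by auto
    qed
    show "P v" if u: "\<And>n::nat. P (u n)" and B: "\<And>n z. z \<in> sphere 0 1 \<Longrightarrow> norm (u n z) \<le> B"
      and lim: "\<And>z. z \<in> sphere 0 1 \<Longrightarrow> (\<lambda>n. u n z) \<longlonglongrightarrow> v z" for u v B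
    proof -
      have v_le: "norm (v z) \<le> B" if "z \<in> sphere 0 1" for z
        by (rule Lim_bounded[OF tendsto_norm[OF lim[OF that]], of 0]) (use B that in auto)
      have v_meas: "v \<in> borel_measurable circle_borel"
        by (rule borel_measurable_LIMSEQ_metric[of u]) (use u lim in \<open>auto simp: P_def\<close>)
      have u_meas: "u n \<in> borel_measurable circle_borel" for n using u by (simp add: P_def)
      have "(\<lambda>n. \<integral>z. u n (T z) \<partial>circle_measure) \<longlonglongrightarrow> (\<integral>z. v (T z) \<partial>circle_measure)"
        by (rule circle_bounded_convergence[where B = B])
          (use B lim T in \<open>auto intro: measurable_compose[OF T_meas] u_meas v_meas\<close>)
      moreover have "(\<lambda>n. \<integral>z. u n z \<partial>circle_measure) \<longlonglongrightarrow> (\<integral>z. v z \<partial>circle_measure)"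
        by (rule circle_bounded_convergence[where B = B])
          (use B lim in \<open>auto intro: measurable_compose[OF id_meas] u_meas v_meas\<close>)
      ultimately have "(\<integral>z. v (T z) \<partial>circle_measure) = (\<integral>z. v z \<partial>circle_measure)"
        using u unfolding P_def by (auto intro: LIMSEQ_unique)
      moreover have "\<exists>B. \<forall>z\<in>sphere 0 1. norm (v z) \<le> B"
        using v_le by blast
      ultimately show ?thesis
        using v_meas unfolding P_def by blast
    qed
  qed
  have integral_indicator_complex: "(\<integral>z. indicator X z \<partial>circle_measure) = complex_of_real (measure circle_measure X)"
    if X: "X \<in> sets circle_measure" for X
  proof -
    have "(\<integral>z. indicator X z \<partial>circle_measure) = (\<integral>z. complex_of_real (indicator X z) \<partial>circle_measure)"
      by (intro Bochner_Integration.integral_cong) (auto simp: indicator_def)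
    also have "\<dots> = of_real (measure circle_measure (X \<inter> space circle_measure))"
      by (subst integral_complex_of_real) simp
    finally show ?thesis
      using sets.sets_into_space[OF X] by (simp add: Int_absorb2)
  qed
  have distr: "distr circle_measure circle_borel T = circle_borel"
  proof (rule measure_eqI)
    fix A assume "A \<in> sets (distr circle_measure circle_borel T)"
    then have A: "A \<in> sets circle_borel" by simp
    then have A_borel: "A \<in> sets borel"
      by (auto simp: sets_circle_borel sets_restrict_space)
    have A_circle: "A \<in> sets circle_measure" "A \<subseteq> sphere 0 1"
      using A sets.sets_into_space[OF A] by (auto simp: circle_measure_eq)
    have TA: "T -` A \<inter> space circle_measure \<in> sets circle_measure"
      by (rule measurable_sets[OF T_meas A])
    have "(\<integral>z. indicator A (T z) \<partial>circle_measure) = (\<integral>z. indicator A z \<partial>circle_measure :: complex)"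
      using P_ind[OF A_borel] by (simp add: P_def)
    also have "(\<integral>z. indicator A (T z) \<partial>circle_measure :: complex) =
        (\<integral>z. indicator (T -` A \<inter> space circle_measure) z \<partial>circle_measure)"
      by (intro Bochner_Integration.integral_cong) (auto simp: indicator_def)
    finally have "measure circle_measure (T -` A \<inter> space circle_measure) = measure circle_measure A"
      unfolding integral_indicator_complex[OF TA] integral_indicator_complex[OF A_circle(1)] by simp
    then have "emeasure circle_measure (T -` A \<inter> space circle_measure) = emeasure circle_measure A"
      by (simp add: circle.emeasure_eq_measure)
    also have "emeasure circle_measure A = emeasure circle_borel A"
      using A by (simp add: circle_measure_eq)
    finally show "emeasure (distr circle_measure circle_borel T) A = emeasure circle_borel A"
      by (simp add: emeasure_distr[OF T_meas A])
  qed simp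
  \<comment> \<open>Since \<open>T\<close> preserves the Borel measure, preimages of null sets are
    null; completeness of the source then extends measurability and invariance to all completed
    sets.\<close>
  interpret complete: complete_measure circle_measure
    unfolding circle_measure_eq by (rule completion.complete_measure_axioms)
  have "T \<in> circle_measure \<rightarrow>\<^sub>M completion circle_borel"
    by (rule complete.measurable_completion2[OF T_meas]) (simp add: distr)
  moreover have "distr circle_measure (completion circle_borel) T = completion circle_borel"
    using complete.completion_distr_eq[OF T_meas] by (simp add: distr)
  ultimately show ?thesis
    unfolding measure_preserving_map_def T_def[symmetric] by (simp only: circle_measure_eq[symmetric])
qed

section \<open>Ergodic averages\<close>

text \<open>The square of the L2 distance between the average and the mean, which spares square
  roots in the estimates.\<close>

definition ergodic_error :: "'a measure \<Rightarrow> (nat \<Rightarrow> 'a \<Rightarrow> 'a) \<Rightarrow> ('a \<Rightarrow> complex) \<Rightarrow> nat \<Rightarrow> real" where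
  "ergodic_error M T \<phi> N =
     (\<integral>x. (norm (1 / of_nat N * (\<Sum>n=1..N. \<phi> (T n x)) - (\<integral>y. \<phi> y \<partial>M)))\<^sup>2 \<partial>M)"

definition ergodic_for :: "'a measure \<Rightarrow> (nat \<Rightarrow> 'a \<Rightarrow> 'a) \<Rightarrow> ('a \<Rightarrow> complex) \<Rightarrow> bool" where
  "ergodic_for M T \<phi> \<longleftrightarrow> square_integrable M \<phi> \<and> ergodic_error M T \<phi> \<longlonglongrightarrow> 0"

lemma measure_preserving_integral:
  fixes f :: "'a \<Rightarrow> 'b::{banach, second_countable_topology}"
  assumes "measure_preserving_map M T" "f \<in> borel_measurable M"
  shows "(\<integral>x. f (T x) \<partial>M) = (\<integral>x. f x \<partial>M)"
  using assms integral_distr[of T M M f] by (simp add: measure_preserving_map_def)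

lemma measure_preserving_integrable:
  fixes f :: "'a \<Rightarrow> 'b::{banach, second_countable_topology}"
  assumes "measure_preserving_map M T" "integrable M f"
  shows "integrable M (\<lambda>x. f (T x))"
  using assms integrable_distr[of T M M f] by (simp add: measure_preserving_map_def)

text \<open>Stands in for the triangle inequality in L2, at the price of a factor 2.\<close>

lemma power2_norm_add_le: "(norm (a + b))\<^sup>2 \<le> 2 * (norm a)\<^sup>2 + 2 * (norm b)\<^sup>2"
proof -
  have "(norm (a + b))\<^sup>2 \<le> (norm a + norm b)\<^sup>2"
    by (intro power_mono norm_triangle_ineq) auto
  also have "\<dots> \<le> 2 * (norm a)\<^sup>2 + 2 * (norm b)\<^sup>2"
    using sum_squares_bound[of "norm a" "norm b"] by (simp add: power2_sum)
  finally show ?thesis .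
qed

lemma power2_norm_diff_le: "(norm (a - b))\<^sup>2 \<le> 2 * (norm a)\<^sup>2 + 2 * (norm b)\<^sup>2"
  using power2_norm_add_le[of a "- b"] by simp

context prob_space
begin

lemma integrable_of_square_integrable:
  assumes "square_integrable M f"
  shows "integrable M f"
proof (rule Bochner_Integration.integrable_bound)
  show "integrable M (\<lambda>x. 1 + (norm (f x))\<^sup>2)"
    using assms by (auto simp: square_integrable_def)
  have "t \<le> 1 + t\<^sup>2" for t :: real
  proof -
    have "2 * t \<le> t\<^sup>2 + 1" using sum_squares_bound[of t 1] by simp
    then show ?thesis using zero_le_power2[of t] by linarith
  qed
  then show "AE x in M. norm (f x) \<le> norm (1 + (norm (f x))\<^sup>2)"
    by (intro AE_I2) (simp add: abs_of_nonneg)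
qed (use assms in \<open>auto simp: square_integrable_def\<close>)

lemma square_integrable_add:
  assumes "square_integrable M f" "square_integrable M g"
  shows "square_integrable M (\<lambda>x. f x + g x)"
  unfolding square_integrable_def
proof
  show meas: "(\<lambda>x. f x + g x) \<in> borel_measurable M"
    using assms by (auto simp: square_integrable_def)
  show "integrable M (\<lambda>x. (norm (f x + g x))\<^sup>2)"
  proof (rule Bochner_Integration.integrable_bound)
    show "integrable M (\<lambda>x. 2 * (norm (f x))\<^sup>2 + 2 * (norm (g x))\<^sup>2)"
      using assms by (auto simp: square_integrable_def)
    show "(\<lambda>x. (norm (f x + g x))\<^sup>2) \<in> borel_measurable M" using meas by measurable
  qed (intro AE_I2, simp add: power2_norm_add_le)
qed

lemma square_integrable_mult:
  assumes "square_integrable M f"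
  shows "square_integrable M (\<lambda>x. c * f x)"
  using assms by (auto simp: square_integrable_def norm_mult power_mult_distrib)

lemma square_integrable_diff:
  assumes "square_integrable M f" "square_integrable M g"
  shows "square_integrable M (\<lambda>x. f x - g x)"
  using square_integrable_add[OF assms(1) square_integrable_mult[OF assms(2), of "- 1"]] by simp

lemma square_integrable_bounded:
  assumes "f \<in> borel_measurable M" "\<And>x. x \<in> space M \<Longrightarrow> norm (f x) \<le> B"
  shows "square_integrable M f"
  unfolding square_integrable_def
proof
  show "integrable M (\<lambda>x. (norm (f x))\<^sup>2)"
    by (rule integrable_const_bound[of _ "B\<^sup>2"]) (use assms in \<open>auto intro!: AE_I2 power_mono\<close>)
qed fact

context
  fixes T :: "nat \<Rightarrow> 'a \<Rightarrow> 'a"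
  assumes T: "\<And>n. n \<ge> 1 \<Longrightarrow> measure_preserving_map M (T n)"
begin

lemma square_integrable_ergodic_error:
  assumes \<phi>: "square_integrable M \<phi>"
  shows "square_integrable M (\<lambda>x. 1 / of_nat N * (\<Sum>n=1..N. \<phi> (T n x)) - (\<integral>y. \<phi> y \<partial>M))"
proof -
  have comp: "square_integrable M (\<lambda>x. \<phi> (T n x))" if "n \<ge> 1" for n
    using \<phi> T[OF that] measure_preserving_integrable[OF T[OF that], of "\<lambda>x. (norm (\<phi> x))\<^sup>2"]
    by (auto simp: square_integrable_def measure_preserving_map_def)
  have "square_integrable M (\<lambda>x. \<Sum>n=1..K. \<phi> (T n x))" for K
    by (induction K) (auto intro!: square_integrable_add comp simp: square_integrable_def[of _ "\<lambda>_. 0"])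
  then show ?thesis
    by (intro square_integrable_diff square_integrable_mult square_integrable_bounded[of "\<lambda>_. _"]) auto
qed

text \<open>The bound is uniform in \<open>N\<close>: Cauchy-Schwarz and invariance bound the mean
  square of the average by \<open>I\<close>, which also bounds the squared mean. Separating the two
  doubles each, whence the 4.\<close>

lemma ergodic_error_le:
  assumes \<phi>: "square_integrable M \<phi>"
  shows "ergodic_error M T \<phi> N \<le> 4 * (\<integral>x. (norm (\<phi> x))\<^sup>2 \<partial>M)"
proof -
  define I where "I = (\<integral>x. (norm (\<phi> x))\<^sup>2 \<partial>M)"
  have int: "integrable M (\<lambda>x. (norm (\<phi> x))\<^sup>2)" "integrable M \<phi>"
    using \<phi> integrable_of_square_integrable[OF \<phi>] by (simp_all add: square_integrable_def)
  have int_T: "integrable M (\<lambda>x. (norm (\<phi> (T n x)))\<^sup>2)" "(\<integral>x. (norm (\<phi> (T n x)))\<^sup>2 \<partial>M) = I" if "n \<ge> 1" for n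
    using measure_preserving_integrable[OF T[OF that] int(1)] measure_preserving_integral[OF T[OF that], of "\<lambda>x. (norm (\<phi> x))\<^sup>2"]
      borel_measurable_integrable[OF int(1)]
    by (simp_all add: I_def)
  have mean: "(norm (\<integral>y. \<phi> y \<partial>M))\<^sup>2 \<le> I"
  proof -
    have "(norm (\<integral>y. \<phi> y \<partial>M))\<^sup>2 \<le> (\<integral>y. norm (\<phi> y) \<partial>M)\<^sup>2"
      by (intro power_mono integral_norm_bound) auto
    also have "\<dots> \<le> I"
      unfolding I_def by (rule expectation_power2_le) (use int in auto)
    finally show ?thesis .
  qed
  have pointwise: "(norm (1 / of_nat N * (\<Sum>n=1..N. \<phi> (T n x))))\<^sup>2 \<le> (\<Sum>n=1..N. (norm (\<phi> (T n x)))\<^sup>2) / N" for x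
  proof (cases "N = 0")
    case False
    have "(norm (\<Sum>n=1..N. \<phi> (T n x)))\<^sup>2 \<le> (\<Sum>n=1..N. norm (\<phi> (T n x)))\<^sup>2"
      by (intro power_mono norm_sum) auto
    also have "\<dots> \<le> (\<Sum>n=1..N. (norm (\<phi> (T n x)))\<^sup>2) * N"
      using sum_squared_le_sum_of_squares[of "\<lambda>n. norm (\<phi> (T n x))" "{1..N}"] by simp
    finally show ?thesis
      using False by (simp add: norm_mult norm_divide power_divide power2_eq_square field_simps)
  qed simp
  have int_sum: "integrable M (\<lambda>x. \<Sum>n=1..N. (norm (\<phi> (T n x)))\<^sup>2)"
    by (intro Bochner_Integration.integrable_sum int_T(1)) auto
  have integral_sum: "(\<integral>x. (\<Sum>n=1..N. (norm (\<phi> (T n x)))\<^sup>2) \<partial>M) = (\<Sum>n=1..N. I)"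
    by (subst Bochner_Integration.integral_sum) (auto simp: int_T)
  have "ergodic_error M T \<phi> N \<le> (\<integral>x. 2 * ((\<Sum>n=1..N. (norm (\<phi> (T n x)))\<^sup>2) / N) + 2 * I \<partial>M)"
    unfolding ergodic_error_def
  proof (rule integral_mono)
    show "integrable M (\<lambda>x. 2 * ((\<Sum>n=1..N. (norm (\<phi> (T n x)))\<^sup>2) / N) + 2 * I)"
      using int_sum by (intro Bochner_Integration.integrable_add integrable_mult_right integrable_divide) auto
    show "(norm (1 / of_nat N * (\<Sum>n=1..N. \<phi> (T n x)) - (\<integral>y. \<phi> y \<partial>M)))\<^sup>2
       \<le> 2 * ((\<Sum>n=1..N. (norm (\<phi> (T n x)))\<^sup>2) / N) + 2 * I" for x
      using power2_norm_diff_le[of "1 / of_nat N * (\<Sum>n=1..N. \<phi> (T n x))" "\<integral>y. \<phi> y \<partial>M"] pointwise[of x] mean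
      by linarith
  qed (use square_integrable_ergodic_error[OF \<phi>] in \<open>auto simp: square_integrable_def\<close>)
  also have "\<dots> = 2 * ((\<Sum>n=1..N. I) / N) + 2 * I"
    using int_sum by (subst integral_sum[symmetric]) (simp add: prob_space)
  \<comment> \<open>For \<open>N = 0\<close> division by 0 makes the first term 0, and
    \<open>0 \<le> I\<close> is what remains to be used.\<close>
  also have "\<dots> \<le> 4 * I"
    using order_trans[OF zero_le_power2 mean] by (cases "N = 0") auto
  finally show ?thesis by (simp add: I_def)
qed

lemma ergodic_error_add_le:
  assumes u: "square_integrable M u" and v: "square_integrable M v"
  shows "ergodic_error M T (\<lambda>x. u x + v x) N \<le> 2 * ergodic_error M T u N + 2 * ergodic_error M T v N"
proof -
  define e where "e \<phi> x = 1 / of_nat N * (\<Sum>n=1..N. \<phi> (T n x)) - (\<integral>y. \<phi> y \<partial>M)"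
    for \<phi> :: "'a \<Rightarrow> complex" and x
  have err: "ergodic_error M T \<phi> N = (\<integral>x. (norm (e \<phi> x))\<^sup>2 \<partial>M)" for \<phi>
    by (simp add: ergodic_error_def e_def)
  have int: "integrable M (\<lambda>x. (norm (e \<phi> x))\<^sup>2)" if "square_integrable M \<phi>" for \<phi>
    using square_integrable_ergodic_error[OF that] by (simp add: square_integrable_def e_def)
  have e: "e (\<lambda>x. u x + v x) x = e u x + e v x" for x
    using integrable_of_square_integrable[OF u] integrable_of_square_integrable[OF v]
    by (simp add: e_def sum.distrib algebra_simps add_divide_distrib)
  have "ergodic_error M T (\<lambda>x. u x + v x) N \<le> (\<integral>x. 2 * (norm (e u x))\<^sup>2 + 2 * (norm (e v x))\<^sup>2 \<partial>M)"
    unfolding err using int[OF square_integrable_add[OF u v]] int[OF u] int[OF v]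
    by (intro integral_mono) (auto simp: e power2_norm_add_le)
  also have "\<dots> = 2 * ergodic_error M T u N + 2 * ergodic_error M T v N"
    unfolding err using int[OF u] int[OF v] by simp
  finally show ?thesis .
qed

lemma ergodic_error_mult:
  "ergodic_error M T (\<lambda>x. c * u x) N = (norm c)\<^sup>2 * ergodic_error M T u N"
proof -
  have "1 / of_nat N * (\<Sum>n=1..N. c * u (T n x)) - (\<integral>y. c * u y \<partial>M) =
      c * (1 / of_nat N * (\<Sum>n=1..N. u (T n x)) - (\<integral>y. u y \<partial>M))" for x
    by (simp add: algebra_simps sum_distrib_left)
  then show ?thesis
    by (simp add: ergodic_error_def norm_mult power_mult_distrib)
qed

lemma ergodic_error_nonneg: "0 \<le> ergodic_error M T u N"
  by (simp add: ergodic_error_def)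

lemma ergodic_for_add:
  assumes "ergodic_for M T u" "ergodic_for M T v"
  shows "ergodic_for M T (\<lambda>x. u x + v x)"
proof -
  have "(\<lambda>N. 2 * ergodic_error M T u N + 2 * ergodic_error M T v N) \<longlonglongrightarrow> 2 * 0 + 2 * 0"
    using assms by (intro tendsto_intros) (auto simp: ergodic_for_def)
  then have lim: "(\<lambda>N. 2 * ergodic_error M T u N + 2 * ergodic_error M T v N) \<longlonglongrightarrow> 0" by simp
  have uv: "square_integrable M u" "square_integrable M v"
    using assms by (simp_all add: ergodic_for_def)
  have "ergodic_error M T (\<lambda>x. u x + v x) \<longlonglongrightarrow> 0"
  proof (rule tendsto_sandwich[OF _ _ tendsto_const lim])
    show "\<forall>\<^sub>F N in sequentially. 0 \<le> ergodic_error M T (\<lambda>x. u x + v x) N"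
      by (simp add: ergodic_error_nonneg)
    show "\<forall>\<^sub>F N in sequentially. ergodic_error M T (\<lambda>x. u x + v x) N
        \<le> 2 * ergodic_error M T u N + 2 * ergodic_error M T v N"
      using ergodic_error_add_le[OF uv] by simp
  qed
  then show ?thesis
    using square_integrable_add[OF uv] by (simp add: ergodic_for_def)
qed

lemma ergodic_for_mult:
  assumes "ergodic_for M T u"
  shows "ergodic_for M T (\<lambda>x. c * u x)"
proof -
  have "ergodic_error M T (\<lambda>x. c * u x) = (\<lambda>N. (norm c)\<^sup>2 * ergodic_error M T u N)"
    by (simp add: fun_eq_iff ergodic_error_mult)
  then show ?thesis
    using assms tendsto_mult_right_zero[of "ergodic_error M T u" sequentially "(norm c)\<^sup>2"]
    by (simp add: ergodic_for_def square_integrable_mult)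
qed

lemma ergodic_for_sum:
  assumes "finite A" "\<And>i. i \<in> A \<Longrightarrow> ergodic_for M T (u i)"
  shows "ergodic_for M T (\<lambda>x. \<Sum>i\<in>A. u i x)"
  using assms
proof (induction A rule: finite_induct)
  case empty
  have "ergodic_error M T (\<lambda>x. 0) = (\<lambda>N. 0)"
    by (simp add: fun_eq_iff ergodic_error_def)
  then show ?case
    by (simp add: ergodic_for_def square_integrable_def)
qed (simp add: ergodic_for_add)

text \<open>The errors are bounded by the L2 norm uniformly in \<open>N\<close>, so the functions
  with vanishing error are closed in L2.\<close>

lemma ergodic_for_limit:
  assumes \<phi>: "square_integrable M \<phi>"
    and u: "\<And>k::nat. ergodic_for M T (u k)" and lim: "(\<lambda>k. \<integral>x. (norm (\<phi> x - u k x))\<^sup>2 \<partial>M) \<longlonglongrightarrow> 0"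
  shows "ergodic_for M T \<phi>"
  unfolding ergodic_for_def
proof
  show "ergodic_error M T \<phi> \<longlonglongrightarrow> 0"
  proof (rule LIMSEQ_I)
    fix e :: real assume e: "e > 0"
    \<comment> \<open>The remainder is multiplied by 4 and then by 2, so \<open>e / 16\<close>
      leaves half of \<open>e\<close>; the \<open>e / 4\<close> below is doubled and uses the other
      half.\<close>
    obtain k where k: "(\<integral>x. (norm (\<phi> x - u k x))\<^sup>2 \<partial>M) < e / 16"
      using order_tendstoD(2)[OF lim, of "e / 16"] e by (auto simp: eventually_sequentially)
    have uk: "square_integrable M (u k)" "ergodic_error M T (u k) \<longlonglongrightarrow> 0"
      using u[of k] by (auto simp: ergodic_for_def)
    then obtain N0 where N0: "\<And>N. N \<ge> N0 \<Longrightarrow> ergodic_error M T (u k) N < e / 4"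
      using order_tendstoD(2)[OF uk(2), of "e / 4"] e by (auto simp: eventually_sequentially)
    have "norm (ergodic_error M T \<phi> N - 0) < e" if "N \<ge> N0" for N
    proof -
      have "ergodic_error M T (\<lambda>x. u k x + (\<phi> x - u k x)) N \<le>
          2 * ergodic_error M T (u k) N + 2 * ergodic_error M T (\<lambda>x. \<phi> x - u k x) N"
        by (intro ergodic_error_add_le uk square_integrable_diff \<phi>)
      moreover have "ergodic_error M T (\<lambda>x. \<phi> x - u k x) N \<le> 4 * (\<integral>x. (norm (\<phi> x - u k x))\<^sup>2 \<partial>M)"
        by (intro ergodic_error_le uk square_integrable_diff \<phi>)
      ultimately have "ergodic_error M T \<phi> N < e"
        using k N0[OF that] by simp
      then show ?thesis by (simp add: ergodic_error_nonneg)
    qed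
    then show "\<exists>N0. \<forall>N\<ge>N0. norm (ergodic_error M T \<phi> N - 0) < e" by blast
  qed
qed fact

text \<open>A function equal to \<open>u\<close> almost everywhere is the L2 limit of the constant
  sequence \<open>u\<close>.\<close>

lemma ergodic_for_AE_cong:
  assumes "ergodic_for M T u" "\<phi> \<in> borel_measurable M" "AE x in M. \<phi> x = u x"
  shows "ergodic_for M T \<phi>"
proof (rule ergodic_for_limit[where u = "\<lambda>_. u"])
  have [measurable]: "u \<in> borel_measurable M"
    using assms(1) by (auto simp: ergodic_for_def square_integrable_def)
  note [measurable] = assms(2)
  have "integrable M (\<lambda>x. (norm (\<phi> x))\<^sup>2) \<longleftrightarrow> integrable M (\<lambda>x. (norm (u x))\<^sup>2)"
    by (intro integrable_cong_AE) (use assms(3) in auto)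
  then show "square_integrable M \<phi>"
    using assms by (auto simp: ergodic_for_def square_integrable_def)
  have "(\<integral>x. (norm (\<phi> x - u x))\<^sup>2 \<partial>M) = (\<integral>x. 0 \<partial>M)"
    by (intro integral_cong_AE) (use assms(3) in auto)
  then show "(\<lambda>k::nat. \<integral>x. (norm (\<phi> x - u x))\<^sup>2 \<partial>M) \<longlonglongrightarrow> 0"
    by simp
qed (rule assms(1))

text \<open>The simple functions can be taken with \<open>norm (s i x)\<close> at most twice
  \<open>norm (\<phi> x)\<close>; the squared differences are then dominated with the factor (1 +
  2)^2 = 9, and \<open>s i\<close> tends to \<open>\<phi>\<close> in L2.\<close>

lemma ergodic_for_of_indicators:
  assumes ind: "\<And>A. A \<in> sets M \<Longrightarrow> ergodic_for M T (indicator A)" and \<phi>: "square_integrable M \<phi>"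
  shows "ergodic_for M T \<phi>"
proof -
  have [measurable]: "\<phi> \<in> borel_measurable M" using \<phi> by (simp add: square_integrable_def)
  obtain s where s: "\<And>i. simple_function M (s i)" "\<And>x. x \<in> space M \<Longrightarrow> (\<lambda>i. s i x) \<longlonglongrightarrow> \<phi> x"
    "\<And>i x. x \<in> space M \<Longrightarrow> dist (s i x) 0 \<le> 2 * dist (\<phi> x) 0"
    using borel_measurable_implies_sequence_metric[OF \<open>\<phi> \<in> borel_measurable M\<close>, of 0] by blast
  have [measurable]: "s i \<in> borel_measurable M" for i
    using s(1) by (rule borel_measurable_simple_function)
  have "ergodic_for M T (s i)" for i
  proof (rule ergodic_for_AE_cong)
    show "ergodic_for M T (\<lambda>x. \<Sum>y\<in>s i ` space M. y * indicator (s i -` {y} \<inter> space M) x)"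
      using s(1)[of i] by (intro ergodic_for_sum ergodic_for_mult ind) (auto simp: simple_function_def)
    show "AE x in M. s i x = (\<Sum>y\<in>s i ` space M. y * indicator (s i -` {y} \<inter> space M) x)"
    proof (rule AE_I2)
      fix x assume "x \<in> space M"
      then have "s i x = (\<Sum>y\<in>s i ` space M. indicator (s i -` {y} \<inter> space M) x *\<^sub>R y)"
        by (rule simple_function_indicator_representation_banach[OF s(1)])
      also have "\<dots> = (\<Sum>y\<in>s i ` space M. y * indicator (s i -` {y} \<inter> space M) x)"
        by (intro sum.cong refl) (simp add: indicator_def)
      finally show "s i x = (\<Sum>y\<in>s i ` space M. y * indicator (s i -` {y} \<inter> space M) x)" .
    qed
  qed simp
  moreover have "(\<lambda>i. \<integral>x. (norm (\<phi> x - s i x))\<^sup>2 \<partial>M) \<longlonglongrightarrow> (\<integral>x. 0 \<partial>M)"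
  proof (rule integral_dominated_convergence[where w = "\<lambda>x. 9 * (norm (\<phi> x))\<^sup>2"])
    show "AE x in M. (\<lambda>i. (norm (\<phi> x - s i x))\<^sup>2) \<longlonglongrightarrow> 0"
    proof (rule AE_I2)
      fix x assume "x \<in> space M"
      then have "(\<lambda>i. (norm (\<phi> x - s i x))\<^sup>2) \<longlonglongrightarrow> (norm (\<phi> x - \<phi> x))\<^sup>2"
        by (intro tendsto_intros s)
      then show "(\<lambda>i. (norm (\<phi> x - s i x))\<^sup>2) \<longlonglongrightarrow> 0" by simp
    qed
    show "AE x in M. norm ((norm (\<phi> x - s i x))\<^sup>2) \<le> 9 * (norm (\<phi> x))\<^sup>2" for i
    proof (rule AE_I2)
      fix x assume "x \<in> space M"
      then have "norm (\<phi> x - s i x) \<le> 3 * norm (\<phi> x)"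
        using s(3)[of x i] norm_triangle_ineq4[of "\<phi> x" "s i x"] by simp
      then have "(norm (\<phi> x - s i x))\<^sup>2 \<le> (3 * norm (\<phi> x))\<^sup>2"
        by (intro power_mono) auto
      then show "norm ((norm (\<phi> x - s i x))\<^sup>2) \<le> 9 * (norm (\<phi> x))\<^sup>2"
        by (simp add: power_mult_distrib)
    qed
  qed (use \<phi> in \<open>auto simp: square_integrable_def\<close>)
  ultimately show ?thesis
    by (intro ergodic_for_limit[OF \<phi>, of s]) auto
qed

end

end

section \<open>Ergodicity on the circle from decay of correlations\<close>

lemma ergodic_sequenceI:
  assumes "prob_space M" "\<And>n. n \<ge> 1 \<Longrightarrow> measure_preserving_map M (T n)"
    and "\<And>\<phi>. square_integrable M \<phi> \<Longrightarrow> ergodic_error M T \<phi> \<longlonglongrightarrow> 0"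
  shows "ergodic_sequence M T"
proof -
  have "(\<lambda>N. L2_norm M (\<lambda>x. (1 / of_nat N) * (\<Sum>n=1..N. \<phi> (T n x)) - (\<integral>y. \<phi> y \<partial>M))) \<longlonglongrightarrow> 0"
    if "square_integrable M \<phi>" for \<phi>
    using tendsto_real_sqrt[OF assms(3)[OF that]] unfolding L2_norm_def ergodic_error_def by simp
  then show ?thesis
    using assms(1,2) unfolding ergodic_sequence_def by blast
qed

text \<open>On the circle a mixed monomial is 1, a positive power or the conjugate of one. From
  monomials the class of good functions grows to Borel indicators, then to completed sets, then to
  all of L2.\<close>

lemma ergodic_sequence_circle_of_powers:
  assumes T: "\<And>n. n \<ge> 1 \<Longrightarrow> measure_preserving_map circle_measure (T n)"
    and pow: "\<And>k. k \<ge> 1 \<Longrightarrow>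
      (\<lambda>N. \<integral>z. (norm (1 / of_nat N * (\<Sum>n=1..N. T n z ^ k)))\<^sup>2 \<partial>circle_measure) \<longlonglongrightarrow> 0"
  shows "ergodic_sequence circle_measure T"
proof (rule ergodic_sequenceI[OF prob_space_circle_measure T])
  let ?P = "ergodic_for circle_measure T"
  have T_sphere: "T n z \<in> sphere 0 1" if "n \<ge> 1" "z \<in> sphere 0 1" for n z
    using T[OF that(1)] measurable_space[of "T n" circle_measure circle_measure z] that
    by (simp add: measure_preserving_map_def)
  have sqi: "square_integrable circle_measure u" if "continuous_on (sphere 0 1) u" for u
    using that by (auto simp: square_integrable_def intro!: borel_measurable_circleI integrable_circleI continuous_intros)
  have cnj_pow: "w ^ m * cnj w ^ m = 1" if "w \<in> sphere 0 1" for w :: complex and m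
    using that complex_norm_square[of w] by (simp flip: power_mult_distrib)
  have monom: "?P (\<lambda>z. z ^ j * cnj z ^ k)" for j k
  proof (cases j k rule: linorder_cases)
    case less
    have eq: "w ^ j * cnj w ^ k = cnj (w ^ (k - j))" if "w \<in> sphere 0 1" for w :: complex
      using less cnj_pow[OF that, of j] power_add[of "cnj w" j "k - j"] by (simp flip: mult.assoc)
    have "ergodic_error circle_measure T (\<lambda>z. z ^ j * cnj z ^ k) N =
        (\<integral>z. (norm (1 / of_nat N * (\<Sum>n=1..N. T n z ^ (k - j))))\<^sup>2 \<partial>circle_measure)" for N
      unfolding ergodic_error_def integral_circle_power
    proof (rule Bochner_Integration.integral_cong)
      fix z assume "z \<in> space circle_measure"
      then have "(\<Sum>n=1..N. T n z ^ j * cnj (T n z) ^ k) = cnj (\<Sum>n=1..N. T n z ^ (k - j))"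
        unfolding cnj_sum by (intro sum.cong eq T_sphere) auto
      then show "(norm (1 / of_nat N * (\<Sum>n=1..N. T n z ^ j * cnj (T n z) ^ k) - (if j = k then 1 else 0)))\<^sup>2 =
          (norm (1 / of_nat N * (\<Sum>n=1..N. T n z ^ (k - j))))\<^sup>2"
        using less by (simp add: norm_mult norm_divide del: cnj_sum)
    qed simp
    then have "ergodic_error circle_measure T (\<lambda>z. z ^ j * cnj z ^ k) =
        (\<lambda>N. \<integral>z. (norm (1 / of_nat N * (\<Sum>n=1..N. T n z ^ (k - j))))\<^sup>2 \<partial>circle_measure)"
      by (rule ext)
    moreover have "(\<lambda>N. \<integral>z. (norm (1 / of_nat N * (\<Sum>n=1..N. T n z ^ (k - j))))\<^sup>2 \<partial>circle_measure) \<longlonglongrightarrow> 0"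
      using less by (intro pow) simp
    moreover have "square_integrable circle_measure (\<lambda>z. z ^ j * cnj z ^ k)"
      by (intro sqi continuous_intros)
    ultimately show ?thesis
      by (simp only: ergodic_for_def)
  next
    case equal
    \<comment> \<open>\<open>N = 0\<close> is excluded: the empty average is 0 while the mean is
      1.\<close>
    have "ergodic_error circle_measure T (\<lambda>z. z ^ j * cnj z ^ k) N = 0" if "N \<ge> 1" for N
    proof -
      have "ergodic_error circle_measure T (\<lambda>z. z ^ j * cnj z ^ k) N = (\<integral>z. 0 \<partial>circle_measure)"
        unfolding ergodic_error_def integral_circle_power
      proof (rule Bochner_Integration.integral_cong)
        fix z assume "z \<in> space circle_measure"
        then have "(\<Sum>n=1..N. T n z ^ j * cnj (T n z) ^ k) = (\<Sum>n=1..N. 1)"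
          using equal by (intro sum.cong) (auto intro!: cnj_pow T_sphere)
        then show "(norm (1 / of_nat N * (\<Sum>n=1..N. T n z ^ j * cnj (T n z) ^ k) - (if j = k then 1 else 0)))\<^sup>2 = 0"
          using equal that by simp
      qed simp
      then show ?thesis by simp
    qed
    then have "\<forall>\<^sub>F N in sequentially. 0 = ergodic_error circle_measure T (\<lambda>z. z ^ j * cnj z ^ k) N"
      by (auto simp: eventually_sequentially intro!: exI[of _ 1])
    then have "ergodic_error circle_measure T (\<lambda>z. z ^ j * cnj z ^ k) \<longlonglongrightarrow> 0"
      by (rule Lim_transform_eventually[OF tendsto_const])
    then show ?thesis
      unfolding ergodic_for_def by (auto intro!: sqi continuous_intros)
  next
    case greater
    have eq: "w ^ j * cnj w ^ k = w ^ (j - k)" if "w \<in> sphere 0 1" for w :: complex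
      using greater cnj_pow[OF that, of k] power_add[of w "j - k" k] by (simp add: mult.assoc)
    have "ergodic_error circle_measure T (\<lambda>z. z ^ j * cnj z ^ k) N =
        (\<integral>z. (norm (1 / of_nat N * (\<Sum>n=1..N. T n z ^ (j - k))))\<^sup>2 \<partial>circle_measure)" for N
      unfolding ergodic_error_def integral_circle_power
    proof (rule Bochner_Integration.integral_cong)
      fix z assume "z \<in> space circle_measure"
      then have "(\<Sum>n=1..N. T n z ^ j * cnj (T n z) ^ k) = (\<Sum>n=1..N. T n z ^ (j - k))"
        by (intro sum.cong eq T_sphere) auto
      then show "(norm (1 / of_nat N * (\<Sum>n=1..N. T n z ^ j * cnj (T n z) ^ k) - (if j = k then 1 else 0)))\<^sup>2 =
          (norm (1 / of_nat N * (\<Sum>n=1..N. T n z ^ (j - k))))\<^sup>2"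
        using greater by simp
    qed simp
    then have "ergodic_error circle_measure T (\<lambda>z. z ^ j * cnj z ^ k) =
        (\<lambda>N. \<integral>z. (norm (1 / of_nat N * (\<Sum>n=1..N. T n z ^ (j - k))))\<^sup>2 \<partial>circle_measure)"
      by (rule ext)
    moreover have "(\<lambda>N. \<integral>z. (norm (1 / of_nat N * (\<Sum>n=1..N. T n z ^ (j - k))))\<^sup>2 \<partial>circle_measure) \<longlonglongrightarrow> 0"
      using greater by (intro pow) simp
    moreover have "square_integrable circle_measure (\<lambda>z. z ^ j * cnj z ^ k)"
      by (intro sqi continuous_intros)
    ultimately show ?thesis
      by (simp only: ergodic_for_def)
  qed
  have borel_ind: "?P (indicator A)" if "A \<in> sets borel" for A
  proof (rule circle_class_indicator[where P = ?P, OF monom _ _ _ that])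
    show "?P (\<lambda>z. u z + v z)" if "?P u" "?P v" for u v
      by (rule circle.ergodic_for_add[OF T that])
    show "?P (\<lambda>z. c * u z)" if "?P u" for u c
      by (rule circle.ergodic_for_mult[OF T that])
    show "?P v" if u: "\<And>n::nat. ?P (u n)" and B: "\<And>n z. z \<in> sphere 0 1 \<Longrightarrow> norm (u n z) \<le> B"
      and lim: "\<And>z. z \<in> sphere 0 1 \<Longrightarrow> (\<lambda>n. u n z) \<longlonglongrightarrow> v z" for u v B
    proof (rule circle.ergodic_for_limit[OF T _ u])
      have [measurable]: "u n \<in> borel_measurable circle_measure" for n
        using u[of n] unfolding ergodic_for_def by (auto simp: square_integrable_def)
      have v_le: "norm (v z) \<le> B" if "z \<in> sphere 0 1" for z
        by (rule Lim_bounded[OF tendsto_norm[OF lim[OF that]], of 0]) (use B that in auto)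
      have [measurable]: "v \<in> borel_measurable circle_measure"
        by (rule borel_measurable_LIMSEQ_metric[of u]) (use lim in auto)
      show "square_integrable circle_measure v"
        by (rule circle.square_integrable_bounded[of _ B]) (use v_le in auto)
      have "(\<lambda>n. \<integral>z. (norm (v z - u n z))\<^sup>2 \<partial>circle_measure) \<longlonglongrightarrow> (\<integral>z. 0 \<partial>circle_measure)"
      proof (rule integral_dominated_convergence[where w = "\<lambda>_. (B + B)\<^sup>2"])
        show "AE z in circle_measure. (\<lambda>n. (norm (v z - u n z))\<^sup>2) \<longlonglongrightarrow> 0"
        proof (rule AE_I2)
          fix z assume "z \<in> space circle_measure"
          then have "(\<lambda>n. (norm (v z - u n z))\<^sup>2) \<longlonglongrightarrow> (norm (v z - v z))\<^sup>2"
            by (intro tendsto_intros lim) simp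
          then show "(\<lambda>n. (norm (v z - u n z))\<^sup>2) \<longlonglongrightarrow> 0" by simp
        qed
        show "AE z in circle_measure. norm ((norm (v z - u n z))\<^sup>2) \<le> (B + B)\<^sup>2" for n
        proof (rule AE_I2)
          fix z assume "z \<in> space circle_measure"
          then have "norm (v z - u n z) \<le> B + B"
            using v_le[of z] B[of z n] norm_triangle_ineq4[of "v z" "u n z"] by simp
          then show "norm ((norm (v z - u n z))\<^sup>2) \<le> (B + B)\<^sup>2"
            using power_mono[OF _ norm_ge_zero, of "v z - u n z" "B + B" 2] by simp
        qed
      qed auto
      then show "(\<lambda>n. \<integral>z. (norm (v z - u n z))\<^sup>2 \<partial>circle_measure) \<longlonglongrightarrow> 0" by simp
    qed
  qed
  fix \<phi> assume \<phi>: "square_integrable circle_measure \<phi>"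
  have "?P \<phi>"
  proof (rule circle.ergodic_for_of_indicators[OF T _ \<phi>])
    fix A assume A: "A \<in> sets circle_measure"
    then obtain S N N' where S: "A = S \<union> N" "N \<subseteq> N'" "N' \<in> null_sets circle_borel" "S \<in> sets circle_borel"
      unfolding circle_measure_eq by (rule sets_completionE)
    have "S \<in> sets borel"
      using S(4) by (auto simp: sets_circle_borel sets_restrict_space)
    then have 1: "?P (indicator S)" by (rule borel_ind)
    have 2: "(indicator A :: complex \<Rightarrow> complex) \<in> borel_measurable circle_measure"
      using A by simp
    \<comment> \<open>A completed set differs from its Borel part \<open>S\<close> only inside a
      Borel null set.\<close>
    have 3: "AE z in circle_measure. (indicator A z :: complex) = indicator S z"
      using AE_completion[OF AE_not_in[OF S(3)]] unfolding circle_measure_eq[symmetric]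
      by eventually_elim (use S(1,2) in \<open>auto simp: indicator_def\<close>)
    show "?P (indicator A)"
      by (rule circle.ergodic_for_AE_cong[OF T 1 2 3])
  qed
  then show "ergodic_error circle_measure T \<phi> \<longlonglongrightarrow> 0"
    unfolding ergodic_for_def by simp
qed

text \<open>The squared sum of \<open>N\<close> unimodular functions has \<open>N\<close> diagonal
  terms of size at most 1 and conjugate pairs of off-diagonal ones. As \<open>p m n\<close> is
  independent of \<open>k\<close>, one smallness condition settles all powers.\<close>

lemma ergodic_sequence_circle_of_correlations:
  assumes T: "\<And>n. n \<ge> 1 \<Longrightarrow> measure_preserving_map circle_measure (T n)"
    and corr: "\<And>k m n. 1 \<le> k \<Longrightarrow> 1 \<le> m \<Longrightarrow> m < n \<Longrightarrow>
      norm (\<integral>z. T n z ^ k * cnj (T m z) ^ k \<partial>circle_measure) \<le> p m n"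
    and small: "\<And>e. 0 < e \<Longrightarrow> \<exists>C\<ge>0. \<forall>n. (\<Sum>m\<in>{1..<n}. p m n) \<le> C + e * real n"
  shows "ergodic_sequence circle_measure T"
proof (rule ergodic_sequence_circle_of_powers[OF T])
  fix k :: nat assume k: "k \<ge> 1"
  have T_norm: "norm (T n z) = 1" if "n \<ge> 1" "z \<in> sphere 0 1" for n z
    using T[OF that(1)] measurable_space[of "T n" circle_measure circle_measure z] that
    by (simp add: measure_preserving_map_def)
  have T_meas: "T n \<in> borel_measurable circle_measure" if "n \<ge> 1" for n
  proof -
    have "(\<lambda>z. z) \<in> borel_measurable circle_measure"
      by (intro borel_measurable_circleI continuous_intros)
    moreover have "T n \<in> circle_measure \<rightarrow>\<^sub>M circle_measure"
      using T[OF that] by (simp add: measure_preserving_map_def)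
    ultimately have "(\<lambda>z. T n z) \<in> borel_measurable circle_measure"
      by (rule measurable_compose[rotated])
    then show ?thesis by simp
  qed
  define b where "b n m = (\<integral>z. T n z ^ k * cnj (T m z) ^ k \<partial>circle_measure)" for n m
  have int: "integrable circle_measure (\<lambda>z. T n z ^ k * cnj (T m z) ^ k)" if "n \<ge> 1" "m \<ge> 1" for n m
  proof (rule integrable_circle_bounded[where B = 1])
    show "norm (T n z ^ k * cnj (T m z) ^ k) \<le> 1" if "z \<in> sphere 0 1" for z
      using T_norm[OF \<open>n \<ge> 1\<close> that] T_norm[OF \<open>m \<ge> 1\<close> that] by (simp add: norm_mult norm_power)
  qed (intro borel_measurable_times borel_measurable_power borel_measurable_cnj T_meas that)
  have b_le: "norm (b n m) \<le> (if m < n then p m n else 0) + (if n < m then p n m else 0) + (if n = m then 1 else 0)"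
    if nm: "n \<ge> 1" "m \<ge> 1" for n m
  proof (cases n m rule: linorder_cases)
    case less
    have "b n m = cnj (b m n)"
      unfolding b_def by (simp add: mult.commute flip: Bochner_Integration.integral_cnj)
    then show ?thesis using corr[OF k nm(1) less] less by (simp add: b_def)
  next
    case equal
    have "norm (b n m) \<le> (\<integral>z. norm (T n z ^ k * cnj (T m z) ^ k) \<partial>circle_measure)"
      unfolding b_def by (rule integral_norm_bound)
    also have "\<dots> \<le> (\<integral>z. 1 \<partial>circle_measure)"
      by (intro integral_mono integrable_norm int nm)
        (use T_norm[OF nm(1)] T_norm[OF nm(2)] in \<open>auto simp: norm_mult norm_power\<close>)
    finally show ?thesis using equal by simp
  next
    case greater
    then show ?thesis using corr[OF k nm(2) greater] by (simp add: b_def)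
  qed
  define S where "S N = (\<Sum>n=1..N. \<Sum>m\<in>{1..<n}. p m n)" for N
  have expand: "(\<integral>z. (norm (1 / of_nat N * (\<Sum>n=1..N. T n z ^ k)))\<^sup>2 \<partial>circle_measure)
      \<le> (2 * S N + N) / (real N)\<^sup>2" for N
  proof -
    have "complex_of_real (\<integral>z. (norm (\<Sum>n=1..N. T n z ^ k))\<^sup>2 \<partial>circle_measure) =
        (\<integral>z. (\<Sum>n=1..N. \<Sum>m=1..N. T n z ^ k * cnj (T m z) ^ k) \<partial>circle_measure)"
      by (simp add: integral_complex_of_real[symmetric] complex_norm_square sum_product del: of_real_power)
    also have "\<dots> = (\<Sum>n=1..N. \<integral>z. (\<Sum>m=1..N. T n z ^ k * cnj (T m z) ^ k) \<partial>circle_measure)"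
      by (intro Bochner_Integration.integral_sum Bochner_Integration.integrable_sum int) auto
    also have "\<dots> = (\<Sum>n=1..N. \<Sum>m=1..N. b n m)"
      unfolding b_def by (intro sum.cong refl Bochner_Integration.integral_sum int) auto
    finally have "(\<integral>z. (norm (\<Sum>n=1..N. T n z ^ k))\<^sup>2 \<partial>circle_measure) = Re (\<Sum>n=1..N. \<Sum>m=1..N. b n m)"
      by (metis Re_complex_of_real)
    also have "\<dots> \<le> norm (\<Sum>n=1..N. \<Sum>m=1..N. b n m)" by (rule complex_Re_le_cmod)
    also have "\<dots> \<le> (\<Sum>n=1..N. \<Sum>m=1..N. (if m < n then p m n else 0) + (if n < m then p n m else 0) + (if n = m then 1 else 0))"
      by (intro sum_norm_le b_le order_trans[OF norm_sum] sum_mono) auto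
    also have "\<dots> = (\<Sum>n=1..N. \<Sum>m=1..N. if m < n then p m n else 0) + (\<Sum>n=1..N. \<Sum>m=1..N. if n < m then p n m else 0) + N"
      by (simp add: sum.distrib)
    also have "(\<Sum>n=1..N. \<Sum>m=1..N. if n < m then p n m else 0) = (\<Sum>n=1..N. \<Sum>m=1..N. if m < n then p m n else 0)"
      by (rule sum.swap)
    also have "(\<Sum>n=1..N. \<Sum>m=1..N. if m < n then p m n else 0) = S N"
      unfolding S_def
    proof (rule sum.cong)
      fix n assume n: "n \<in> {1..N}"
      have "(\<Sum>m=1..N. if m < n then p m n else 0) = (\<Sum>m\<in>{m \<in> {1..N}. m < n}. p m n)"
        by (rule sum.inter_filter[symmetric]) simp
      also have "{m \<in> {1..N}. m < n} = {1..<n}" using n by auto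
      finally show "(\<Sum>m=1..N. if m < n then p m n else 0) = (\<Sum>m\<in>{1..<n}. p m n)" .
    qed simp
    finally have "(\<integral>z. (norm (\<Sum>n=1..N. T n z ^ k))\<^sup>2 \<partial>circle_measure) \<le> 2 * S N + N" by simp
    then have "(\<integral>z. (norm (\<Sum>n=1..N. T n z ^ k))\<^sup>2 \<partial>circle_measure) / (real N)\<^sup>2 \<le> (2 * S N + N) / (real N)\<^sup>2"
      by (rule divide_right_mono) simp
    moreover have "(\<integral>z. (norm (1 / of_nat N * (\<Sum>n=1..N. T n z ^ k)))\<^sup>2 \<partial>circle_measure) =
        (\<integral>z. (norm (\<Sum>n=1..N. T n z ^ k))\<^sup>2 \<partial>circle_measure) / (real N)\<^sup>2"
      by (simp add: norm_mult norm_divide power_divide)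
    ultimately show ?thesis by simp
  qed
  show "(\<lambda>N. \<integral>z. (norm (1 / of_nat N * (\<Sum>n=1..N. T n z ^ k)))\<^sup>2 \<partial>circle_measure) \<longlonglongrightarrow> 0"
  proof (rule LIMSEQ_I)
    fix e :: real assume e: "e > 0"
    \<comment> \<open>Summed over \<open>n\<close> and doubled, \<open>e / 4\<close> becomes
      \<open>e / 2\<close> times the square of \<open>N\<close>; the other half is reserved for
      terms linear in \<open>N\<close>.\<close>
    obtain C where C: "C \<ge> 0" "\<And>n. (\<Sum>m\<in>{1..<n}. p m n) \<le> C + (e / 4) * real n"
      using small[of "e / 4"] e by auto
    have S_le: "S N \<le> N * (C + e / 4 * N)" for N
    proof -
      have "S N \<le> (\<Sum>n=1..N. C + e / 4 * real N)"
        unfolding S_def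
      proof (rule sum_mono)
        fix n assume "n \<in> {1..N}"
        then have "e / 4 * real n \<le> e / 4 * real N" using e by (intro mult_left_mono) auto
        then show "(\<Sum>m\<in>{1..<n}. p m n) \<le> C + e / 4 * real N" using C(2)[of n] by linarith
      qed
      then show ?thesis by simp
    qed
    \<comment> \<open>Chosen so that the linear term \<open>(2 * C + 1) * N\<close> stays below that
      other half.\<close>
    obtain N0 where N0: "2 * (2 * C + 1) / e < real N0"
      using reals_Archimedean2 by blast
    have "norm ((\<integral>z. (norm (1 / of_nat N * (\<Sum>n=1..N. T n z ^ k)))\<^sup>2 \<partial>circle_measure) - 0) < e"
      if N: "N \<ge> N0" for N
    proof -
      have "0 < 2 * (2 * C + 1) / e" using C e by simp
      then have N_pos: "real N > 0" using N0 N by linarith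
      have "2 * (2 * C + 1) / e < real N" using N0 N by linarith
      then have small': "2 * (2 * C + 1) < real N * e" using e by (simp add: divide_less_eq)
      have "2 * S N + N \<le> N * (2 * C + 1 + e / 2 * N)"
        using S_le[of N] by (simp add: algebra_simps)
      also have "\<dots> < N * (e * N)"
        using small' N_pos by (intro mult_strict_left_mono) (auto simp: mult.commute)
      finally have "(2 * S N + N) / (real N)\<^sup>2 < e"
        using N_pos by (simp add: divide_less_eq power2_eq_square mult_ac)
      then show ?thesis using expand[of N] by simp
    qed
    then show "\<exists>N0. \<forall>N\<ge>N0. norm ((\<integral>z. (norm (1 / of_nat N * (\<Sum>n=1..N. T n z ^ k)))\<^sup>2 \<partial>circle_measure) - 0) < e"
      by blast
  qed
qed

section \<open>Compositions of inner functions\<close>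

lemma iter_comp_add:
  "iter_comp g (m + d) = iter_comp (\<lambda>j. g (m + j)) d \<circ> iter_comp g m"
  by (induction d) (simp_all add: comp_assoc)

text \<open>All maps fix 0, so the chain rule evaluates every derivative there. The lemma is meant
  for shifted sequences, where it describes the block leading from one iterate to a later
  one.\<close>

lemma iter_comp_self_map:
  fixes g :: "nat \<Rightarrow> complex \<Rightarrow> complex"
  assumes "\<And>n. n \<ge> 1 \<Longrightarrow> g n holomorphic_on ball 0 1" "\<And>n. n \<ge> 1 \<Longrightarrow> g n ` ball 0 1 \<subseteq> ball 0 1"
    and "\<And>n. n \<ge> 1 \<Longrightarrow> g n 0 = 0"
  shows "iter_comp g n holomorphic_on ball 0 1 \<and> iter_comp g n ` ball 0 1 \<subseteq> ball 0 1 \<and>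
    iter_comp g n 0 = 0 \<and> deriv (iter_comp g n) 0 = (\<Prod>j=1..n. deriv (g j) 0)"
proof (induction n)
  case 0
  then show ?case by (simp add: id_def)
next
  case (Suc n)
  note g = assms[of "Suc n", simplified]
  have hol: "iter_comp g n holomorphic_on ball 0 1" and img: "iter_comp g n ` ball 0 1 \<subseteq> ball 0 1"
    and z: "iter_comp g n 0 = 0" and d: "deriv (iter_comp g n) 0 = (\<Prod>j=1..n. deriv (g j) 0)"
    using Suc by auto
  show ?case
    unfolding iter_comp.simps
  proof (intro conjI)
    show "(g (Suc n) \<circ> iter_comp g n) holomorphic_on ball 0 1"
      by (rule holomorphic_on_compose_gen[OF hol g(1) img])
    show "(g (Suc n) \<circ> iter_comp g n) ` ball 0 1 \<subseteq> ball 0 1"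
      using g(2) img unfolding image_comp[symmetric] by blast
    show "(g (Suc n) \<circ> iter_comp g n) 0 = 0"
      using g(3) z by simp
    have "deriv (g (Suc n) \<circ> iter_comp g n) 0 = deriv (g (Suc n)) 0 * deriv (iter_comp g n) 0"
      using holomorphic_on_imp_differentiable_at[OF hol] holomorphic_on_imp_differentiable_at[OF g(1)] z
      by (subst deriv_chain) auto
    also have "\<dots> = (\<Prod>j=1..Suc n. deriv (g j) 0)"
      by (simp add: d mult.commute)
    finally show "deriv (g (Suc n) \<circ> iter_comp g n) 0 = (\<Prod>j=1..Suc n. deriv (g j) 0)" .
  qed
qed

text \<open>The general \<open>r\<close> covers both claims: the identity for ergodicity, any
  strictly increasing sequence for mixing. The block between the iterates \<open>r m\<close> and
  \<open>r n\<close> composes the maps with indices in \<open>{r m<..r n}\<close>, which gives the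
  products in \<open>small\<close>.\<close>

lemma ergodic_sequence_iter_comp:
  fixes g :: "nat \<Rightarrow> complex \<Rightarrow> complex"
  assumes inner: "\<And>n. n \<ge> 1 \<Longrightarrow> inner_function (g n)" and zero: "\<And>n. n \<ge> 1 \<Longrightarrow> g n 0 = 0"
    and r: "strict_mono r"
    and small: "\<And>e. 0 < e \<Longrightarrow> \<exists>C\<ge>0. \<forall>n. (\<Sum>m\<in>{1..<n}. \<Prod>j\<in>{r m<..r n}. norm (deriv (g j) 0)) \<le> C + e * real n"
  shows "ergodic_sequence circle_measure (\<lambda>n. boundary_map (iter_comp g (r n)))"
proof -
  note gD = inner_functionD[OF inner]
  have iter: "inner_function (iter_comp g n) \<and> iter_comp g n 0 = 0" for n
  proof (induction n)
    case 0
    have "((\<lambda>r. of_real r * z) \<longlongrightarrow> of_real 1 * z) (at_left (1::real))" for z :: complex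
      by (intro tendsto_intros)
    then show ?case
      unfolding inner_function_def by (auto intro!: AE_I2 exI)
  next
    case (Suc n)
    have "inner_function (g (Suc n) \<circ> iter_comp g n)"
      using Suc inner by (intro inner_function_comp) auto
    moreover have "(g (Suc n) \<circ> iter_comp g n) 0 = 0"
      using Suc zero by simp
    ultimately show ?case
      unfolding iter_comp.simps ..
  qed
  have deriv_le: "norm (deriv (g j) 0) \<le> 1" if "j \<ge> 1" for j
    by (rule Schwarz_Lemma(2)[OF gD(1)[OF that] zero[OF that] gD(2)[OF that], of 0]) auto
  show ?thesis
  proof (rule ergodic_sequence_circle_of_correlations[OF _ _ small])
    show "measure_preserving_map circle_measure (boundary_map (iter_comp g (r n)))" for n
      using iter by (intro boundary_map_measure_preserving) auto
    fix k m n :: nat assume k: "1 \<le> k" and m: "1 \<le> m" "m < n"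
    define d where "d = r n - r m"
    have rn: "r n = r m + d" using strict_monoD[OF r m(2)] by (simp add: d_def)
    define h where "h = iter_comp (\<lambda>j. g (r m + j)) d"
    have h: "h holomorphic_on ball 0 1" "h ` ball 0 1 \<subseteq> ball 0 1" "h 0 = 0"
      "deriv h 0 = (\<Prod>j=1..d. deriv (g (r m + j)) 0)"
      unfolding h_def using iter_comp_self_map[of "\<lambda>j. g (r m + j)" d] gD zero by auto
    have comp: "iter_comp g (r n) = h \<circ> iter_comp g (r m)"
      unfolding rn h_def by (rule iter_comp_add)
    have "(\<integral>z. boundary_map (iter_comp g (r n)) z ^ k * cnj (boundary_map (iter_comp g (r m)) z) ^ k \<partial>circle_measure)
        = deriv h 0 ^ k"
      unfolding comp using iter[of "r m"] iter[of "r n"] h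
      by (intro integral_boundary_comp_cnj_power) (auto simp: comp)
    \<comment> \<open>The place where the bound becomes independent of \<open>k\<close>.\<close>
    also have "norm (deriv h 0 ^ k) \<le> norm (deriv h 0)"
    proof -
      have "norm (deriv h 0) \<le> 1"
        unfolding h(4) prod_norm[symmetric] using deriv_le by (intro prod_le_1) auto
      then show ?thesis
        using k power_decreasing[of 1 k "norm (deriv h 0)"] by (simp add: norm_power)
    qed
    also have "norm (deriv h 0) = (\<Prod>j\<in>{r m<..r n}. norm (deriv (g j) 0))"
      unfolding h(4) prod_norm[symmetric]
      by (rule prod.reindex_bij_witness[of _ "\<lambda>j. j - r m" "\<lambda>j. r m + j"]) (auto simp: rn)
    finally show "norm (\<integral>z. boundary_map (iter_comp g (r n)) z ^ k * cnj (boundary_map (iter_comp g (r m)) z) ^ k \<partial>circle_measure)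
        \<le> (\<Prod>j\<in>{r m<..r n}. norm (deriv (g j) 0))" .
  qed
qed

theorem corollary1p4:
  fixes g :: "nat \<Rightarrow> complex \<Rightarrow> complex"
  assumes inner: "\<And>n. n \<ge> 1 \<Longrightarrow> inner_function (g n)"
    and zero: "\<And>n. n \<ge> 1 \<Longrightarrow> g n 0 = 0"
  shows "((\<forall>\<epsilon>::real. 0 < \<epsilon> \<and> \<epsilon> < 1 \<longrightarrow>
            (\<lambda>N::nat. \<Prod>k = nat \<lfloor>real N * (1 - \<epsilon>)\<rfloor>..N. deriv (g k) 0) \<longlonglongrightarrow> 0)
          \<longrightarrow> ergodic_sequence circle_measure (\<lambda>n. boundary_map (iter_comp g n)))
       \<and> ((\<forall>\<epsilon>::real. \<epsilon> > 0 \<longrightarrow>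
            (\<exists>M\<^sub>0::nat. \<forall>N M::nat. N > M \<and> M > M\<^sub>0 \<longrightarrow>
               (\<Prod>k = N - M..N. norm (deriv (g k) 0)) < \<epsilon>))
          \<longrightarrow> mixing_sequence circle_measure (\<lambda>n. boundary_map (iter_comp g n)))"
proof (intro conjI impI)
  note gD = inner_functionD[OF inner]
  define a where "a j = norm (deriv (g j) 0)" for j
  have a_le: "a j \<le> 1" if "j \<ge> 1" for j
    unfolding a_def by (rule Schwarz_Lemma(2)[OF gD(1)[OF that] zero[OF that] gD(2)[OF that], of 0]) auto
  have a0: "0 \<le> a j" for j by (simp add: a_def)
  \<comment> \<open>Index 0 must stay out, because nothing is known about
    \<open>g 0\<close>.\<close>
  have prod_le_1: "prod a A \<le> 1" if "\<And>j. j \<in> A \<Longrightarrow> j \<ge> 1" for A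
    using that a_le a0 by (intro prod_le_1) auto
  have prod_mono_set: "prod a B \<le> prod a A" if "finite B" "A \<subseteq> B" "\<And>j. j \<in> B \<Longrightarrow> j \<ge> 1" for A B
  proof -
    have "prod a B = prod a (B - A) * prod a A"
      using that by (intro prod.subset_diff) auto
    also have "\<dots> \<le> 1 * prod a A"
      using that by (intro mult_right_mono prod_le_1 prod_nonneg a0) auto
    finally show ?thesis by simp
  qed
  { assume lim: "\<forall>\<epsilon>::real. 0 < \<epsilon> \<and> \<epsilon> < 1 \<longrightarrow>
            (\<lambda>N::nat. \<Prod>k = nat \<lfloor>real N * (1 - \<epsilon>)\<rfloor>..N. deriv (g k) 0) \<longlonglongrightarrow> 0"
    show "ergodic_sequence circle_measure (\<lambda>n. boundary_map (iter_comp g n))"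
    proof (rule ergodic_sequence_iter_comp[OF inner zero, of "\<lambda>n. n"])
      fix e :: real assume e: "0 < e"
      \<comment> \<open>\<open>\<epsilon>\<close> is spent twice, as the size of the products for
        distant \<open>m\<close> and as the proportion of near \<open>m\<close>; hence at most half
        of \<open>e\<close>. The 1/2 keeps it below 1.\<close>
      define \<epsilon> where "\<epsilon> = min (e / 2) (1 / 2)"
      have \<epsilon>: "0 < \<epsilon>" "\<epsilon> < 1" "2 * \<epsilon> \<le> e" using e by (auto simp: \<epsilon>_def)
      define L where "L n = nat \<lfloor>real n * (1 - \<epsilon>)\<rfloor>" for n
      have "(\<lambda>n. norm (\<Prod>k = L n..n. deriv (g k) 0)) \<longlonglongrightarrow> 0"
        using lim \<epsilon> unfolding L_def by (intro tendsto_norm_zero) auto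
      then have "(\<lambda>n. prod a {L n..n}) \<longlonglongrightarrow> 0"
        by (simp add: a_def prod_norm)
      then obtain N0 where N0: "\<And>n. n \<ge> N0 \<Longrightarrow> prod a {L n..n} < \<epsilon>"
        using order_tendstoD(2)[of _ 0 sequentially \<epsilon>] \<epsilon> by (auto simp: eventually_sequentially)
      \<comment> \<open>The constant absorbs all \<open>n\<close> below \<open>N0\<close>, where
        each product is merely at most 1, and for larger \<open>n\<close> the rounding in
        \<open>L n\<close>.\<close>
      have "(\<Sum>m\<in>{1..<n}. prod a {m<..n}) \<le> (real N0 + 1) + e * real n" for n
      proof (cases "n \<ge> N0")
        case False
        have "(\<Sum>m\<in>{1..<n}. prod a {m<..n}) \<le> (\<Sum>m\<in>{1..<n}. 1)"
          by (intro sum_mono prod_le_1) auto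
        also have "\<dots> \<le> real N0 + 1" using False by simp
        also have "\<dots> \<le> (real N0 + 1) + e * real n" using e by simp
        finally show ?thesis .
      next
        case True
        have Ln: "L n \<le> n"
        proof -
          have "real n * (1 - \<epsilon>) \<le> real n * 1" using \<epsilon> by (intro mult_left_mono) auto
          then show ?thesis unfolding L_def by linarith
        qed
        have "(\<Sum>m\<in>{1..<n}. prod a {m<..n}) \<le> (\<Sum>m\<in>{1..<n}. \<epsilon> + (if L n \<le> m then 1 else 0))"
        proof (rule sum_mono)
          fix m assume m: "m \<in> {1..<n}"
          show "prod a {m<..n} \<le> \<epsilon> + (if L n \<le> m then 1 else 0)"
          proof (cases "L n \<le> m")
            case True
            have "prod a {m<..n} \<le> 1" by (intro prod_le_1) auto
            then show ?thesis using True \<epsilon> by simp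
          next
            case False
            \<comment> \<open>For \<open>m < L n\<close> the left product has more factors, each of
              modulus at most 1. Only positive indices occur, since \<open>m\<close> is at least
              1.\<close>
            then have "prod a {m<..n} \<le> prod a {L n..n}"
              by (intro prod_mono_set) auto
            then show ?thesis using N0[OF True] False by simp
          qed
        qed
        also have "\<dots> = \<epsilon> * real (n - 1) + (\<Sum>m\<in>{1..<n}. if L n \<le> m then 1 else 0)"
          by (simp add: sum.distrib mult.commute)
        \<comment> \<open>The number of near indices is at most \<open>n - L n\<close>; the
          additional 1 is lost to the floor.\<close>
        also have "(\<Sum>m\<in>{1..<n}. if L n \<le> m then 1 else 0 :: real) \<le> \<epsilon> * real n + 1"
        proof -
          have "(\<Sum>m\<in>{1..<n}. if L n \<le> m then 1 else 0 :: real) = (\<Sum>m\<in>{m\<in>{1..<n}. L n \<le> m}. 1)"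
            by (rule sum.inter_filter[symmetric]) simp
          also have "\<dots> \<le> (\<Sum>m\<in>{L n..<n}. 1)"
            by (intro sum_mono2) auto
          also have "\<dots> = real n - real (L n)" using Ln by (simp add: of_nat_diff)
          also have "real n * (1 - \<epsilon>) - 1 \<le> real (L n)"
            unfolding L_def by linarith
          then have "real n - real (L n) \<le> \<epsilon> * real n + 1"
            by (simp add: algebra_simps)
          finally show ?thesis .
        qed
        also have "\<epsilon> * real (n - 1) + (\<epsilon> * real n + 1) \<le> 2 * \<epsilon> * real n + 1"
        proof -
          have "\<epsilon> * real (n - 1) \<le> \<epsilon> * real n" using \<epsilon> by (intro mult_left_mono) auto
          then show ?thesis by simp
        qed
        also have "\<dots> \<le> e * real n + 1"
          using \<epsilon> by (intro add_right_mono mult_right_mono) auto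
        also have "\<dots> \<le> (real N0 + 1) + e * real n" by simp
        finally show ?thesis by simp
      qed
      then show "\<exists>C\<ge>0. \<forall>n. (\<Sum>m\<in>{1..<n}. \<Prod>j\<in>{m<..n}. norm (deriv (g j) 0)) \<le> C + e * real n"
        unfolding a_def by (intro exI[of _ "real N0 + 1"]) auto
    qed (auto simp: strict_mono_def)
  }
  { assume small: "\<forall>\<epsilon>::real. \<epsilon> > 0 \<longrightarrow>
            (\<exists>M\<^sub>0::nat. \<forall>N M::nat. N > M \<and> M > M\<^sub>0 \<longrightarrow>
               (\<Prod>k = N - M..N. norm (deriv (g k) 0)) < \<epsilon>)"
    show "mixing_sequence circle_measure (\<lambda>n. boundary_map (iter_comp g n))"
      unfolding mixing_sequence_def
    proof (intro allI impI)
      fix r :: "nat \<Rightarrow> nat" assume r: "strict_mono r"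
      show "ergodic_sequence circle_measure (\<lambda>n. boundary_map (iter_comp g (r n)))"
      proof (rule ergodic_sequence_iter_comp[OF inner zero r])
        fix e :: real assume e: "0 < e"
        then obtain M0 where M0: "\<And>N M. M < N \<Longrightarrow> M0 < M \<Longrightarrow> prod a {N - M..N} < e"
          using small unfolding a_def by blast
        \<comment> \<open>Pairs with \<open>n - m < M0 + 2\<close> are bounded by 1 each, and for
          given \<open>n\<close> there are at most \<open>M0 + 2\<close> of them; all others have
          products below \<open>e\<close>.\<close>
        have "(\<Sum>m\<in>{1..<n}. prod a {r m<..r n}) \<le> real (M0 + 2) + e * real n" for n
        proof -
          have "(\<Sum>m\<in>{1..<n}. prod a {r m<..r n}) \<le> (\<Sum>m\<in>{1..<n}. e + (if n < m + (M0 + 2) then 1 else 0))"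
          proof (rule sum_mono)
            fix m assume m: "m \<in> {1..<n}"
            show "prod a {r m<..r n} \<le> e + (if n < m + (M0 + 2) then 1 else 0)"
            proof (cases "n < m + (M0 + 2)")
              case True
              have "prod a {r m<..r n} \<le> 1" by (intro prod_le_1) auto
              then show ?thesis using True e by simp
            next
              case False
              \<comment> \<open>Each step of \<open>r\<close> gains at least 1, so distant pairs
                stay distant along the subsequence.\<close>
              have "r m + (n - m) \<le> r n"
              proof -
                have "r m + d \<le> r (m + d)" for d
                proof (induction d)
                  case (Suc d)
                  have "r (m + d) < r (m + Suc d)" by (intro strict_monoD[OF r]) simp
                  with Suc show ?case by simp
                qed simp
                from this[of "n - m"] m show ?thesis by simp
              qed
              \<comment> \<open>The half-open range starts at \<open>Suc (r m)\<close>, so it is the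
                range of the hypothesis with \<open>M = r n - r m - 1\<close>. Requiring
                \<open>M0 < M\<close> is what makes \<open>M0 + 2\<close> the threshold on the
                gap.\<close>
              then have "M0 < r n - r m - 1" "r n - r m - 1 < r n" "r n - (r n - r m - 1) = Suc (r m)"
                using False m by linarith+
              moreover have "{r m<..r n} = {Suc (r m)..r n}" by auto
              ultimately have "prod a {r m<..r n} < e"
                using M0[of "r n - r m - 1" "r n"] by simp
              then show ?thesis using False by simp
            qed
          qed
          also have "\<dots> = e * real (n - 1) + (\<Sum>m\<in>{1..<n}. if n < m + (M0 + 2) then 1 else 0)"
            by (simp add: sum.distrib mult.commute)
          also have "(\<Sum>m\<in>{1..<n}. if n < m + (M0 + 2) then 1 else 0 :: real) \<le> real (M0 + 2)"
          proof -
            have "(\<Sum>m\<in>{1..<n}. if n < m + (M0 + 2) then 1 else 0 :: real) = (\<Sum>m\<in>{m\<in>{1..<n}. n < m + (M0 + 2)}. 1)"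
              by (rule sum.inter_filter[symmetric]) simp
            also have "\<dots> \<le> (\<Sum>m\<in>{n - (M0 + 2)..<n}. 1)"
              by (intro sum_mono2) auto
            also have "\<dots> \<le> real (M0 + 2)" by simp
            finally show ?thesis .
          qed
          also have "e * real (n - 1) + real (M0 + 2) \<le> real (M0 + 2) + e * real n"
            using e by (simp add: mult_left_mono)
          finally show ?thesis by simp
        qed
        then show "\<exists>C\<ge>0. \<forall>n. (\<Sum>m\<in>{1..<n}. \<Prod>j\<in>{r m<..r n}. norm (deriv (g j) 0)) \<le> C + e * real n"
          unfolding a_def by (intro exI[of _ "real (M0 + 2)"]) auto
      qed
    qed
  }
qed

end
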